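(* Let $X$ be a nonempty set and let $\mathcal{A}$ be a countably generated and uniformly closed algebra of bounded real-valued functions on $X$ that separates the points of $X$. Let $\mathcal{E}:\mathcal{A}\to[0,+\infty]$ be a sup-norm-separable, $\sigma$-finite and sup-norm-lower semicontinuous quadratic form on $\mathcal{A}$ on which normal contractions operate, and let $$\mathcal{D}=\{f\in\mathcal{A}:\mathcal{E}(f)<+\infty\}$$ be its effective domain. Then there exist a locally compact separable metric space $Y$, a nonnegative Radon measure $\nu$ on $Y$ with full support, a regular Dirichlet form $(\hat{\mathcal{E}},\hat{\mathcal{F}})$ on $L^2(Y,\nu)$, an algebra $\hat{\mathcal{D}}$ of continuous functions on $Y$ contained in the domain $\hat{\mathcal{F}}$ of $\hat{\mathcal{E}}$, and a bijection $f\mapsto\hat f$ from $\mathcal{D}$ onto $\hat{\mathcal{D}}$ such that: (1) $f\mapsto\hat f$ is an isomorphism of algebras and preserves the supremum norm, i.e. $\sup_{y\in Y}|\hat f(y)|=\sup_{x\in X}|f(x)|$ for all $f\in\mathcal{D}$; (2) $\hat{\mathcal{E}}(\hat f)=\mathcal{E}(f)$ for all $f\in\mathcal{D}$; (3) $\hat{\mathcal{D}}$ contains a core for $(\hat{\mathcal{E}},\hat{\mathcal{F}})$.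
   Context: Algebra operations on functions are pointwise. An algebra $\mathcal{A}$ of bounded real-valued functions on $X$ is uniformly closed if it is complete with respect to the supremum norm; a sequence $\{f_n\}\subset\mathcal{A}$ generates $\mathcal{A}$ if $\mathcal{A}$ is the smallest uniformly closed algebra (not necessarily containing the constants) of bounded real-valued functions on $X$ containing all $f_n$; $\mathcal{A}$ is countably generated if such a sequence exists. A quadratic form $\mathcal{E}:\mathcal{A}\to[0,+\infty]$ satisfies $\mathcal{E}(0)=0$, $\mathcal{E}(af)=a^2\mathcal{E}(f)$ for real $a\ne 0$, and the parallelogram law $\mathcal{E}(f+g)+\mathcal{E}(f-g)=2\mathcal{E}(f)+2\mathcal{E}(g)$. It is called: - sup-norm-separable if there is a sequence $\{f_n\}_{n=1}^\infty\subset\mathcal{A}$ generating $\mathcal{A}$ with $\mathcal{E}(f_n)<+\infty$ for all $n$; - $\sigma$-finite if $\mathcal{A}$ contains a strictly positive function $\chi$ with $\mathcal{E}(\chi)<+\infty$; - sup-norm-lower semicontinuous on $\mathcal{A}$ if $\mathcal{E}(f)\le\liminf_n\mathcal{E}(f_n)$ for any sequence $(f_n)_n\subset\mathcal{A}$ converging uniformly to $f\in\mathcal{A}$. A normal contraction (in several variables) is a function $F:\mathbb{R}^k\to\mathbb{R}$ with $F(0)=0$ and $|F(x)-F(y)|\le\sum_{i=1}^k|x_i-y_i|$ for all $x,y\in\mathbb{R}^k$. Normal contractions operate on $\mathcal{E}$ if $\mathcal{E}(F(f_1,\dots,f_k))^{1/2}\le\sum_{i=1}^k\mathcal{E}(f_i)^{1/2}$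 for all $k$, all $f_1,\dots,f_k\in\mathcal{A}$ and all normal contractions $F:\mathbb{R}^k\to\mathbb{R}$. A Dirichlet form $(\mathcal{E},\mathcal{F})$ on a real space $L^2(X,\mathcal{X},\mu)$ over a $\sigma$-finite measure space is a symmetric, bilinear, nonnegative definite real-valued form $\mathcal{E}$ on a dense subspace $\mathcal{F}$ such that $\mathcal{F}$ with the norm $(\mathcal{E}(f)+\|f\|_{L^2}^2)^{1/2}$ is a Hilbert space and for any $f\in\mathcal{F}$ one has $(f\wedge1)\vee0\in\mathcal{F}$ and $\mathcal{E}((f\wedge1)\vee0)\le\mathcal{E}(f)$. Here $\mathcal{E}(f):=\mathcal{E}(f,f)$. If $Y$ is a locally compact separable metric space with its Borel $\sigma$-algebra and $\nu$ is a nonnegative Radon measure on $Y$ with full support, a core for a Dirichlet form $(\mathcal{E},\mathcal{F})$ on $L^2(Y,\nu)$ is a subset $\mathcal{C}\subset C_c(Y)\cap\mathcal{F}$ that is dense in the Hilbert space $\mathcal{F}$ and dense in $C_c(Y)$ with respect to the supremum norm; the Dirichlet form is regular if it has a core. $C_c(Y)$ is the space of continuous compactly supported real functions. *)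

theory Defs
  imports "HOL-Analysis.Analysis"
begin

section \<open>Algebras of real-valued functions\<close>

definition function_algebra :: "('a \<Rightarrow> real) set \<Rightarrow> bool" where
  "function_algebra A \<longleftrightarrow>
     (\<lambda>x. 0) \<in> A \<and>
     (\<forall>f\<in>A. \<forall>g\<in>A. (\<lambda>x. f x + g x) \<in> A) \<and>
     (\<forall>c. \<forall>f\<in>A. (\<lambda>x. c * f x) \<in> A) \<and>
     (\<forall>f\<in>A. \<forall>g\<in>A. (\<lambda>x. f x * g x) \<in> A)"

definition algebra_isomorphism ::
  "('a \<Rightarrow> real) set \<Rightarrow> ('b \<Rightarrow> real) set \<Rightarrow> (('a \<Rightarrow> real) \<Rightarrow> 'b \<Rightarrow> real) \<Rightarrow> bool" where
  "algebra_isomorphism A B \<Phi> \<longleftrightarrow>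
     function_algebra A \<and> function_algebra B \<and> bij_betw \<Phi> A B \<and>
     (\<forall>f\<in>A. \<forall>g\<in>A. \<Phi> (\<lambda>x. f x + g x) = (\<lambda>y. \<Phi> f y + \<Phi> g y)) \<and>
     (\<forall>c. \<forall>f\<in>A. \<Phi> (\<lambda>x. c * f x) = (\<lambda>y. c * \<Phi> f y)) \<and>
     (\<forall>f\<in>A. \<forall>g\<in>A. \<Phi> (\<lambda>x. f x * g x) = (\<lambda>y. \<Phi> f y * \<Phi> g y))"

definition bounded_function_algebra :: "('a \<Rightarrow> real) set \<Rightarrow> bool" where
  "bounded_function_algebra A \<longleftrightarrow> function_algebra A \<and> (\<forall>f\<in>A. bounded (range f))"

definition uniformly_closed :: "('a \<Rightarrow> real) set \<Rightarrow> bool" where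
  "uniformly_closed A \<longleftrightarrow>
     (\<forall>f :: nat \<Rightarrow> 'a \<Rightarrow> real. range f \<subseteq> A \<and> uniformly_Cauchy_on UNIV f \<longrightarrow>
        (\<exists>g\<in>A. uniform_limit UNIV f g sequentially))"

definition generates :: "(nat \<Rightarrow> 'a \<Rightarrow> real) \<Rightarrow> ('a \<Rightarrow> real) set \<Rightarrow> bool" where
  "generates f A \<longleftrightarrow>
     bounded_function_algebra A \<and> uniformly_closed A \<and> range f \<subseteq> A \<and>
     (\<forall>B. bounded_function_algebra B \<and> uniformly_closed B \<and> range f \<subseteq> B \<longrightarrow> A \<subseteq> B)"

definition countably_generated :: "('a \<Rightarrow> real) set \<Rightarrow> bool" where
  "countably_generated A \<longleftrightarrow> (\<exists>f. generates f A)"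

definition separates_points :: "('a \<Rightarrow> real) set \<Rightarrow> bool" where
  "separates_points A \<longleftrightarrow> (\<forall>x y. x \<noteq> y \<longrightarrow> (\<exists>f\<in>A. f x \<noteq> f y))"


section \<open>Quadratic forms with values in \<open>[0, \<infinity>]\<close>\<close>

text \<open>A form on \<open>A\<close> is a function on all of \<open>'a \<Rightarrow> real\<close>; its values outside \<open>A\<close> are irrelevant.\<close>

definition quadratic_form_on ::
  "('a \<Rightarrow> real) set \<Rightarrow> (('a \<Rightarrow> real) \<Rightarrow> ennreal) \<Rightarrow> bool" where
  "quadratic_form_on A E \<longleftrightarrow>
     E (\<lambda>x. 0) = 0 \<and>
     (\<forall>a f. a \<noteq> 0 \<and> f \<in> A \<longrightarrow> E (\<lambda>x. a * f x) = ennreal (a\<^sup>2) * E f) \<and>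
     (\<forall>f\<in>A. \<forall>g\<in>A. E (\<lambda>x. f x + g x) + E (\<lambda>x. f x - g x) = 2 * E f + 2 * E g)"

definition sup_norm_separable ::
  "('a \<Rightarrow> real) set \<Rightarrow> (('a \<Rightarrow> real) \<Rightarrow> ennreal) \<Rightarrow> bool" where
  "sup_norm_separable A E \<longleftrightarrow> (\<exists>f. generates f A \<and> (\<forall>n. E (f n) < \<infinity>))"

definition sigma_finite_form ::
  "('a \<Rightarrow> real) set \<Rightarrow> (('a \<Rightarrow> real) \<Rightarrow> ennreal) \<Rightarrow> bool" where
  "sigma_finite_form A E \<longleftrightarrow> (\<exists>h\<in>A. (\<forall>x. 0 < h x) \<and> E h < \<infinity>)"

definition sup_norm_lsc ::
  "('a \<Rightarrow> real) set \<Rightarrow> (('a \<Rightarrow> real) \<Rightarrow> ennreal) \<Rightarrow> bool" where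
  "sup_norm_lsc A E \<longleftrightarrow>
     (\<forall>f\<in>A. \<forall>g :: nat \<Rightarrow> 'a \<Rightarrow> real. range g \<subseteq> A \<and> uniform_limit UNIV g f sequentially \<longrightarrow>
        E f \<le> liminf (\<lambda>n. E (g n)))"

text \<open>
  Functions on \<open>\<real>\<^sup>k\<close> are functions of sequences. The Lipschitz condition forces \<open>F\<close> to depend
  on the first \<open>k\<close> coordinates only, so nothing else is quantified over.
\<close>

definition normal_contraction :: "nat \<Rightarrow> ((nat \<Rightarrow> real) \<Rightarrow> real) \<Rightarrow> bool" where
  "normal_contraction k F \<longleftrightarrow>
     F (\<lambda>i. 0) = 0 \<and> (\<forall>x y. \<bar>F x - F y\<bar> \<le> (\<Sum>i<k. \<bar>x i - y i\<bar>))"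

definition ennreal_sqrt :: "ennreal \<Rightarrow> ennreal" where
  "ennreal_sqrt a = (if a = \<infinity> then \<infinity> else ennreal (sqrt (enn2real a)))"

text \<open>
  If \<open>A\<close> is a uniformly closed algebra of bounded functions, then \<open>F(f\<^sub>1, \<dots>, f\<^sub>k)\<close> below belongs
  to \<open>A\<close> automatically, by the Weierstrass approximation theorem and \<open>F(0) = 0\<close>.
\<close>

definition normal_contractions_operate ::
  "('a \<Rightarrow> real) set \<Rightarrow> (('a \<Rightarrow> real) \<Rightarrow> ennreal) \<Rightarrow> bool" where
  "normal_contractions_operate A E \<longleftrightarrow>
     (\<forall>k F. \<forall>f :: nat \<Rightarrow> 'a \<Rightarrow> real. normal_contraction k F \<and> (\<forall>i<k. f i \<in> A) \<longrightarrow>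
        ennreal_sqrt (E (\<lambda>x. F (\<lambda>i. f i x))) \<le> (\<Sum>i<k. ennreal_sqrt (E (f i))))"

definition effective_domain ::
  "('a \<Rightarrow> real) set \<Rightarrow> (('a \<Rightarrow> real) \<Rightarrow> ennreal) \<Rightarrow> ('a \<Rightarrow> real) set" where
  "effective_domain A E = {f \<in> A. E f < \<infinity>}"


section \<open>Dirichlet forms\<close>

text \<open>
  Elements of \<open>L\<^sup>2\<close> are handled through their representatives: a subspace of \<open>L\<^sup>2\<close> is a set of
  square-integrable functions saturated under almost everywhere equality, and a form on such
  a subspace has to respect almost everywhere equality.
\<close>

definition square_integrable :: "'a measure \<Rightarrow> ('a \<Rightarrow> real) set" where
  "square_integrable M = {f \<in> borel_measurable M. integrable M (\<lambda>x. (f x)\<^sup>2)}"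

definition L2_norm :: "'a measure \<Rightarrow> ('a \<Rightarrow> real) \<Rightarrow> real" where
  "L2_norm M f = sqrt (\<integral>x. (f x)\<^sup>2 \<partial>M)"

definition L2_subspace :: "'a measure \<Rightarrow> ('a \<Rightarrow> real) set \<Rightarrow> bool" where
  "L2_subspace M F \<longleftrightarrow>
     F \<subseteq> square_integrable M \<and>
     (\<forall>f\<in>F. \<forall>g\<in>borel_measurable M. (AE x in M. f x = g x) \<longrightarrow> g \<in> F) \<and>
     (\<lambda>x. 0) \<in> F \<and>
     (\<forall>f\<in>F. \<forall>g\<in>F. (\<lambda>x. f x + g x) \<in> F) \<and>
     (\<forall>c. \<forall>f\<in>F. (\<lambda>x. c * f x) \<in> F)"

definition L2_dense :: "'a measure \<Rightarrow> ('a \<Rightarrow> real) set \<Rightarrow> bool" where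
  "L2_dense M F \<longleftrightarrow>
     (\<forall>f\<in>square_integrable M. \<forall>\<epsilon>>0. \<exists>g\<in>F. L2_norm M (\<lambda>x. f x - g x) < \<epsilon>)"

definition L2_bilinear_form ::
  "'a measure \<Rightarrow> (('a \<Rightarrow> real) \<Rightarrow> ('a \<Rightarrow> real) \<Rightarrow> real) \<Rightarrow> ('a \<Rightarrow> real) set \<Rightarrow> bool" where
  "L2_bilinear_form M E F \<longleftrightarrow>
     (\<forall>f\<in>F. \<forall>f'\<in>F. \<forall>g\<in>F. (AE x in M. f x = f' x) \<longrightarrow> E f g = E f' g) \<and>
     (\<forall>f\<in>F. \<forall>g\<in>F. E f g = E g f) \<and>
     (\<forall>f\<in>F. \<forall>g\<in>F. \<forall>h\<in>F. E (\<lambda>x. f x + g x) h = E f h + E g h) \<and>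
     (\<forall>c. \<forall>f\<in>F. \<forall>h\<in>F. E (\<lambda>x. c * f x) h = c * E f h) \<and>
     (\<forall>f\<in>F. 0 \<le> E f f)"

definition form_norm ::
  "'a measure \<Rightarrow> (('a \<Rightarrow> real) \<Rightarrow> ('a \<Rightarrow> real) \<Rightarrow> real) \<Rightarrow> ('a \<Rightarrow> real) \<Rightarrow> real" where
  "form_norm M E f = sqrt (E f f + (L2_norm M f)\<^sup>2)"

definition form_complete ::
  "'a measure \<Rightarrow> (('a \<Rightarrow> real) \<Rightarrow> ('a \<Rightarrow> real) \<Rightarrow> real) \<Rightarrow> ('a \<Rightarrow> real) set \<Rightarrow> bool" where
  "form_complete M E F \<longleftrightarrow>
     (\<forall>f :: nat \<Rightarrow> 'a \<Rightarrow> real.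
        range f \<subseteq> F \<and>
        (\<forall>\<epsilon>>0. \<exists>N. \<forall>m\<ge>N. \<forall>n\<ge>N. form_norm M E (\<lambda>x. f m x - f n x) < \<epsilon>) \<longrightarrow>
        (\<exists>g\<in>F. (\<lambda>n. form_norm M E (\<lambda>x. f n x - g x)) \<longlonglongrightarrow> 0))"

definition dirichlet_form ::
  "'a measure \<Rightarrow> (('a \<Rightarrow> real) \<Rightarrow> ('a \<Rightarrow> real) \<Rightarrow> real) \<Rightarrow> ('a \<Rightarrow> real) set \<Rightarrow> bool" where
  "dirichlet_form M E F \<longleftrightarrow>
     sigma_finite_measure M \<and> L2_subspace M F \<and> L2_dense M F \<and>
     L2_bilinear_form M E F \<and> form_complete M E F \<and>
     (\<forall>f\<in>F. (\<lambda>x. max (min (f x) 1) 0) \<in> F \<and>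
        E (\<lambda>x. max (min (f x) 1) 0) (\<lambda>x. max (min (f x) 1) 0) \<le> E f f)"


section \<open>Radon measures and regular Dirichlet forms\<close>

definition radon_measure :: "'b topology \<Rightarrow> 'b measure \<Rightarrow> bool" where
  "radon_measure T N \<longleftrightarrow>
     space N = topspace T \<and>
     sets N = sets (sigma (topspace T) {U. openin T U}) \<and>
     (\<forall>K. compactin T K \<longrightarrow> emeasure N K < \<infinity>) \<and>
     (\<forall>B\<in>sets N. emeasure N B = (SUP K\<in>{K. compactin T K \<and> K \<subseteq> B}. emeasure N K))"

definition full_support :: "'b topology \<Rightarrow> 'b measure \<Rightarrow> bool" where
  "full_support T N \<longleftrightarrow> (\<forall>U. openin T U \<and> U \<noteq> {} \<longrightarrow> 0 < emeasure N U)"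

text \<open>
  A real function on a topological space \<open>T\<close> is represented by the function on the ambient type
  that is \<open>0\<close> outside \<open>topspace T\<close>. This makes the representation unique and is compatible
  with the pointwise algebra operations.
\<close>

definition continuous_functions :: "'b topology \<Rightarrow> ('b \<Rightarrow> real) set" where
  "continuous_functions T =
     {f. continuous_map T euclideanreal f \<and> (\<forall>y. y \<notin> topspace T \<longrightarrow> f y = 0)}"

definition Cc :: "'b topology \<Rightarrow> ('b \<Rightarrow> real) set" where
  "Cc T = {f \<in> continuous_functions T. compactin T (T closure_of {y \<in> topspace T. f y \<noteq> 0})}"

text \<open>
  A separable metric space has at most continuum many points, so up to isometry its carrier may
  be taken to be a subset of \<open>nat \<Rightarrow> real\<close>, with an arbitrary metric. An existential statement
  about such spaces can hence be phrased with the single type \<open>(nat \<Rightarrow> real) metric\<close>.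
\<close>

definition form_core ::
  "'b topology \<Rightarrow> 'b measure \<Rightarrow> (('b \<Rightarrow> real) \<Rightarrow> ('b \<Rightarrow> real) \<Rightarrow> real) \<Rightarrow> ('b \<Rightarrow> real) set \<Rightarrow>
    ('b \<Rightarrow> real) set \<Rightarrow> bool" where
  "form_core T N E F C \<longleftrightarrow>
     C \<subseteq> Cc T \<inter> F \<and>
     (\<forall>f\<in>F. \<forall>\<epsilon>>0. \<exists>g\<in>C. form_norm N E (\<lambda>y. f y - g y) < \<epsilon>) \<and>
     (\<forall>f\<in>Cc T. \<forall>\<epsilon>>0. \<exists>g\<in>C. \<forall>y\<in>topspace T. \<bar>f y - g y\<bar> < \<epsilon>)"

definition regular_dirichlet_form ::
  "'b topology \<Rightarrow> 'b measure \<Rightarrow> (('b \<Rightarrow> real) \<Rightarrow> ('b \<Rightarrow> real) \<Rightarrow> real) \<Rightarrow> ('b \<Rightarrow> real) set \<Rightarrow> bool"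
  where
  "regular_dirichlet_form T N E F \<longleftrightarrow> dirichlet_form N E F \<and> (\<exists>C. form_core T N E F C)"

end

theory Submission
  imports Defs
begin

text \<open>
  The generators embed \<open>X\<close> into \<open>nat \<Rightarrow> real\<close>. Let \<open>K\<close> be the closure of the image together with the
  origin and \<open>Y = K - {0}\<close>; by Stone--Weierstrass \<open>A\<close> is the algebra of continuous functions on the
  compact set \<open>K\<close> that vanish at the origin.

  The sublevel set \<open>{E \<le> c}\<close> is convex, and by lower semicontinuity a function \<open>f\<close> with \<open>E f > c\<close>
  has positive uniform distance \<open>\<epsilon>\<close> from it. Minimax (Hahn--Banach for the sublinear functional
  \<open>h \<mapsto> sup h(K)\<close>, then Riesz) yields a measure of mass at most one on \<open>K\<close> for which the
  \<open>L\<^sup>1\<close>-distance is still at least \<open>\<epsilon>\<close>. As \<open>A\<close> is separable, countably many of these measures suffice.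
  With respect to a weighted sum \<open>\<nu>\<close> of them and of point masses at a dense sequence, \<open>E\<close> is
  \<open>L\<^sup>2(\<nu>)\<close>-lower semicontinuous on its effective domain.

  The Dirichlet form is the \<open>L\<^sup>2(\<nu>)\<close>-relaxation of \<open>E\<close> restricted to the functions with compact
  support in \<open>Y\<close>. Lower semicontinuity and truncation near the origin show that it extends \<open>E\<close>;
  completeness and the contraction property are immediate for a relaxation, and the parallelogram
  law makes the compactly supported functions dense in the form norm.
\<close>

section \<open>Linear functionals below a sublinear functional\<close>

text \<open>The difficulty is to trade uniform convergence for convergence in a single measure. A
  function whose energy exceeds \<open>c\<close> differs by a fixed amount from each member of the
  sublevel set at some point, but this point depends on the member. Minimax replaces the points by
  one measure that serves all members at once; it needs the sublevel set to be convex, which follows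
  from the parallelogram law. The functional is paired linearly with \<open>|f - h|\<close>, so the
  bound comes out in \<open>L^1\<close>; on a finite measure space it passes to \<open>L^2\<close>.
  Relaxing from the compactly supported functions alone makes them a core by construction. The price
  is to show that this smaller domain gives the same values: subtracting a clamp kills a
  neighbourhood of the origin without raising the energy. The hypotheses enter at separate places:
  finite energy of the generators makes the effective domain uniformly dense in \<open>A\<close>,
  contractions of two variables close it under products, and the strictly positive function keeps
  the points of \<open>X\<close> off the origin, so that removing the origin preserves supremum
  norms.\<close>

definition sublinear :: "('v::real_vector \<Rightarrow> real) \<Rightarrow> bool" where
  "sublinear p \<longleftrightarrow> (\<forall>u v. p (u + v) \<le> p u + p v) \<and> (\<forall>c v. 0 \<le> c \<longrightarrow> p (c *\<^sub>R v) = c * p v)"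

lemma sublinear_add: "sublinear p \<Longrightarrow> p (u + v) \<le> p u + p v"
  and sublinear_scale: "sublinear p \<Longrightarrow> 0 \<le> c \<Longrightarrow> p (c *\<^sub>R v) = c * p v"
  by (auto simp: sublinear_def)

lemma sublinear_zero: "sublinear p \<Longrightarrow> p 0 = 0"
  using sublinear_scale[of p 0 0] by simp

lemma sublinear_uminus: "sublinear p \<Longrightarrow> - p (- v) \<le> p v"
  using sublinear_add[of p v "-v"] sublinear_zero[of p] by simp

text \<open>The reverse inequality in homogeneity is the assumed one for the factor
  \<open>1/c\<close> at the vector scaled by \<open>c\<close>.\<close>

lemma sublinearI:
  assumes "\<And>u v. p (u + v) \<le> p u + p v" "p 0 = 0" "\<And>c v. 0 < c \<Longrightarrow> p (c *\<^sub>R v) \<le> c * p v"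
  shows "sublinear p"
  unfolding sublinear_def
proof (intro conjI allI impI)
  show "p (u + v) \<le> p u + p v" for u v by (rule assms)
  fix c :: real and v assume "0 \<le> c"
  show "p (c *\<^sub>R v) = c * p v"
  proof (cases "c = 0")
    case False
    with \<open>0 \<le> c\<close> have c: "0 < c" by simp
    have "p ((1/c) *\<^sub>R (c *\<^sub>R v)) \<le> 1/c * p (c *\<^sub>R v)"
      using c by (intro assms) auto
    then have "c * p v \<le> p (c *\<^sub>R v)" using c by (simp add: field_simps)
    with assms(3)[OF c, of v] show ?thesis by simp
  qed (simp add: assms)
qed

text \<open>Infimal convolution with the cone: \<open>q v\<close> is the infimum of
  \<open>p (v + g)\<close> over \<open>G\<close>. It is finite because
  \<open>p (v + g) >= p g - p (- v) >= - p (- v)\<close>. A linear functional below it is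
  nonnegative on \<open>G\<close>, since \<open>q (- g) <= p 0 = 0\<close>.\<close>

lemma sublinear_below_cone:
  fixes p :: "'v::real_vector \<Rightarrow> real"
  assumes p: "sublinear p" and G0: "0 \<in> G"
    and Gadd: "\<And>g h. g \<in> G \<Longrightarrow> h \<in> G \<Longrightarrow> g + h \<in> G"
    and Gscale: "\<And>c g. 0 < c \<Longrightarrow> g \<in> G \<Longrightarrow> c *\<^sub>R g \<in> G"
    and pos: "\<And>g. g \<in> G \<Longrightarrow> 0 \<le> p g"
  obtains q where "sublinear q" "\<And>v. q v \<le> p v" "\<And>g. g \<in> G \<Longrightarrow> q (- g) \<le> 0"
proof -
  define q where "q v = (INF g\<in>G. p (v + g))" for v
  have lower: "- p (- v) \<le> p (v + g)" if "g \<in> G" for v g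
    using sublinear_add[OF p, of "-v" "v + g"] pos[OF that] by simp
  have bdd: "bdd_below ((\<lambda>g. p (v + g)) ` G)" for v
    by (rule bdd_belowI2[of _ "- p (- v)"]) (rule lower)
  have q_le: "q v \<le> p (v + g)" if "g \<in> G" for v g
    unfolding q_def by (rule cINF_lower[OF bdd that])
  have q_ge: "a \<le> q v" if "\<And>g. g \<in> G \<Longrightarrow> a \<le> p (v + g)" for a v
    unfolding q_def using G0 that by (intro cINF_greatest) auto
  have sub: "q (u + v) \<le> q u + q v" for u v
  proof -
    have "q (u + v) - q u \<le> p (v + h)" if h: "h \<in> G" for h
    proof -
      have "q (u + v) - p (v + h) \<le> p (u + g)" if g: "g \<in> G" for g
        using q_le[OF Gadd[OF g h], of "u + v"] sublinear_add[OF p, of "u + g" "v + h"]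
        by (simp add: algebra_simps)
      from q_ge[OF this] show ?thesis by simp
    qed
    from q_ge[OF this] show ?thesis by simp
  qed
  have zero: "q 0 = 0"
    using q_le[OF G0, of 0] q_ge[of 0 0] pos sublinear_zero[OF p] by force
  have scale: "q (c *\<^sub>R v) \<le> c * q v" if c: "0 < c" for c v
  proof -
    have "q (c *\<^sub>R v) / c \<le> p (v + g)" if g: "g \<in> G" for g
    proof -
      have "q (c *\<^sub>R v) \<le> p (c *\<^sub>R (v + g))"
        using q_le[OF Gscale[OF c g]] by (simp add: scaleR_add_right)
      then show ?thesis using c sublinear_scale[OF p, of c "v + g"] by (simp add: field_simps)
    qed
    from q_ge[OF this] show ?thesis using c by (simp add: field_simps)
  qed
  show thesis
  proof
    show "sublinear q" by (rule sublinearI; fact)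
    show "q v \<le> p v" for v using q_le[OF G0, of v] by simp
    show "q (- g) \<le> 0" if "g \<in> G" for g
      using q_le[OF that, of "- g"] sublinear_zero[OF p] by simp
  qed
qed

text \<open>An infimum of sublinear functionals is in general not subadditive. Along a chain it is,
  because \<open>s v + t w\<close> is at least the value at \<open>v + w\<close> of the smaller of
  \<open>s\<close> and \<open>t\<close>. The bound \<open>- p (- v)\<close> keeps the infimum
  finite.\<close>

lemma sublinear_chain_lower_bound:
  fixes p :: "'v::real_vector \<Rightarrow> real"
  assumes C: "C \<noteq> {}" "\<And>s. s \<in> C \<Longrightarrow> sublinear s \<and> (\<forall>v. s v \<le> p v)"
    and chain: "\<And>s t. s \<in> C \<Longrightarrow> t \<in> C \<Longrightarrow> (\<forall>v. s v \<le> t v) \<or> (\<forall>v. t v \<le> s v)"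
  obtains u where "sublinear u" "\<And>s v. s \<in> C \<Longrightarrow> u v \<le> s v"
proof -
  define u where "u v = (INF s\<in>C. s v)" for v
  have lower: "- p (- v) \<le> s v" if "s \<in> C" for s v
    using C(2)[OF that] sublinear_uminus[of s v] by (smt (verit))
  have u_le: "u v \<le> s v" if "s \<in> C" for s v
    unfolding u_def
    by (rule cINF_lower[OF bdd_belowI2[of _ "- p (- v)"] that]) (rule lower)
  have u_ge: "a \<le> u v" if "\<And>s. s \<in> C \<Longrightarrow> a \<le> s v" for a v
    unfolding u_def using C(1) that by (intro cINF_greatest) auto
  have sub: "u (v + w) \<le> u v + u w" for v w
  proof -
    have "u (v + w) - u v \<le> t w" if t: "t \<in> C" for t
    proof -
      have "u (v + w) - t w \<le> s v" if s: "s \<in> C" for s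
        using u_le[OF s, of "v + w"] u_le[OF t, of "v + w"] chain[OF s t]
          sublinear_add[of s v w] sublinear_add[of t v w] C(2)[OF s] C(2)[OF t]
        by (smt (verit, best))
      then have "u (v + w) - t w \<le> u v" by (rule u_ge)
      then show ?thesis by simp
    qed
    then have "u (v + w) - u v \<le> u w" by (rule u_ge)
    then show ?thesis by simp
  qed
  obtain s0 where s0: "s0 \<in> C" using C(1) by auto
  have "u 0 = 0"
    using u_le[OF s0, of 0] u_ge[of 0 0] C(2) sublinear_zero by (metis order.refl order_antisym s0)
  moreover have "u (c *\<^sub>R v) \<le> c * u v" if c: "0 < c" for c v
  proof -
    have "u (c *\<^sub>R v) / c \<le> s v" if s: "s \<in> C" for s
      using u_le[OF s, of "c *\<^sub>R v"] sublinear_scale[of s c v] C(2)[OF s] c by (simp add: field_simps)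
    then have "u (c *\<^sub>R v) / c \<le> u v" by (rule u_ge)
    then show ?thesis using c by (simp add: field_simps)
  qed
  ultimately have "sublinear u" using sub by (intro sublinearI)
  then show thesis using u_le by (rule that)
qed

text \<open>Instead of extending a functional from a subspace, Zorn's lemma gives a minimal
  sublinear functional below \<open>p\<close>; minimality forces it to be odd, and an odd sublinear
  functional is linear.\<close>

lemma linear_below_sublinear:
  fixes p :: "'v::real_vector \<Rightarrow> real"
  assumes p: "sublinear p"
  obtains L where "linear L" "\<And>v. L v \<le> p v"
proof -
  define S where "S = {s. sublinear s \<and> (\<forall>v. s v \<le> p v)}"
  \<comment> \<open>\<open>P\<close> is the reversed pointwise order, because
    \<open>predicate_Zorn\<close> produces maximal elements.\<close>
  define P where "P = (\<lambda>s t :: 'v \<Rightarrow> real. \<forall>v. t v \<le> s v)"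
  have "\<exists>m\<in>S. \<forall>a\<in>S. P m a \<longrightarrow> a = m"
  proof (rule predicate_Zorn)
    show "partial_order_on S (relation_of P S)"
      by (rule partial_order_on_relation_ofI) (auto simp: P_def fun_eq_iff intro: order_trans antisym)
  next
    fix C assume C: "C \<in> Chains (relation_of P S)"
    show "\<exists>u\<in>S. \<forall>a\<in>C. P a u"
    proof (cases "C = {}")
      case True
      then show ?thesis using p by (auto simp: S_def)
    next
      case False
      have CS: "s \<in> S" if "s \<in> C" for s
        using C that by (auto simp: Chains_def relation_of_def)
      obtain u where "sublinear u" "\<And>s v. s \<in> C \<Longrightarrow> u v \<le> s v"
      proof (rule sublinear_chain_lower_bound[OF False, of p])
        show "sublinear s \<and> (\<forall>v. s v \<le> p v)" if "s \<in> C" for s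
          using CS[OF that] by (simp add: S_def)
        show "(\<forall>v. s v \<le> t v) \<or> (\<forall>v. t v \<le> s v)" if "s \<in> C" "t \<in> C" for s t
          using C that by (auto simp: Chains_def relation_of_def P_def)
      qed blast
      with False CS show ?thesis
        by (auto simp: S_def P_def) (metis (no_types, lifting) False ex_in_conv order_trans)
    qed
  qed
  then obtain m where m: "sublinear m" "\<And>v. m v \<le> p v"
    and min: "\<And>s. sublinear s \<Longrightarrow> (\<And>v. s v \<le> m v) \<Longrightarrow> s = m"
    by (auto simp: S_def P_def) (metis order_trans)
  \<comment> \<open>Below \<open>q\<close> is a sublinear functional with \<open>q \<le> m\<close> and \<open>q (- v) \<le> - m v\<close>; minimality gives \<open>q = m\<close>.\<close>
  have odd: "m (- v) = - m v" for v
  proof -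
    define q where "q w = (INF c\<in>{0..}. m (w + c *\<^sub>R v) - c * m v)" for w
    have lower: "- m (- w) \<le> m (w + c *\<^sub>R v) - c * m v" if "0 \<le> c" for w c
      using sublinear_add[OF m(1), of "-w" "w + c *\<^sub>R v"] sublinear_scale[OF m(1) that, of v] by simp
    have q_le: "q w \<le> m (w + c *\<^sub>R v) - c * m v" if "0 \<le> c" for w c
      unfolding q_def using that lower
      by (intro cINF_lower bdd_belowI2[of _ "- m (- w)"]) auto
    have q_ge: "a \<le> q w" if "\<And>c. 0 \<le> c \<Longrightarrow> a \<le> m (w + c *\<^sub>R v) - c * m v" for a w
      unfolding q_def using that by (intro cINF_greatest) auto
    have "q (w + z) \<le> q w + q z" for w z
    proof -
      have "q (w + z) - q w \<le> m (z + d *\<^sub>R v) - d * m v" if d: "0 \<le> d" for d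
      proof -
        have "q (w + z) - (m (z + d *\<^sub>R v) - d * m v) \<le> m (w + c *\<^sub>R v) - c * m v" if c: "0 \<le> c" for c
          using q_le[of "c + d" "w + z"] c d sublinear_add[OF m(1), of "w + c *\<^sub>R v" "z + d *\<^sub>R v"]
          by (simp add: algebra_simps)
        from q_ge[OF this] show ?thesis by simp
      qed
      from q_ge[OF this] show ?thesis by simp
    qed
    moreover have "q 0 = 0"
      using q_le[of 0 0] q_ge[of 0 0] sublinear_zero[OF m(1)] sublinear_scale[OF m(1)] by force
    moreover have "q (t *\<^sub>R w) \<le> t * q w" if t: "0 < t" for t w
    proof -
      have "q (t *\<^sub>R w) / t \<le> m (w + c *\<^sub>R v) - c * m v" if c: "0 \<le> c" for c
      proof -
        have "q (t *\<^sub>R w) \<le> m (t *\<^sub>R (w + c *\<^sub>R v)) - t * c * m v"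
          using q_le[of "t * c" "t *\<^sub>R w"] c t by (simp add: scaleR_add_right)
        then show ?thesis using t sublinear_scale[OF m(1), of t "w + c *\<^sub>R v"] by (simp add: field_simps)
      qed
      from q_ge[OF this] show ?thesis using t by (simp add: field_simps)
    qed
    ultimately have "sublinear q" by (rule sublinearI)
    then have "q = m" using q_le[of 0] by (intro min) auto
    then have "m (- v) \<le> - m v"
      using q_le[of 1 "- v"] sublinear_zero[OF m(1)] by simp
    with sublinear_uminus[OF m(1), of v] show ?thesis by simp
  qed
  have add: "m (u + v) = m u + m v" for u v
    using sublinear_add[OF m(1), of u v] sublinear_add[OF m(1), of "u + v" "- v"] odd[of v] by simp
  have "m (c *\<^sub>R v) = c * m v" for c v
    using sublinear_scale[OF m(1), of c v] sublinear_scale[OF m(1), of "- c" v] odd[of "c *\<^sub>R v"]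
    by (cases "0 \<le> c") auto
  with add have "linear m" by (intro linearI) auto
  with m(2) show thesis by (rule that[rotated -1])
qed

lemma linear_below_sublinear_nonneg_on_cone:
  fixes p :: "'v::real_vector \<Rightarrow> real"
  assumes "sublinear p" "0 \<in> G"
    and "\<And>g h. g \<in> G \<Longrightarrow> h \<in> G \<Longrightarrow> g + h \<in> G"
    and "\<And>c g. 0 < c \<Longrightarrow> g \<in> G \<Longrightarrow> c *\<^sub>R g \<in> G"
    and "\<And>g. g \<in> G \<Longrightarrow> 0 \<le> p g"
  obtains L where "linear L" "\<And>v. L v \<le> p v" "\<And>g. g \<in> G \<Longrightarrow> 0 \<le> L g"
proof -
  obtain q where q: "sublinear q" "\<And>v. q v \<le> p v" "\<And>g. g \<in> G \<Longrightarrow> q (- g) \<le> 0"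
    using sublinear_below_cone[OF assms] by blast
  obtain L where L: "linear L" "\<And>v. L v \<le> q v" using linear_below_sublinear[OF q(1)] by blast
  show thesis
  proof
    show "linear L" by fact
    show "L v \<le> p v" for v using L(2) q(2) order_trans by blast
    show "0 \<le> L g" if "g \<in> G" for g
      using L(2)[of "- g"] q(3)[OF that] linear_neg[OF L(1), of g] by simp
  qed
qed

section \<open>Measures dominating a functional on bounded continuous functions\<close>

lemma apply_Bcontfun:
  "continuous_on UNIV f \<Longrightarrow> bounded (range f) \<Longrightarrow> apply_bcontfun (Bcontfun f) = f"
  by (rule Bcontfun_inverse) (auto simp: bcontfun_def)

lemmas bcontfun_rep_eqs = plus_bcontfun.rep_eq minus_bcontfun.rep_eq scaleR_bcontfun.rep_eq
  zero_bcontfun.rep_eq uminus_bcontfun.rep_eq const_bcontfun.rep_eq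

lemma sum_bcontfun_apply: "apply_bcontfun (\<Sum>i\<in>I. f i) x = (\<Sum>i\<in>I. apply_bcontfun (f i) x)"
  by (induction I rule: infinite_finite_induct) (auto simp: bcontfun_rep_eqs)

text \<open>Cuts a value into slices of height one, so that a nonnegative bounded function becomes a
  sum of functions between 0 and 1, the \<open>i\<close>-th of which vanishes where
  \<open>t <= i\<close>.\<close>

lemma sum_clamped_layers:
  fixes t :: real
  assumes "0 \<le> t"
  shows "(\<Sum>i<N. min (max (t - real i) 0) 1) = min t (real N)"
  by (induction N) (use assms in auto)

text \<open>The number of slices that are hit exceeds \<open>t\<close> by at most one. This excess
  is the error in comparing slices with superlevel sets.\<close>

lemma sum_layer_indicators_le:
  fixes t :: real
  assumes "0 \<le> t"
  shows "(\<Sum>i<N. if real i < t then 1 else 0) \<le> min (real N) (t + 1)"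
  by (induction N) (use assms in auto)

text \<open>The single bound encodes all that the Riesz construction needs: \<open>c = 0\<close>
  gives positivity, \<open>c = 1\<close> total mass at most one, and testing \<open>h\<close> on
  \<open>K\<close> alone forces the measure to live on \<open>K\<close>.\<close>

locale dominated_functional =
  fixes K :: "'b::metric_space set" and L :: "('b \<Rightarrow>\<^sub>C real) \<Rightarrow> real"
  assumes compact: "compact K"
    and linear: "linear L"
    and bound: "\<And>h c. (\<And>y. y \<in> K \<Longrightarrow> apply_bcontfun h y \<le> c) \<Longrightarrow> L h \<le> c"
begin

lemma mono: "L g \<le> L h" if "\<And>y. y \<in> K \<Longrightarrow> apply_bcontfun g y \<le> apply_bcontfun h y"
proof -
  have "L (g - h) \<le> 0" using that by (intro bound) (auto simp: bcontfun_rep_eqs)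
  then show ?thesis by (simp add: linear_diff[OF linear])
qed

lemma nonneg: "0 \<le> L h" if "\<And>y. y \<in> K \<Longrightarrow> 0 \<le> apply_bcontfun h y"
  using mono[of 0 h] that by (simp add: bcontfun_rep_eqs linear_0[OF linear])

lemma le_add_const: "L g \<le> L h + c"
  if "\<And>y. y \<in> K \<Longrightarrow> apply_bcontfun g y \<le> apply_bcontfun h y + c"
proof -
  have "L (g - h) \<le> c" using that by (intro bound) (auto simp: bcontfun_rep_eqs algebra_simps)
  then show ?thesis by (simp add: linear_diff[OF linear])
qed

text \<open>Test functions for \<open>U\<close> have to vanish off \<open>U\<close>, but their
  support need not be a compact subset of \<open>U\<close>. Where room near the boundary is wanted,
  as in \<open>content_split\<close>, a small constant is subtracted.\<close>

definition below :: "'b set \<Rightarrow> ('b \<Rightarrow>\<^sub>C real) set" where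
  "below U = {h. \<forall>y. 0 \<le> apply_bcontfun h y \<and> apply_bcontfun h y \<le> indicator U y}"

definition content :: "'b set \<Rightarrow> ennreal" where
  "content U = (SUP h\<in>below U. ennreal (L h))"

definition outer :: "'b set \<Rightarrow> ennreal" where
  "outer B = (INF U\<in>{U. open U \<and> B \<subseteq> U}. content U)"

lemma below_mono: "U \<subseteq> V \<Longrightarrow> below U \<subseteq> below V"
proof
  fix h assume UV: "U \<subseteq> V" and h: "h \<in> below U"
  have "indicator U y \<le> (indicator V y :: real)" for y using UV by (auto simp: indicator_def)
  then show "h \<in> below V" using h unfolding below_def by (auto intro: order_trans)
qed

lemma belowD:
  assumes "h \<in> below U"
  shows "0 \<le> apply_bcontfun h y" "apply_bcontfun h y \<le> 1" "y \<notin> U \<Longrightarrow> apply_bcontfun h y = 0"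
proof -
  have *: "0 \<le> apply_bcontfun h y" "apply_bcontfun h y \<le> indicator U y"
    using assms unfolding below_def by auto
  then show "0 \<le> apply_bcontfun h y" "y \<notin> U \<Longrightarrow> apply_bcontfun h y = 0" by auto
  show "apply_bcontfun h y \<le> 1" using *(2) indicator_le_1[of U y] by (rule order_trans)
qed

lemma content_mono: "U \<subseteq> V \<Longrightarrow> content U \<le> content V"
  unfolding content_def by (rule SUP_subset_mono[OF below_mono]) auto

lemma content_le_1: "content U \<le> 1"
  unfolding content_def
proof (rule SUP_least)
  fix h assume "h \<in> below U"
  then have "L h \<le> 1" by (intro bound belowD)
  then show "ennreal (L h) \<le> 1" by (simp add: ennreal_le_1)
qed

lemma content_disjoint_eq_0: "content U = 0" if "U \<inter> K = {}"
proof -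
  have "L h \<le> 0" if "h \<in> below U" for h
    using belowD(3)[OF that] \<open>U \<inter> K = {}\<close> by (intro bound) fastforce
  then have "content U \<le> 0" unfolding content_def by (intro SUP_least) (auto simp: ennreal_neg)
  then show ?thesis by simp
qed

lemma le_content: "h \<in> below U \<Longrightarrow> ennreal (L h) \<le> content U"
  unfolding content_def by (rule SUP_upper)

lemma outer_le: "open U \<Longrightarrow> B \<subseteq> U \<Longrightarrow> outer B \<le> content U"
  unfolding outer_def by (rule INF_lower) auto

lemma outer_open: "open U \<Longrightarrow> outer U = content U"
  unfolding outer_def by (rule antisym) (auto intro!: INF_greatest INF_lower content_mono)

lemma outer_mono: "B \<subseteq> C \<Longrightarrow> outer B \<le> outer C"
  unfolding outer_def by (rule INF_superset_mono) auto

lemma bump: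
  fixes U :: "'b set"
  assumes "open U"
  obtains f :: "'b \<Rightarrow> real" where "continuous_on UNIV f" "\<And>y. 0 \<le> f y" "\<And>y. 0 < f y \<longleftrightarrow> y \<in> U"
\<comment> \<open>\<open>infdist\<close> to the empty set is 0 by convention, so the distance to the
  complement cannot serve for the whole space.\<close>
proof (cases "U = UNIV")
  case True
  then show thesis by (intro that[of "\<lambda>_. 1"]) auto
next
  case False
  then have "- U \<noteq> {}" by auto
  have "0 < infdist y (- U) \<longleftrightarrow> y \<in> U" for y
    using in_closed_iff_infdist_zero[OF closed_Compl[OF assms] \<open>- U \<noteq> {}\<close>, of y] infdist_nonneg[of y "- U"]
    by (metis ComplI Compl_iff less_le)
  then show thesis
    by (intro that[of "\<lambda>y. infdist y (- U)"]) (auto intro!: continuous_intros infdist_nonneg)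
qed

text \<open>Off the set \<open>C\<close> where \<open>h >= e\<close>, the function \<open>h\<close>
  contributes at most \<open>e\<close>, as the functional has mass at most one. \<open>C\<close> is
  compact, so finitely many \<open>U i\<close> cover it, and a partition of unity splits
  \<open>h\<close> into test functions for the single sets.\<close>

lemma content_UN_le:
  fixes U :: "nat \<Rightarrow> 'b set"
  assumes U: "\<And>i. open (U i)"
  shows "content (\<Union>i. U i) \<le> (\<Sum>i. content (U i))"
  unfolding content_def[of "\<Union>i. U i"]
proof (rule SUP_least)
  fix h assume h: "h \<in> below (\<Union>i. U i)"
  note h0 = belowD(1,2)[OF h] and hU = belowD(3)[OF h]
  show "ennreal (L h) \<le> (\<Sum>i. content (U i))"
  proof (rule ennreal_le_epsilon)
    fix e :: real assume e: "0 < e"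
    define C where "C = K \<inter> {y. e \<le> apply_bcontfun h y}"
    have C: "compact C"
      unfolding C_def
      by (intro compact_Int_closed compact closed_Collect_le continuous_intros) auto
    have "C \<subseteq> (\<Union>i. U i)" using hU e unfolding C_def by fastforce
    then obtain I where I: "finite I" "C \<subseteq> (\<Union>i\<in>I. U i)"
      using compactE_image[OF C, of UNIV U] U by metis
    have "\<exists>f. continuous_on UNIV f \<and> (\<forall>y. 0 \<le> f y) \<and> (\<forall>y. (0::real) < f y \<longleftrightarrow> y \<in> U i)" for i
      using bump[OF U[of i]] by metis
    then obtain f :: "nat \<Rightarrow> 'b \<Rightarrow> real" where f: "\<And>i. continuous_on UNIV (f i)" "\<And>i y. 0 \<le> f i y"
      "\<And>i y. 0 < f i y \<longleftrightarrow> y \<in> U i"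
      by metis
    define S where "S y = (\<Sum>i\<in>I. f i y)" for y
    have S_cont: "continuous_on UNIV S" unfolding S_def by (intro continuous_intros f)
    have "0 < S y" if "y \<in> C" for y
      using I that f unfolding S_def by (metis (full_types) UN_E subsetD sum_pos2)
    then obtain d where d: "0 < d" "\<And>y. y \<in> C \<Longrightarrow> d \<le> S y"
    proof (cases "C = {}")
      case False
      obtain z where "z \<in> C" "\<And>y. y \<in> C \<Longrightarrow> S z \<le> S y"
        using continuous_attains_inf[OF C False continuous_on_subset[OF S_cont subset_UNIV]] by auto
      then show ?thesis using \<open>\<And>y. y \<in> C \<Longrightarrow> 0 < S y\<close> by (intro that[of "S z"]) auto
    qed (auto intro: that[of 1])
    \<comment> \<open>On \<open>C\<close> the denominator is \<open>S y\<close>, so the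
      \<open>g i\<close> add up to \<open>h\<close>. Elsewhere the lower bound \<open>d\<close>
      avoids division by zero and keeps the quotients at most one.\<close>
    define g where "g i y = apply_bcontfun h y * (f i y / max (S y) d)" for i y
    have f_le: "f i y \<le> max (S y) d" if "i \<in> I" for i y
      using member_le_sum[OF that, of "\<lambda>i. f i y"] f(2) I(1) unfolding S_def by auto
    have g01: "0 \<le> g i y" "g i y \<le> indicator (U i) y" if "i \<in> I" for i y
    proof -
      have q: "0 \<le> f i y / max (S y) d" "f i y / max (S y) d \<le> 1"
        using f(2) d(1) f_le[OF that, of y] by (auto simp: field_simps)
      then show "0 \<le> g i y" unfolding g_def using h0 by (intro mult_nonneg_nonneg)
      have "g i y \<le> 1" unfolding g_def using mult_mono[OF h0(2) q(2)] q h0 by simp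
      moreover have "g i y = 0" if "y \<notin> U i" using f(2,3)[of i y] that unfolding g_def by auto
      ultimately show "g i y \<le> indicator (U i) y" by (auto simp: indicator_def)
    qed
    have g_cont: "continuous_on UNIV (g i)" for i
      unfolding g_def using d by (intro continuous_intros f S_cont) auto
    have g_bdd: "bounded (range (g i))" if "i \<in> I" for i
    proof (rule boundedI[of _ 1])
      fix x assume "x \<in> range (g i)"
      then obtain y where "x = g i y" by auto
      then show "norm x \<le> 1" using g01[OF that, of y] indicator_le_1[of "U i" y] by (simp add: order_trans)
    qed
    have ap: "apply_bcontfun (Bcontfun (g i)) = g i" if "i \<in> I" for i
      by (rule apply_Bcontfun[OF g_cont g_bdd[OF that]])
    have Lg: "0 \<le> L (Bcontfun (g i))" if "i \<in> I" for i
      by (rule nonneg) (use g01[OF that] in \<open>simp add: ap[OF that]\<close>)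
    have mem: "Bcontfun (g i) \<in> below (U i)" if "i \<in> I" for i
      unfolding below_def using g01[OF that] by (auto simp: ap[OF that])
    have "L h \<le> L (\<Sum>i\<in>I. Bcontfun (g i)) + e"
    proof (rule le_add_const)
      fix y assume y: "y \<in> K"
      have eq: "apply_bcontfun (\<Sum>i\<in>I. Bcontfun (g i)) y = apply_bcontfun h y * (S y / max (S y) d)"
        by (simp add: sum_bcontfun_apply ap g_def S_def sum_distrib_left sum_divide_distrib)
      show "apply_bcontfun h y \<le> apply_bcontfun (\<Sum>i\<in>I. Bcontfun (g i)) y + e"
      proof (cases "y \<in> C")
        case True
        then show ?thesis unfolding eq using d(1) d(2)[OF True] e by (simp add: max_def)
      next
        case False
        have "0 \<le> S y" unfolding S_def by (intro sum_nonneg f)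
        then have "0 \<le> apply_bcontfun h y * (S y / max (S y) d)" using h0 d by (intro mult_nonneg_nonneg) auto
        then show ?thesis unfolding eq using False y unfolding C_def by auto
      qed
    qed
    also have "L (\<Sum>i\<in>I. Bcontfun (g i)) = (\<Sum>i\<in>I. L (Bcontfun (g i)))"
      by (rule linear_sum[OF linear])
    finally have "ennreal (L h) \<le> ennreal ((\<Sum>i\<in>I. L (Bcontfun (g i))) + e)" by (rule ennreal_leI)
    also have "\<dots> = (\<Sum>i\<in>I. ennreal (L (Bcontfun (g i)))) + ennreal e"
      using e Lg by (subst ennreal_plus) (auto intro!: sum_nonneg simp: sum_ennreal)
    also have "\<dots> \<le> (\<Sum>i\<in>I. content (U i)) + ennreal e"
      by (intro add_mono sum_mono le_content mem order_refl)
    also have "\<dots> \<le> (\<Sum>i. content (U i)) + ennreal e"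
      by (intro add_mono sum_le_suminf I(1)) auto
    finally show "ennreal (L h) \<le> (\<Sum>i. content (U i)) + ennreal e" .
  qed
qed

lemma outer_measure_space_outer: "outer_measure_space (Pow UNIV) outer"
proof -
  have "outer {} = 0" using outer_open[of "{}"] content_disjoint_eq_0[of "{}"] by simp
  moreover have "countably_subadditive (Pow UNIV) outer"
  proof (simp add: countably_subadditive_def, intro allI impI)
    fix B :: "nat \<Rightarrow> 'b set"
    show "outer (\<Union>i. B i) \<le> (\<Sum>n. outer (B n))"
    proof (rule ennreal_le_epsilon)
      fix e :: real assume e: "0 < e"
      have "\<exists>U. open U \<and> B n \<subseteq> U \<and> content U \<le> outer (B n) + ennreal e * ennreal ((1/2) ^ Suc n)" for n
      proof -
        have "outer (B n) < \<infinity>" using outer_le[of UNIV "B n"] content_le_1[of UNIV]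
          by (metis ennreal_one_less_top infinity_ennreal_def le_less_trans subset_UNIV open_UNIV)
        then have "outer (B n) < outer (B n) + ennreal (e * (1/2) ^ Suc n)"
          using e by (auto simp: less_top)
        then show ?thesis unfolding outer_def INF_less_iff using e
          by (auto simp: ennreal_mult[symmetric] intro: less_imp_le)
      qed
      then obtain U where U: "\<And>n. open (U n)" "\<And>n. B n \<subseteq> U n"
        "\<And>n. content (U n) \<le> outer (B n) + ennreal e * ennreal ((1/2) ^ Suc n)" by metis
      have "outer (\<Union>i. B i) \<le> content (\<Union>i. U i)" using U by (intro outer_le) auto
      also have "\<dots> \<le> (\<Sum>n. content (U n))" by (rule content_UN_le) (rule U)
      also have "\<dots> \<le> (\<Sum>n. outer (B n) + ennreal e * ennreal ((1/2) ^ Suc n))"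
        by (intro suminf_le U) auto
      also have "\<dots> = (\<Sum>n. outer (B n)) + (\<Sum>n. ennreal e * ennreal ((1/2) ^ Suc n))"
        by (subst suminf_add[symmetric]) auto
      also have "\<dots> = (\<Sum>n. outer (B n)) + e"
        unfolding ennreal_suminf_cmult
        by (subst suminf_ennreal_eq[OF zero_le_power power_half_series]) auto
      finally show "outer (\<Union>i. B i) \<le> (\<Sum>n. outer (B n)) + e" .
    qed
  qed
  ultimately show ?thesis
    by (auto simp: outer_measure_space_def positive_def increasing_def outer_mono)
qed

text \<open>Caratheodory's inequality for open sets. Lowering \<open>h\<close> by \<open>e\<close>
  makes it vanish on the open set \<open>W\<close> where \<open>h < e\<close>, and \<open>W\<close>
  contains \<open>V - U\<close>; so test functions for \<open>W\<close> can be added to the lowered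
  \<open>h\<close> without exceeding the indicator of \<open>V\<close>.\<close>

lemma content_split:
  assumes U: "open U" and V: "open V"
  shows "content (U \<inter> V) + outer (V - U) \<le> content V"
proof -
  have "ennreal (L h) + outer (V - U) \<le> content V" if h: "h \<in> below (U \<inter> V)" for h
  proof (rule ennreal_le_epsilon)
    fix e :: real assume e: "0 < e"
    define h' where "h' y = max (apply_bcontfun h y - e) 0" for y
    define W where "W = V \<inter> {y. apply_bcontfun h y < e}"
    have W: "open W" unfolding W_def
      by (intro open_Int V open_Collect_less continuous_intros) auto
    have h0: "0 \<le> apply_bcontfun h y" "apply_bcontfun h y \<le> indicator (U \<inter> V) y" for y
      using h unfolding below_def by auto
    have h1: "apply_bcontfun h y \<le> 1" for y
      using h0(2)[of y] indicator_le_1[of "U \<inter> V" y] by (metis order_trans)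
    have ap: "apply_bcontfun (Bcontfun h') = h'"
      unfolding h'_def
    proof (rule apply_Bcontfun)
      show "bounded (range (\<lambda>y. max (apply_bcontfun h y - e) 0))"
        by (rule boundedI[of _ 1]) (use h1 e in \<open>auto simp: max_def\<close>, smt (verit))
    qed (intro continuous_intros continuous_on_apply_bcontfun)
    have VU: "V - U \<subseteq> W"
      unfolding W_def using belowD(3)[OF h] e by auto
    have h'0: "0 \<le> L (Bcontfun h')" by (rule nonneg) (simp add: ap h'_def)
    have "L h \<le> L (Bcontfun h') + e" by (rule le_add_const) (simp add: ap h'_def)
    then have le: "ennreal (L h) \<le> ennreal (L (Bcontfun h')) + ennreal e"
      using h'0 e by (simp add: ennreal_plus[symmetric] ennreal_leI del: ennreal_plus)
    have "ennreal (L (Bcontfun h')) + content W \<le> content V"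
    proof -
      have "ennreal (L (Bcontfun h')) + ennreal (L g) \<le> content V" if g: "g \<in> below W" for g
      proof -
        note g0 = belowD[OF g]
        have "apply_bcontfun (Bcontfun h' + g) y \<le> indicator V y \<and> 0 \<le> apply_bcontfun (Bcontfun h' + g) y" for y
        proof -
          have "y \<notin> V \<Longrightarrow> apply_bcontfun h y = 0 \<and> apply_bcontfun g y = 0"
            using belowD(3)[OF h, of y] g0(3)[of y] unfolding W_def by auto
          moreover have "\<not> apply_bcontfun h y < e \<Longrightarrow> apply_bcontfun g y = 0"
            using g0(3)[of y] unfolding W_def by auto
          ultimately show ?thesis
            using g0(1,2)[of y] h1[of y] e
            by (cases "apply_bcontfun h y < e"; cases "y \<in> V") (auto simp: bcontfun_rep_eqs ap h'_def)
        qed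
        then have "Bcontfun h' + g \<in> below V" unfolding below_def by auto
        from le_content[OF this] show ?thesis
          using h'0 nonneg[OF g0(1)] by (simp add: linear_add[OF linear] ennreal_plus)
      qed
      moreover have "0 \<in> below W" by (auto simp: below_def bcontfun_rep_eqs)
      then have "below W \<noteq> {}" by auto
      ultimately show ?thesis
        unfolding content_def[of W] by (subst ennreal_SUP_add_right) (auto intro!: SUP_least)
    qed
    moreover have "outer (V - U) \<le> content W" by (rule outer_le[OF W VU])
    ultimately have "ennreal (L (Bcontfun h')) + outer (V - U) \<le> content V"
      using add_left_mono order_trans by blast
    then have *: "ennreal (L (Bcontfun h')) + outer (V - U) + ennreal e \<le> content V + ennreal e"
      by (rule add_right_mono)
    have "ennreal (L h) + outer (V - U) \<le> ennreal (L (Bcontfun h')) + ennreal e + outer (V - U)"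
      using le by (rule add_right_mono)
    also have "\<dots> = ennreal (L (Bcontfun h')) + outer (V - U) + ennreal e" by (simp only: ac_simps)
    also note *
    finally show "ennreal (L h) + outer (V - U) \<le> content V + ennreal e" .
  qed
  moreover have "0 \<in> below (U \<inter> V)" by (auto simp: below_def bcontfun_rep_eqs)
  then have "below (U \<inter> V) \<noteq> {}" by auto
  ultimately show ?thesis
    unfolding content_def[of "U \<inter> V"] by (subst ennreal_SUP_add_left[symmetric]) (auto intro!: SUP_least)
qed

text \<open>\<open>content_split\<close> covers open \<open>V\<close>; the infimum over all open
  \<open>V\<close> containing \<open>B\<close> extends it to arbitrary \<open>B\<close>.\<close>

lemma open_in_lambda_system:
  assumes U: "open U"
  shows "U \<in> lambda_system UNIV (Pow UNIV) outer"
  unfolding lambda_system_def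
proof (clarsimp, rule antisym)
  fix B :: "'b set"
  have *: "outer (U \<inter> B) + outer ((UNIV - U) \<inter> B) \<le> content V" if V: "open V" "B \<subseteq> V" for V
  proof -
    have "outer (U \<inter> B) \<le> content (U \<inter> V)" using U V by (intro outer_le) auto
    moreover have "outer ((UNIV - U) \<inter> B) \<le> outer (V - U)" using V by (intro outer_mono) auto
    ultimately show ?thesis using content_split[OF U V(1)] by (meson add_mono order_trans)
  qed
  then show "outer (U \<inter> B) + outer ((UNIV - U) \<inter> B) \<le> outer B"
    unfolding outer_def[of B] by (auto intro!: INF_greatest)
  interpret sigma_algebra UNIV "Pow UNIV :: 'b set set" by (rule sigma_algebra_Pow)
  have "subadditive (Pow UNIV) outer"
    using outer_measure_space_outer
    by (intro countably_subadditive_subadditive) (auto simp: outer_measure_space_def)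
  then show "outer B \<le> outer (U \<inter> B) + outer ((UNIV - U) \<inter> B)"
    using subadditiveD[of "Pow UNIV" outer "U \<inter> B" "(UNIV - U) \<inter> B"]
    by (simp add: Int_Un_distrib2[symmetric]) blast
qed

definition riesz_measure :: "'b measure" where
  "riesz_measure = measure_of UNIV (sets borel) outer"

lemma sets_riesz_measure: "sets riesz_measure = sets borel"
  and space_riesz_measure: "space riesz_measure = UNIV"
  using sets.sigma_sets_eq[of "borel :: 'b measure"] unfolding riesz_measure_def by simp_all

lemma emeasure_riesz_measure: "B \<in> sets borel \<Longrightarrow> emeasure riesz_measure B = outer B"
proof -
  assume B: "B \<in> sets borel"
  let ?Q = "lambda_system UNIV (Pow UNIV) outer"
  have ms: "measure_space UNIV ?Q outer"
    using sigma_algebra.caratheodory_lemma[OF sigma_algebra_Pow outer_measure_space_outer] .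
  then have sa: "sigma_algebra UNIV ?Q" by (simp add: measure_space_def)
  have "sigma_sets UNIV {S. open S} \<subseteq> ?Q"
    using open_in_lambda_system by (intro sigma_algebra.sigma_sets_subset[OF sa]) auto
  then have "sets borel \<subseteq> ?Q" by (simp add: borel_def)
  from measure_down[OF ms _ this] have "measure_space UNIV (sets borel) outer"
    using sets.sigma_algebra_axioms[of borel] by simp
  then show ?thesis
    unfolding riesz_measure_def using B sets.sigma_algebra_axioms[of "borel :: 'b measure"]
    by (intro emeasure_measure_of_sigma) (auto simp: measure_space_def)
qed

lemma emeasure_riesz_measure_le_1: "emeasure riesz_measure UNIV \<le> 1"
  using emeasure_riesz_measure[of UNIV] outer_open[of UNIV] content_le_1[of UNIV] by simp

lemma emeasure_riesz_measure_Compl: "emeasure riesz_measure (- K) = 0"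
  using emeasure_riesz_measure[of "- K"] outer_open[of "- K"] content_disjoint_eq_0[of "- K"]
    compact_imp_closed[OF compact] by auto

text \<open>Slice \<open>h\<close> into layers of height \<open>e\<close>. The \<open>i\<close>-th
  layer, divided by \<open>e\<close>, is a test function for the open set where
  \<open>h > i * e\<close>, so the functional is bounded by the measure of that set. The indicators
  of these sets add up to at most \<open>h / e + 1\<close>, and mass at most one turns the excess
  into \<open>e\<close>.\<close>

lemma le_nn_integral_riesz_measure:
  assumes h0: "\<And>y. 0 \<le> apply_bcontfun h y"
  shows "ennreal (L h) \<le> (\<integral>\<^sup>+y. ennreal (apply_bcontfun h y) \<partial>riesz_measure)"
proof (rule ennreal_le_epsilon)
  fix e :: real assume e: "0 < e"
  let ?M = riesz_measure
  have [measurable]: "apply_bcontfun h \<in> borel_measurable ?M"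
    using borel_measurable_continuous_onI[OF continuous_on_apply_bcontfun[of UNIV h]]
    by (simp cong: measurable_cong_sets add: measurable_cong_sets[OF sets_riesz_measure refl])
  obtain b where b: "\<And>y. apply_bcontfun h y \<le> b"
    using bounded_apply_bcontfun[of h] unfolding bounded_real by (metis abs_le_iff rangeI)
  obtain N where N: "b / e \<le> real N" using real_arch_simple by blast
  define f where "f i y = min (max (apply_bcontfun h y / e - real i) 0) 1" for i y
  have ap: "apply_bcontfun (Bcontfun (f i)) = f i" for i
    unfolding f_def
    by (rule apply_Bcontfun) (use e in \<open>auto intro!: continuous_intros boundedI[of _ 1]\<close>)
  have sum_f: "apply_bcontfun h y = e * (\<Sum>i<N. f i y)" for y
  proof -
    have "apply_bcontfun h y / e \<le> real N" using N b[of y] e by (meson divide_right_mono less_imp_le order_trans)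
    then show ?thesis unfolding f_def
      using sum_clamped_layers[of "apply_bcontfun h y / e" N] h0[of y] e by simp
  qed
  define U where "U i = {y. real i < apply_bcontfun h y / e}" for i
  have U: "open (U i)" for i
    unfolding U_def using e by (intro open_Collect_less continuous_intros) auto
  have [measurable]: "U i \<in> sets ?M" for i by (simp add: sets_riesz_measure U)
  have f_mem: "Bcontfun (f i) \<in> below (U i)" for i
    unfolding below_def by (auto simp: ap f_def U_def indicator_def)
  have "h = e *\<^sub>R (\<Sum>i<N. Bcontfun (f i))"
    by (rule bcontfun_eqI) (simp add: bcontfun_rep_eqs sum_bcontfun_apply ap sum_f)
  then have "L h = e * (\<Sum>i<N. L (Bcontfun (f i)))"
    by (simp add: linear_scale[OF linear] linear_sum[OF linear])
  then have "ennreal (L h) = ennreal e * (\<Sum>i<N. ennreal (L (Bcontfun (f i))))"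
    using e by (simp add: ennreal_mult' sum_ennreal nonneg ap f_def)
  also have "\<dots> \<le> ennreal e * (\<Sum>i<N. emeasure ?M (U i))"
    using U by (intro mult_left_mono sum_mono) (auto simp: emeasure_riesz_measure outer_open intro!: le_content f_mem)
  also have "\<dots> = (\<integral>\<^sup>+y. ennreal e * (\<Sum>i<N. indicator (U i) y) \<partial>?M)"
    by (subst nn_integral_cmult) (auto simp: nn_integral_sum)
  also have "\<dots> \<le> (\<integral>\<^sup>+y. ennreal (apply_bcontfun h y) + ennreal e \<partial>?M)"
  proof (rule nn_integral_mono)
    fix y
    let ?s = "(\<Sum>i<N. if real i < apply_bcontfun h y / e then 1 else 0)"
    have "?s \<le> apply_bcontfun h y / e + 1"
      using sum_layer_indicators_le[of "apply_bcontfun h y / e" N] h0[of y] e by simp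
    then have le: "e * ?s \<le> apply_bcontfun h y + e" using e by (simp add: field_simps)
    have "(\<Sum>i<N. indicator (U i) y) = ennreal ?s"
      by (subst sum_ennreal[symmetric]) (auto simp: U_def intro!: sum.cong simp del: sum_ennreal)
    then have "ennreal e * (\<Sum>i<N. indicator (U i) y) = ennreal (e * ?s)"
      using e by (simp add: ennreal_mult' sum_nonneg)
    also have "\<dots> \<le> ennreal (apply_bcontfun h y + e)" by (rule ennreal_leI[OF le])
    finally show "ennreal e * (\<Sum>i<N. indicator (U i) y) \<le> ennreal (apply_bcontfun h y) + ennreal e"
      using h0 e by (simp add: ennreal_plus)
  qed
  also have "\<dots> = (\<integral>\<^sup>+y. ennreal (apply_bcontfun h y) \<partial>?M) + ennreal e * emeasure ?M UNIV"
    by (subst nn_integral_add)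
      (auto simp: space_riesz_measure)
  also have "\<dots> \<le> (\<integral>\<^sup>+y. ennreal (apply_bcontfun h y) \<partial>?M) + ennreal e"
    using mult_left_mono[OF emeasure_riesz_measure_le_1, of "ennreal e"] by (intro add_left_mono) simp
  finally show "ennreal (L h) \<le> (\<integral>\<^sup>+y. ennreal (apply_bcontfun h y) \<partial>?M) + ennreal e" .
qed

end

section \<open>Minimax: one measure for a whole convex set of functions\<close>

lemma sublinear_SUP_bcontfun:
  fixes K :: "'b::topological_space set"
  assumes "K \<noteq> {}"
  shows "sublinear (\<lambda>v. SUP y\<in>K. apply_bcontfun v y)"
proof -
  have bdd: "bdd_above (apply_bcontfun v ` K)" for v :: "'b \<Rightarrow>\<^sub>C real"
    by (rule bounded_imp_bdd_above, rule bounded_subset[OF bounded_apply_bcontfun[of v]]) auto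
  have upper: "apply_bcontfun v y \<le> (SUP y\<in>K. apply_bcontfun v y)" if "y \<in> K" for v :: "'b \<Rightarrow>\<^sub>C real" and y
    by (rule cSUP_upper[OF that bdd])
  show ?thesis
  proof (rule sublinearI)
    show "(SUP y\<in>K. apply_bcontfun (u + v) y) \<le> (SUP y\<in>K. apply_bcontfun u y) + (SUP y\<in>K. apply_bcontfun v y)"
      for u v :: "'b \<Rightarrow>\<^sub>C real"
      using upper by (intro cSUP_least assms) (auto simp: bcontfun_rep_eqs intro: add_mono)
    show "(SUP y\<in>K. apply_bcontfun (0 :: 'b \<Rightarrow>\<^sub>C real) y) = 0"
      using assms by (simp add: bcontfun_rep_eqs)
    show "(SUP y\<in>K. apply_bcontfun (c *\<^sub>R v) y) \<le> c * (SUP y\<in>K. apply_bcontfun v y)" if "0 < c"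
      for c and v :: "'b \<Rightarrow>\<^sub>C real"
      using upper that by (intro cSUP_least assms) (auto simp: bcontfun_rep_eqs)
  qed
qed

text \<open>Every member of \<open>P\<close> reaches \<open>e\<close> somewhere on \<open>K\<close>,
  so the supremum over \<open>K\<close> is nonnegative on the cone spanned by \<open>P - e\<close>.
  A linear functional that is below this supremum and nonnegative on the cone is at least
  \<open>e\<close> on all of \<open>P\<close>, and the Riesz construction turns it into a
  measure.\<close>

lemma subprobability_bounding_convex_set_below:
  fixes K :: "'b::metric_space set" and P :: "('b \<Rightarrow>\<^sub>C real) set"
  assumes K: "compact K" "K \<noteq> {}" and P: "convex P"
    and P0: "\<And>h y. h \<in> P \<Longrightarrow> 0 \<le> apply_bcontfun h y"
    and far: "\<And>h. h \<in> P \<Longrightarrow> \<exists>y\<in>K. e \<le> apply_bcontfun h y"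
  obtains M :: "'b measure" where "sets M = sets borel" "emeasure M UNIV \<le> 1" "emeasure M (- K) = 0"
    "\<And>h. h \<in> P \<Longrightarrow> ennreal e \<le> (\<integral>\<^sup>+y. ennreal (apply_bcontfun h y) \<partial>M)"
proof -
  define p where "p v = (SUP y\<in>K. apply_bcontfun v y)" for v :: "'b \<Rightarrow>\<^sub>C real"
  define G where "G = insert 0 {c *\<^sub>R (h - const_bcontfun e) | c h. 0 < c \<and> h \<in> P}"
  have upper: "apply_bcontfun v y \<le> p v" if "y \<in> K" for v y
    unfolding p_def
    by (intro cSUP_upper that bounded_imp_bdd_above bounded_subset[OF bounded_apply_bcontfun[of v]]) auto
  obtain L where L: "linear L" "\<And>v. L v \<le> p v" "\<And>g. g \<in> G \<Longrightarrow> 0 \<le> L g"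
  proof (rule linear_below_sublinear_nonneg_on_cone[of p G])
    show "sublinear p" unfolding p_def by (rule sublinear_SUP_bcontfun[OF K(2)])
    show "0 \<in> G" by (simp add: G_def)
    show "c *\<^sub>R g \<in> G" if "0 < c" "g \<in> G" for c g
    proof (cases "g = 0")
      case False
      then obtain d h where "g = d *\<^sub>R (h - const_bcontfun e)" "0 < d" "h \<in> P"
        using \<open>g \<in> G\<close> unfolding G_def by auto
      then have "c *\<^sub>R g = (c * d) *\<^sub>R (h - const_bcontfun e) \<and> 0 < c * d \<and> h \<in> P"
        using \<open>0 < c\<close> by simp
      then show ?thesis unfolding G_def by blast
    qed (simp add: G_def)
    show "0 \<le> p g" if "g \<in> G" for g
    proof -
      consider "g = 0" | c h where "g = c *\<^sub>R (h - const_bcontfun e)" "0 < c" "h \<in> P"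
        using \<open>g \<in> G\<close> unfolding G_def by auto
      then show ?thesis
      proof cases
        case 1
        obtain y where "y \<in> K" using K(2) by auto
        then show ?thesis using upper[of y g] 1 by (simp add: bcontfun_rep_eqs)
      next
        case 2
        obtain y where "y \<in> K" "e \<le> apply_bcontfun h y" using far[OF 2(3)] by auto
        then show ?thesis using upper[of y g] 2 by (simp add: bcontfun_rep_eqs) (smt (verit) mult_nonneg_nonneg)
      qed
    qed
    show "g + h \<in> G" if gG: "g \<in> G" and hG: "h \<in> G" for g h
    proof (cases "g = 0 \<or> h = 0")
      case True
      then show ?thesis using gG hG by auto
    next
      case False
      then obtain c k d l where g: "g = c *\<^sub>R (k - const_bcontfun e)" "0 < c" "k \<in> P"
        and h: "h = d *\<^sub>R (l - const_bcontfun e)" "0 < d" "l \<in> P"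
        using gG hG unfolding G_def by auto
      \<comment> \<open>Convexity closes the cone under sums: the weights \<open>c\<close> and
        \<open>d\<close> are normalised by \<open>c + d\<close>.\<close>
      have "(c / (c + d)) *\<^sub>R k + (d / (c + d)) *\<^sub>R l \<in> P"
        using g h by (intro convexD[OF P]) (auto simp: add_divide_distrib[symmetric])
      moreover have "g + h = (c + d) *\<^sub>R ((c / (c + d)) *\<^sub>R k + (d / (c + d)) *\<^sub>R l - const_bcontfun e)"
      proof -
        have "c + d \<noteq> 0" using g h by simp
        then show ?thesis by (simp add: g h scaleR_add_right scaleR_diff_right scaleR_add_left)
      qed
      ultimately show ?thesis unfolding G_def using g h
        by (auto intro!: exI[of _ "c + d"] intro: add_pos_pos)
    qed
  qed blast
  interpret dominated_functional K L
  proof (rule dominated_functional.intro)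
    show "L h \<le> c" if "\<And>y. y \<in> K \<Longrightarrow> apply_bcontfun h y \<le> c" for h c
      using L(2)[of h] cSUP_least[OF K(2), of "apply_bcontfun h" c] that unfolding p_def by force
    show "linear L" "compact K" by fact+
  qed
  show thesis
  proof
    fix h assume h: "h \<in> P"
    have "0 \<le> L (h - const_bcontfun e)"
      by (rule L(3)) (use h in \<open>auto simp: G_def intro!: exI[of _ 1]\<close>)
    \<comment> \<open>Domination at the constant \<open>- e\<close> gives \<open>e <= L e\<close>,
      so no mass is lost on constants.\<close>
    moreover have "- L (const_bcontfun e) \<le> - e"
      using bound[of "- const_bcontfun e" "- e"] by (simp add: bcontfun_rep_eqs linear_neg[OF L(1)])
    ultimately have "e \<le> L h" by (simp add: linear_diff[OF L(1)])
    then show "ennreal e \<le> (\<integral>\<^sup>+y. ennreal (apply_bcontfun h y) \<partial>riesz_measure)"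
      using le_nn_integral_riesz_measure[OF P0[OF h]] by (meson ennreal_leI order_trans)
  qed (fact sets_riesz_measure emeasure_riesz_measure_le_1 emeasure_riesz_measure_Compl)+
qed

section \<open>Square-integrable functions\<close>

lemma square_integrableD:
  assumes "f \<in> square_integrable M"
  shows "f \<in> borel_measurable M" "integrable M (\<lambda>x. (f x)\<^sup>2)"
  using assms by (auto simp: square_integrable_def)

lemma square_integrable_bound:
  assumes "g \<in> borel_measurable M" "integrable M h" "\<And>x. x \<in> space M \<Longrightarrow> (g x)\<^sup>2 \<le> h x"
  shows "g \<in> square_integrable M"
proof -
  have "integrable M (\<lambda>x. (g x)\<^sup>2)"
    using assms by (intro Bochner_Integration.integrable_bound[OF assms(2)] AE_I2) force+
  with assms(1) show ?thesis by (simp add: square_integrable_def)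
qed

lemma square_integrable_add:
  assumes f: "f \<in> square_integrable M" and g: "g \<in> square_integrable M"
  shows "(\<lambda>x. f x + g x) \<in> square_integrable M"
proof (rule square_integrable_bound[where h = "\<lambda>x. 2 * (f x)\<^sup>2 + 2 * (g x)\<^sup>2"])
  show "(f x + g x)\<^sup>2 \<le> 2 * (f x)\<^sup>2 + 2 * (g x)\<^sup>2" for x
    using zero_le_power2[of "f x - g x"] by (simp add: power2_sum power2_diff)
qed (use square_integrableD[OF f] square_integrableD[OF g] in auto)

lemma square_integrable_cmult:
  "f \<in> square_integrable M \<Longrightarrow> (\<lambda>x. c * f x) \<in> square_integrable M"
  by (auto simp: square_integrable_def power_mult_distrib)

lemma square_integrable_diff:
  assumes "f \<in> square_integrable M" "g \<in> square_integrable M"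
  shows "(\<lambda>x. f x - g x) \<in> square_integrable M"
  using square_integrable_add[OF assms(1) square_integrable_cmult[OF assms(2), of "-1"]] by simp

lemma square_integrable_AE_cong:
  assumes "f \<in> square_integrable M" "g \<in> borel_measurable M" "AE x in M. f x = g x"
  shows "g \<in> square_integrable M"
proof -
  have "integrable M (\<lambda>x. (f x)\<^sup>2) \<longleftrightarrow> integrable M (\<lambda>x. (g x)\<^sup>2)"
    using assms square_integrableD[OF assms(1)] by (intro integrable_cong_AE) auto
  then show ?thesis using assms by (simp add: square_integrable_def)
qed

lemma (in finite_measure) square_integrable_bounded:
  assumes "f \<in> borel_measurable M" "\<And>x. x \<in> space M \<Longrightarrow> \<bar>f x\<bar> \<le> c"
  shows "f \<in> square_integrable M"
proof (rule square_integrable_bound[where h = "\<lambda>x. c\<^sup>2"])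
  show "(f x)\<^sup>2 \<le> c\<^sup>2" if "x \<in> space M" for x
    using assms(2)[OF that] by (metis abs_ge_zero power2_abs power_mono)
qed (use assms in auto)

abbreviation L2_dist :: "'a measure \<Rightarrow> ('a \<Rightarrow> real) \<Rightarrow> ('a \<Rightarrow> real) \<Rightarrow> real" where
  "L2_dist M f g \<equiv> L2_norm M (\<lambda>x. f x - g x)"

lemma L2_norm_nonneg: "0 \<le> L2_norm M f"
  by (simp add: L2_norm_def)

lemma L2_norm_power2: "(L2_norm M f)\<^sup>2 = (\<integral>x. (f x)\<^sup>2 \<partial>M)"
  by (simp add: L2_norm_def)

lemma L2_norm_cmult: "L2_norm M (\<lambda>x. c * f x) = \<bar>c\<bar> * L2_norm M f"
  by (simp add: L2_norm_def power_mult_distrib real_sqrt_mult)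

lemma L2_norm_diff_commute: "L2_dist M f g = L2_dist M g f"
  by (simp add: L2_norm_def power2_commute)

lemma L2_norm_AE_cong:
  assumes "f \<in> borel_measurable M" "g \<in> borel_measurable M" "AE x in M. f x = g x"
  shows "L2_norm M f = L2_norm M g"
proof -
  have "(\<integral>x. (f x)\<^sup>2 \<partial>M) = (\<integral>x. (g x)\<^sup>2 \<partial>M)"
    using assms by (intro integral_cong_AE) auto
  then show ?thesis by (simp add: L2_norm_def)
qed

lemma L2_norm_mono:
  assumes "g \<in> square_integrable M" "f \<in> borel_measurable M" "\<And>x. x \<in> space M \<Longrightarrow> \<bar>f x\<bar> \<le> \<bar>g x\<bar>"
  shows "L2_norm M f \<le> L2_norm M g"
proof -
  have "f \<in> square_integrable M"
    using assms square_integrableD[OF assms(1)] abs_le_square_iff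
    by (intro square_integrable_bound[of f M "\<lambda>x. (g x)\<^sup>2"]) blast+
  then have "(\<integral>x. (f x)\<^sup>2 \<partial>M) \<le> (\<integral>x. (g x)\<^sup>2 \<partial>M)"
    using assms square_integrableD abs_le_square_iff by (intro integral_mono) blast+
  then show ?thesis by (simp add: L2_norm_def)
qed

lemma (in finite_measure) L2_norm_le_sup:
  assumes "f \<in> borel_measurable M" "\<And>x. x \<in> space M \<Longrightarrow> \<bar>f x\<bar> \<le> c" "0 \<le> c"
  shows "L2_norm M f \<le> c * sqrt (measure M (space M))"
proof -
  have "L2_norm M f \<le> L2_norm M (\<lambda>x. c * 1)"
    using assms by (intro L2_norm_mono square_integrable_bounded[of _ c]) auto
  also have "\<dots> = c * sqrt (measure M (space M))"
    by (subst L2_norm_cmult) (use assms(3) in \<open>simp add: L2_norm_def\<close>)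
  finally show ?thesis .
qed

text \<open>The two sides differ by \<open>(b * x - a * y)^2 / (a * b)\<close>. With
  \<open>a\<close> and \<open>b\<close> close to the norms of two functions, integration yields
  Minkowski's inequality.\<close>

lemma square_add_le_weighted:
  fixes x y a b :: real
  assumes "0 < a" "0 < b"
  shows "(x + y)\<^sup>2 \<le> (a + b) / a * x\<^sup>2 + (a + b) / b * y\<^sup>2"
proof -
  have "0 \<le> (b * x - a * y)\<^sup>2 / (a * b)" using assms by simp
  also have "\<dots> = (a + b) / a * x\<^sup>2 + (a + b) / b * y\<^sup>2 - (x + y)\<^sup>2"
    using assms by (simp add: field_simps power2_eq_square)
  finally show ?thesis by simp
qed

lemma L2_norm_triangle:
  assumes f: "f \<in> square_integrable M" and g: "g \<in> square_integrable M"
  shows "L2_norm M (\<lambda>x. f x + g x) \<le> L2_norm M f + L2_norm M g"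
proof (rule field_le_epsilon)
  fix e :: real assume "0 < e"
  \<comment> \<open>The summand \<open>e/2\<close> keeps both weights positive when a norm
    vanishes.\<close>
  define a b where "a = L2_norm M f + e/2" and "b = L2_norm M g + e/2"
  have ab: "0 < a" "0 < b" "L2_norm M f \<le> a" "L2_norm M g \<le> b"
    using \<open>0 < e\<close> L2_norm_nonneg[of M f] L2_norm_nonneg[of M g] by (auto simp: a_def b_def)
  have "(\<integral>x. (f x + g x)\<^sup>2 \<partial>M) \<le> (\<integral>x. (a + b) / a * (f x)\<^sup>2 + (a + b) / b * (g x)\<^sup>2 \<partial>M)"
    using square_integrableD[OF f] square_integrableD[OF g] square_integrableD[OF square_integrable_add[OF f g]]
    by (intro integral_mono square_add_le_weighted ab) auto
  also have "\<dots> = (a + b) / a * (L2_norm M f)\<^sup>2 + (a + b) / b * (L2_norm M g)\<^sup>2"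
    using square_integrableD[OF f] square_integrableD[OF g] by (simp add: L2_norm_power2)
  also have "\<dots> \<le> (a + b) / a * a\<^sup>2 + (a + b) / b * b\<^sup>2"
    using ab L2_norm_nonneg[of M f] L2_norm_nonneg[of M g] by (intro add_mono mult_left_mono power_mono) auto
  also have "\<dots> = (a + b)\<^sup>2" using ab by (simp add: power2_eq_square field_simps)
  finally have "L2_norm M (\<lambda>x. f x + g x) \<le> sqrt ((a + b)\<^sup>2)"
    unfolding L2_norm_def[of M "\<lambda>x. f x + g x"] by (rule real_sqrt_le_mono)
  then show "L2_norm M (\<lambda>x. f x + g x) \<le> L2_norm M f + L2_norm M g + e"
    using ab by (simp add: a_def b_def)
qed

lemma L2_norm_triangle_diff:
  assumes "f \<in> square_integrable M" "g \<in> square_integrable M" "h \<in> square_integrable M"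
  shows "L2_dist M f h \<le> L2_dist M f g + L2_dist M g h"
  using L2_norm_triangle[OF square_integrable_diff[OF assms(1,2)] square_integrable_diff[OF assms(2,3)]]
  by simp

lemma L2_norm_triangle_sub:
  assumes "f \<in> square_integrable M" "g \<in> square_integrable M"
  shows "L2_dist M f g \<le> L2_norm M f + L2_norm M g"
  using L2_norm_triangle[OF assms(1) square_integrable_cmult[OF assms(2), of "-1"]]
    L2_norm_cmult[of M "-1" g] by simp

text \<open>A substitute for Cauchy--Schwarz, by integrating \<open>|s| <= t * s^2 + 1/t\<close>.
  The weight \<open>t\<close> is left to the application: \<open>2 ^ k\<close> in the proof of
  completeness, and a large number in the passage from \<open>L^1\<close> to \<open>L^2\<close>
  lower semicontinuity.\<close>

lemma (in finite_measure) integral_abs_le_weighted: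
  assumes f: "f \<in> square_integrable M" and t: "0 < t"
  shows "integrable M (\<lambda>x. \<bar>f x\<bar>)"
    and "(\<integral>x. \<bar>f x\<bar> \<partial>M) \<le> t * (L2_norm M f)\<^sup>2 + measure M (space M) / t"
proof -
  note [measurable] = square_integrableD(1)[OF f]
  have le: "\<bar>f x\<bar> \<le> t * (f x)\<^sup>2 + 1 / t" for x
  proof -
    have "0 \<le> t * (\<bar>f x\<bar> - 1 / (2 * t))\<^sup>2" using t by simp
    also have "\<dots> = t * (f x)\<^sup>2 + 1 / (4 * t) - \<bar>f x\<bar>"
      using t by (simp add: power2_diff power2_eq_square field_simps)
    also have "1 / (4 * t) \<le> 1 / t" using t by (simp add: field_simps)
    finally show ?thesis by simp
  qed
  have int: "integrable M (\<lambda>x. t * (f x)\<^sup>2 + 1 / t)" using square_integrableD[OF f] by simp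
  show i: "integrable M (\<lambda>x. \<bar>f x\<bar>)"
    by (rule Bochner_Integration.integrable_bound[OF int]) (use le in \<open>auto intro!: AE_I2 order_trans[OF le]\<close>)
  have "(\<integral>x. \<bar>f x\<bar> \<partial>M) \<le> (\<integral>x. t * (f x)\<^sup>2 + 1 / t \<partial>M)"
    by (rule integral_mono[OF i int]) (rule le)
  also have "\<dots> = t * (L2_norm M f)\<^sup>2 + measure M (space M) / t"
    using square_integrableD[OF f] by (simp add: L2_norm_power2)
  finally show "(\<integral>x. \<bar>f x\<bar> \<partial>M) \<le> t * (L2_norm M f)\<^sup>2 + measure M (space M) / t" .
qed

text \<open>Riesz--Fischer: a subsequence with increments of norm at most \<open>(1/2) ^ k\<close>
  has summable increments in \<open>L^1\<close>, hence converges almost everywhere, and Fatou's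
  lemma makes this limit an \<open>L^2\<close> limit of the full sequence.\<close>

lemma (in finite_measure) L2_complete:
  fixes u :: "nat \<Rightarrow> 'a \<Rightarrow> real"
  assumes u: "\<And>n. u n \<in> square_integrable M"
    and Cauchy: "\<And>e. 0 < e \<Longrightarrow> \<exists>N. \<forall>m\<ge>N. \<forall>n\<ge>N. L2_dist M (u m) (u n) < e"
  obtains v where "v \<in> square_integrable M" "(\<lambda>n. L2_dist M (u n) v) \<longlonglongrightarrow> 0"
proof -
  note [measurable] = square_integrableD(1)[OF u]
  obtain R where R: "\<And>k m n. R k \<le> m \<Longrightarrow> R k \<le> n \<Longrightarrow> L2_dist M (u m) (u n) < (1/2) ^ k"
    using Cauchy[of "(1/2) ^ k" for k] by (simp, metis)
  \<comment> \<open>Summing makes the index increasing in \<open>k\<close> and at least both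
    \<open>R k\<close> and \<open>k\<close>.\<close>
  define r where "r k = (\<Sum>i\<le>k. Suc (R i))" for k
  have r_ge: "R k \<le> r k" for k
    using member_le_sum[of k "{..k}" "\<lambda>i. Suc (R i)"] by (simp add: r_def)
  have r_id: "k \<le> r k" for k by (induction k) (auto simp: r_def)
  have r_mono: "r k \<le> r (Suc k)" for k unfolding r_def by simp
  define d where "d k x = u (r (Suc k)) x - u (r k) x" for k x
  have [measurable]: "d k \<in> borel_measurable M" for k unfolding d_def by measurable
  have d: "d k \<in> square_integrable M" "L2_norm M (d k) \<le> (1/2) ^ k" for k
    using R[of k "r (Suc k)" "r k"] order_trans[OF r_ge r_mono, of k] r_ge[of k]
    unfolding d_def by (auto intro!: square_integrable_diff u)
  let ?m = "measure M (space M)"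
  have d1: "(\<integral>x. \<bar>d k x\<bar> \<partial>M) \<le> (1 + ?m) * (1/2) ^ k" for k
  proof -
    \<comment> \<open>The weight \<open>2 ^ k\<close> balances the two terms: the squared norm is at
      most \<open>(1/4) ^ k\<close>, so both are of order \<open>(1/2) ^ k\<close>.\<close>
    have "(\<integral>x. \<bar>d k x\<bar> \<partial>M) \<le> 2 ^ k * (L2_norm M (d k))\<^sup>2 + ?m / 2 ^ k"
      by (rule integral_abs_le_weighted(2)[OF d(1)]) simp
    also have "\<dots> \<le> 2 ^ k * ((1/2) ^ k)\<^sup>2 + ?m / 2 ^ k"
      using d(2)[of k] L2_norm_nonneg[of M "d k"] by (intro add_mono mult_left_mono power_mono) auto
    also have "\<dots> = (1 + ?m) * (1/2) ^ k"
      by (simp add: power2_eq_square field_simps)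
    finally show ?thesis .
  qed
  have "(\<integral>\<^sup>+x. (\<Sum>k. ennreal \<bar>d k x\<bar>) \<partial>M) = (\<Sum>k. \<integral>\<^sup>+x. ennreal \<bar>d k x\<bar> \<partial>M)"
    by (rule nn_integral_suminf) measurable
  also have "\<dots> = (\<Sum>k. ennreal (\<integral>x. \<bar>d k x\<bar> \<partial>M))"
    by (intro suminf_cong nn_integral_eq_integral integral_abs_le_weighted(1)[OF d(1), of 1]) auto
  also have "\<dots> \<le> (\<Sum>k. ennreal ((1 + ?m) * (1/2) ^ k))"
    by (intro suminf_le ennreal_leI d1) auto
  also have "\<dots> = ennreal (\<Sum>k. (1 + ?m) * (1/2) ^ k)"
    by (rule suminf_ennreal2) (auto intro!: summable_mult summable_geometric)
  also have "\<dots> < \<infinity>" by simp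
  finally have "AE x in M. (\<Sum>k. ennreal \<bar>d k x\<bar>) \<noteq> \<infinity>"
    by (intro nn_integral_PInf_AE) auto
  then have conv: "AE x in M. convergent (\<lambda>k. u (r k) x)"
  proof eventually_elim
    case (elim x)
    then have "summable (\<lambda>k. \<bar>d k x\<bar>)"
      by (intro summable_suminf_not_top) (auto simp: top_ennreal_def)
    then have "summable (\<lambda>k. d k x)" by (rule summable_rabs_cancel)
    then have "convergent (\<lambda>n. u (r 0) x + (\<Sum>k<n. d k x))"
      by (intro convergent_add convergent_const) (simp add: summable_iff_convergent)
    moreover have "u (r 0) x + (\<Sum>k<n. d k x) = u (r n) x" for n
      by (induction n) (auto simp: d_def)
    ultimately show ?case by simp
  qed
  \<comment> \<open>Where the subsequence diverges \<open>lim\<close> is unspecified; this concerns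
    a null set, and \<open>v\<close> is measurable all the same.\<close>
  define v where "v x = lim (\<lambda>k. u (r k) x)" for x
  have [measurable]: "v \<in> borel_measurable M"
    unfolding v_def by (rule borel_measurable_lim_metric) measurable
  have tail: "(\<integral>\<^sup>+x. ennreal ((u n x - v x)\<^sup>2) \<partial>M) \<le> ennreal (e\<^sup>2)"
    if N: "\<And>m. N \<le> m \<Longrightarrow> L2_dist M (u n) (u m) \<le> e" for n N e
  proof -
    have lim_r: "\<forall>\<^sub>F k in sequentially. N \<le> r k"
      using r_id order_trans by (intro eventually_sequentiallyI[of N]) blast
    have "(\<integral>\<^sup>+x. ennreal ((u n x - v x)\<^sup>2) \<partial>M)
        = (\<integral>\<^sup>+x. liminf (\<lambda>k. ennreal ((u n x - u (r k) x)\<^sup>2)) \<partial>M)"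
    proof (rule nn_integral_cong_AE)
      show "AE x in M. ennreal ((u n x - v x)\<^sup>2) = liminf (\<lambda>k. ennreal ((u n x - u (r k) x)\<^sup>2))"
        using conv
      proof eventually_elim
        case (elim x)
        then have "(\<lambda>k. u (r k) x) \<longlonglongrightarrow> v x" by (simp add: v_def convergent_LIMSEQ_iff)
        then have "(\<lambda>k. ennreal ((u n x - u (r k) x)\<^sup>2)) \<longlonglongrightarrow> ennreal ((u n x - v x)\<^sup>2)"
          by (intro tendsto_intros)
        then show ?case by (intro lim_imp_Liminf[symmetric]) auto
      qed
    qed
    also have "\<dots> \<le> liminf (\<lambda>k. \<integral>\<^sup>+x. ennreal ((u n x - u (r k) x)\<^sup>2) \<partial>M)"
      by (rule nn_integral_liminf) measurable
    also have "\<dots> \<le> liminf (\<lambda>k. ennreal (e\<^sup>2))"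
    proof (rule Liminf_mono, rule eventually_mono[OF lim_r])
      fix k assume "N \<le> r k"
      have "(\<integral>\<^sup>+x. ennreal ((u n x - u (r k) x)\<^sup>2) \<partial>M) = ennreal ((L2_norm M (\<lambda>x. u n x - u (r k) x))\<^sup>2)"
        unfolding L2_norm_power2
        by (intro nn_integral_eq_integral square_integrableD square_integrable_diff u) auto
      also have "\<dots> \<le> ennreal (e\<^sup>2)"
        using N[OF \<open>N \<le> r k\<close>] by (intro ennreal_leI power_mono L2_norm_nonneg)
      finally show "(\<integral>\<^sup>+x. ennreal ((u n x - u (r k) x)\<^sup>2) \<partial>M) \<le> ennreal (e\<^sup>2)" .
    qed
    finally show ?thesis by (simp add: Liminf_const)
  qed
  have sq: "(\<lambda>x. u n x - v x) \<in> square_integrable M \<and> L2_dist M (u n) v \<le> e"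
    if N: "\<And>m. N \<le> m \<Longrightarrow> L2_dist M (u n) (u m) \<le> e" for n N e
  proof -
    have e: "0 \<le> e" using N[of N] L2_norm_nonneg order_trans by blast
    have le: "(\<integral>\<^sup>+x. ennreal ((u n x - v x)\<^sup>2) \<partial>M) \<le> ennreal (e\<^sup>2)" using tail N by blast
    then have int: "integrable M (\<lambda>x. (u n x - v x)\<^sup>2)"
      by (intro integrableI_nonneg) (auto intro: le_less_trans)
    then have "ennreal ((L2_dist M (u n) v)\<^sup>2) \<le> ennreal (e\<^sup>2)"
      using le by (simp add: L2_norm_power2 nn_integral_eq_integral)
    then have "L2_dist M (u n) v \<le> e"
      using e power2_le_imp_le by fastforce
    with int show ?thesis by (simp add: square_integrable_def)
  qed
  have lim: "\<exists>N. \<forall>n\<ge>N. (\<lambda>x. u n x - v x) \<in> square_integrable M \<and> L2_dist M (u n) v < e" if e: "0 < e" for e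
  proof -
    obtain N where "\<forall>m\<ge>N. \<forall>n\<ge>N. L2_dist M (u m) (u n) < e/2"
      using Cauchy[of "e/2"] e by auto
    then have "(\<lambda>x. u n x - v x) \<in> square_integrable M \<and> L2_dist M (u n) v \<le> e/2" if "N \<le> n" for n
      using that by (intro sq[of N]) (auto intro: less_imp_le)
    then show ?thesis using e by force
  qed
  show thesis
  proof
    obtain n where "(\<lambda>x. u n x - v x) \<in> square_integrable M" using lim[of 1] by auto
    from square_integrable_diff[OF u[of n] this] show "v \<in> square_integrable M" by simp
    show "(\<lambda>n. L2_dist M (u n) v) \<longlonglongrightarrow> 0"
      using lim by (intro LIMSEQ_I) (force simp: L2_norm_nonneg)
  qed
qed

section \<open>Quadratic forms obeying the parallelogram law\<close>

text \<open>After subtraction of the linear function with the same value at 1, an additive function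
  remains that vanishes on the integers. It depends on the fractional part only and is therefore
  bounded everywhere, but an additive function grows along the multiples of a point where it does
  not vanish.\<close>

lemma additive_bounded_imp_linear:
  fixes \<phi> :: "real \<Rightarrow> real"
  assumes add: "\<And>a b. \<phi> (a + b) = \<phi> a + \<phi> b" and bdd: "\<And>a. \<bar>a\<bar> \<le> 1 \<Longrightarrow> \<bar>\<phi> a\<bar> \<le> C"
  shows "\<phi> a = a * \<phi> 1"
proof -
  define \<psi> where "\<psi> a = \<phi> a - a * \<phi> 1" for a
  have psi_add: "\<psi> (a + b) = \<psi> a + \<psi> b" for a b by (simp add: \<psi>_def add algebra_simps)
  have psi0: "\<psi> 0 = 0" using psi_add[of 0 0] by simp
  have psi_uminus: "\<psi> (- a) = - \<psi> a" for a using psi_add[of a "-a"] psi0 by simp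
  have psi_nat: "\<psi> (real n * a) = real n * \<psi> a" for n a
    by (induction n) (auto simp: psi0 psi_add algebra_simps)
  have psi_int: "\<psi> (of_int k) = 0" for k
    using psi_nat[of "nat k" 1] psi_nat[of "nat (- k)" 1] psi_uminus[of "of_int (- k)"]
    by (cases "0 \<le> k") (auto simp: \<psi>_def)
  have psi_bdd: "\<bar>\<psi> t\<bar> \<le> 2 * C" for t
  proof -
    have f: "\<bar>frac t\<bar> \<le> 1" using frac_ge_0[of t] frac_lt_1[of t] by linarith
    have "\<psi> t = \<psi> (frac t)"
      using psi_add[of "of_int \<lfloor>t\<rfloor>" "frac t"] psi_int by (simp add: frac_def)
    also have "\<bar>\<dots>\<bar> \<le> \<bar>\<phi> (frac t)\<bar> + \<bar>frac t\<bar> * \<bar>\<phi> 1\<bar>" 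
      using abs_triangle_ineq4[of "\<phi> (frac t)" "frac t * \<phi> 1"] by (simp add: \<psi>_def abs_mult)
    also have "\<dots> \<le> C + 1 * C"
      using f by (intro add_mono mult_mono bdd) auto
    finally show ?thesis by simp
  qed
  have "\<psi> a = 0"
  proof (rule ccontr)
    assume "\<psi> a \<noteq> 0"
    obtain n :: nat where "2 * C < real n * \<bar>\<psi> a\<bar>"
      using reals_Archimedean3[of "\<bar>\<psi> a\<bar>"] \<open>\<psi> a \<noteq> 0\<close> by auto
    then show False using psi_bdd[of "real n * a"] by (simp add: psi_nat abs_mult)
  qed
  then show ?thesis by (simp add: \<psi>_def)
qed

locale parallelogram_form =
  fixes V :: "('a \<Rightarrow> real) set" and Q :: "('a \<Rightarrow> real) \<Rightarrow> real"
  assumes V_add: "\<And>f g. f \<in> V \<Longrightarrow> g \<in> V \<Longrightarrow> (\<lambda>x. f x + g x) \<in> V"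
    and V_cmult: "\<And>c f. f \<in> V \<Longrightarrow> (\<lambda>x. c * f x) \<in> V"
    and Q_nonneg: "\<And>f. f \<in> V \<Longrightarrow> 0 \<le> Q f"
    and Q_cmult: "\<And>c f. f \<in> V \<Longrightarrow> Q (\<lambda>x. c * f x) = c\<^sup>2 * Q f"
    and parallelogram: "\<And>f g. f \<in> V \<Longrightarrow> g \<in> V \<Longrightarrow>
          Q (\<lambda>x. f x + g x) + Q (\<lambda>x. f x - g x) = 2 * Q f + 2 * Q g"
begin

lemma V_diff: "f \<in> V \<Longrightarrow> g \<in> V \<Longrightarrow> (\<lambda>x. f x - g x) \<in> V"
  using V_add[of f "\<lambda>x. -1 * g x"] V_cmult[of g "-1"] by simp

lemma Q_uminus: "f \<in> V \<Longrightarrow> Q (\<lambda>x. - f x) = Q f"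
  using Q_cmult[of f "-1"] by simp

lemma Q_diff_commute: "f \<in> V \<Longrightarrow> g \<in> V \<Longrightarrow> Q (\<lambda>x. f x - g x) = Q (\<lambda>x. g x - f x)"
  using Q_uminus[OF V_diff, of f g] by simp

text \<open>Jordan--von Neumann polarisation; the factor 4 makes
  \<open>polar f f = Q f\<close>.\<close>

definition polar :: "('a \<Rightarrow> real) \<Rightarrow> ('a \<Rightarrow> real) \<Rightarrow> real" where
  "polar f g = (Q (\<lambda>x. f x + g x) - Q (\<lambda>x. f x - g x)) / 4"

lemma polar_commute: "f \<in> V \<Longrightarrow> g \<in> V \<Longrightarrow> polar f g = polar g f"
  unfolding polar_def using Q_diff_commute[of f g] by (simp add: add.commute)

lemma polar_self: "f \<in> V \<Longrightarrow> polar f f = Q f"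
  unfolding polar_def using Q_cmult[of f 2] Q_cmult[of f 0] by simp

lemma polar_0_left: "h \<in> V \<Longrightarrow> polar (\<lambda>x. 0) h = 0"
  unfolding polar_def using Q_uminus[of h] by simp

text \<open>The parallelogram law for \<open>f + h\<close> and \<open>g\<close>, minus the one for
  \<open>f - h\<close> and \<open>g\<close>.\<close>

lemma polar_add_diff:
  assumes f: "f \<in> V" and g: "g \<in> V" and h: "h \<in> V"
  shows "polar (\<lambda>x. f x + g x) h + polar (\<lambda>x. f x - g x) h = 2 * polar f h"
proof -
  have "(\<lambda>x. f x + g x + h x) = (\<lambda>x. f x + h x + g x)" "(\<lambda>x. f x + g x - h x) = (\<lambda>x. f x - h x + g x)"
    "(\<lambda>x. f x - g x + h x) = (\<lambda>x. f x + h x - g x)" "(\<lambda>x. f x - g x - h x) = (\<lambda>x. f x - h x - g x)"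
    by (auto simp: fun_eq_iff)
  then show ?thesis
    using parallelogram[OF V_add[OF f h] g] parallelogram[OF V_diff[OF f h] g]
    by (simp add: polar_def field_simps)
qed

text \<open>This is \<open>polar_add_diff\<close> at half the sum and half the difference of
  \<open>f\<close> and \<open>g\<close>.\<close>

lemma polar_add:
  assumes f: "f \<in> V" and g: "g \<in> V" and h: "h \<in> V"
  shows "polar (\<lambda>x. f x + g x) h = polar f h + polar g h"
proof -
  have double: "polar (\<lambda>x. 2 * k x) h = 2 * polar k h" if "k \<in> V" for k
    using polar_add_diff[OF that that h] polar_0_left[OF h] by simp
  have s: "(\<lambda>x. 1/2 * (f x + g x)) \<in> V" and d: "(\<lambda>x. 1/2 * (f x - g x)) \<in> V"
    by (intro V_cmult V_add V_diff f g)+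
  have eq: "(\<lambda>x. 1/2 * (f x + g x) + 1/2 * (f x - g x)) = f"
    "(\<lambda>x. 1/2 * (f x + g x) - 1/2 * (f x - g x)) = g"
    "(\<lambda>x. 2 * (1/2 * (f x + g x))) = (\<lambda>x. f x + g x)" by (auto simp: fun_eq_iff field_simps)
  show ?thesis
    using polar_add_diff[OF s d h] double[OF s] by (simp only: eq)
qed

text \<open>Both terms on the left of the parallelogram law are nonnegative, so each is at most the
  right-hand side. The bound replaces continuity in the proof of homogeneity and Cauchy--Schwarz in
  the proof of convexity.\<close>

lemma polar_bound: "f \<in> V \<Longrightarrow> g \<in> V \<Longrightarrow> \<bar>polar f g\<bar> \<le> (Q f + Q g) / 2"
  using parallelogram[of f g] Q_nonneg[OF V_add, of f g] Q_nonneg[OF V_diff, of f g]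
  unfolding polar_def by (auto simp: abs_le_iff field_simps)

lemma polar_cmult:
  assumes f: "f \<in> V" and h: "h \<in> V"
  shows "polar (\<lambda>x. c * f x) h = c * polar f h"
proof -
  have "polar (\<lambda>x. c * f x) h = c * polar (\<lambda>x. 1 * f x) h"
  proof (rule additive_bounded_imp_linear[where C = "(Q f + Q h) / 2"])
    show "polar (\<lambda>x. (a + b) * f x) h = polar (\<lambda>x. a * f x) h + polar (\<lambda>x. b * f x) h" for a b
      using polar_add[OF V_cmult[OF f, of a] V_cmult[OF f, of b] h] by (simp add: algebra_simps)
    show "\<bar>polar (\<lambda>x. a * f x) h\<bar> \<le> (Q f + Q h) / 2" if "\<bar>a\<bar> \<le> 1" for a
    proof -
      have "a\<^sup>2 * Q f \<le> 1 * Q f"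
        using that Q_nonneg[OF f] by (intro mult_right_mono) (auto simp: abs_square_le_1)
      then show ?thesis using polar_bound[OF V_cmult[OF f, of a] h] by (simp add: Q_cmult[OF f])
    qed
  qed
  then show ?thesis by simp
qed

end

section \<open>Relaxation of a quadratic form\<close>

locale relaxable_form = finite_measure M + parallelogram_form B q
  for M :: "'a measure" and B :: "('a \<Rightarrow> real) set" and q +
  assumes B_square_integrable: "B \<subseteq> square_integrable M"
    and zero_in_B: "(\<lambda>x. 0) \<in> B"
begin

text \<open>Says that the relaxed form is at most \<open>c\<close> at \<open>v\<close>: some
  sequence in \<open>B\<close> tends to \<open>v\<close> in \<open>L^2\<close> with upper limit of
  \<open>q\<close> at most \<open>c\<close>. Working with such bounds avoids infinite values off the
  domain.\<close>

definition approx :: "('a \<Rightarrow> real) \<Rightarrow> real \<Rightarrow> bool" where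
  "approx v c \<longleftrightarrow> v \<in> square_integrable M \<and>
     (\<forall>r>0. \<exists>h\<in>B. L2_dist M h v < r \<and> q h < c + r)"

definition dom :: "('a \<Rightarrow> real) set" where
  "dom = {v. \<exists>c. approx v c}"

text \<open>Off \<open>dom\<close> this is the infimum of the empty set, an unspecified real; the
  value is meaningful on \<open>dom\<close> only.\<close>

definition rel :: "('a \<Rightarrow> real) \<Rightarrow> real" where
  "rel v = Inf {c. approx v c}"

lemma B_sq: "h \<in> B \<Longrightarrow> h \<in> square_integrable M"
  using B_square_integrable by auto

lemma approx_sq: "approx v c \<Longrightarrow> v \<in> square_integrable M"
  by (simp add: approx_def)

lemma approxD:
  assumes "approx v c" "0 < r"
  obtains h where "h \<in> B" "L2_dist M h v < r" "q h < c + r"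
  using assms that unfolding approx_def by blast

text \<open>The constant \<open>C\<close> lets later proofs lose a fixed factor.\<close>

lemma approxI:
  assumes v: "v \<in> square_integrable M" and C: "0 < C"
    and ex: "\<And>r. 0 < r \<Longrightarrow> \<exists>h\<in>B. L2_dist M h v \<le> C * r \<and> q h \<le> c + C * r"
  shows "approx v c"
  unfolding approx_def
proof (intro conjI allI impI v)
  fix r :: real assume r: "0 < r"
  obtain h where "h \<in> B" "L2_dist M h v \<le> C * (r / (2 * C))" "q h \<le> c + C * (r / (2 * C))"
    using ex[of "r / (2 * C)"] r C by auto
  moreover have "C * (r / (2 * C)) < r" using r C by simp
  ultimately show "\<exists>h\<in>B. L2_dist M h v < r \<and> q h < c + r"
    by (intro bexI[of _ h]) auto
qed

lemma approx_nonneg: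
  assumes "approx v c" shows "0 \<le> c"
proof (rule ccontr)
  assume "\<not> 0 \<le> c"
  then obtain h where "h \<in> B" "q h < c + (- c)" using approxD[OF assms, of "- c"] by auto
  then show False using Q_nonneg[of h] by simp
qed

lemma approx_mono: "approx v c \<Longrightarrow> c \<le> d \<Longrightarrow> approx v d"
  unfolding approx_def by (meson add_right_mono less_le_trans)

lemma rel_le: "approx v c \<Longrightarrow> rel v \<le> c"
  unfolding rel_def by (rule cInf_lower) (auto intro: bdd_belowI[of _ 0] approx_nonneg)

lemma domI: "approx v c \<Longrightarrow> v \<in> dom"
  by (auto simp: dom_def)

text \<open>The infimum is attained, because the slack \<open>r\<close> in \<open>approx\<close>
  absorbs the gap between \<open>c\<close> and the infimum.\<close>

lemma approx_rel:
  assumes "v \<in> dom" shows "approx v (rel v)"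
proof -
  have ne: "{c. approx v c} \<noteq> {}" using assms by (auto simp: dom_def)
  show ?thesis
  proof (rule approxI[of _ 2])
    show "v \<in> square_integrable M" using assms approx_sq by (auto simp: dom_def)
    fix r :: real assume r: "0 < r"
    have "Inf {c. approx v c} < rel v + r" using r by (simp add: rel_def)
    then obtain c where c: "approx v c" "c < rel v + r" using cInf_lessD[OF ne] by auto
    obtain h where "h \<in> B" "L2_dist M h v < r" "q h < c + r" using approxD[OF c(1) r] .
    then show "\<exists>h\<in>B. L2_dist M h v \<le> 2 * r \<and> q h \<le> rel v + 2 * r"
      using c(2) r by (intro bexI[of _ h]) auto
  qed simp
qed

lemma dom_sq: "v \<in> dom \<Longrightarrow> v \<in> square_integrable M"
  using approx_rel approx_sq by blast

lemma rel_nonneg: "v \<in> dom \<Longrightarrow> 0 \<le> rel v"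
  using approx_rel approx_nonneg by blast

lemma not_approxD:
  assumes "\<not> approx v a" "v \<in> square_integrable M"
  obtains r where "0 < r" "\<And>h. h \<in> B \<Longrightarrow> L2_dist M h v < r \<Longrightarrow> a + r \<le> q h"
  using assms that unfolding approx_def by (meson not_less)

text \<open>Failure of \<open>approx v a\<close> amounts to a lower bound for \<open>q\<close> on a
  small \<open>L^2\<close> ball around \<open>v\<close>.\<close>

lemma less_relD:
  assumes "a < rel v" "v \<in> square_integrable M"
  obtains r where "0 < r" "\<And>h. h \<in> B \<Longrightarrow> L2_dist M h v < r \<Longrightarrow> a + r \<le> q h"
proof -
  have "\<not> approx v a" using rel_le[of v a] assms(1) by auto
  from not_approxD[OF this assms(2)] show thesis using that by blast
qed

lemma approx_AE_cong:
  assumes v: "approx v c" and w: "w \<in> borel_measurable M" and eq: "AE x in M. v x = w x"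
  shows "approx w c"
proof -
  note [measurable] = square_integrableD(1)[OF B_sq] square_integrableD(1)[OF approx_sq[OF v]] w
  have "L2_dist M h v = L2_dist M h w" if "h \<in> B" for h
    using eq that by (intro L2_norm_AE_cong) auto
  then show ?thesis
    using v square_integrable_AE_cong[OF approx_sq[OF v] w eq] unfolding approx_def by auto
qed

lemma rel_AE_cong:
  assumes "v \<in> borel_measurable M" "w \<in> borel_measurable M" "AE x in M. v x = w x"
  shows "rel v = rel w"
proof -
  have "AE x in M. w x = v x" using assms(3) by auto
  then have "approx v c \<longleftrightarrow> approx w c" for c using approx_AE_cong assms by blast
  then show ?thesis by (simp add: rel_def)
qed

lemma approx_in_B: "h \<in> B \<Longrightarrow> approx h (q h)"
  unfolding approx_def using B_sq by (auto intro!: bexI[of _ h] simp: L2_norm_def)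

lemma approx_cmult:
  assumes v: "approx v c" shows "approx (\<lambda>x. t * v x) (t\<^sup>2 * c)"
proof (rule approxI[of _ "1 + \<bar>t\<bar> + t\<^sup>2"])
  show "(\<lambda>x. t * v x) \<in> square_integrable M" by (rule square_integrable_cmult[OF approx_sq[OF v]])
  show "0 < 1 + \<bar>t\<bar> + t\<^sup>2" by (simp add: add_pos_nonneg)
  fix r :: real assume r: "0 < r"
  obtain h where h: "h \<in> B" "L2_dist M h v < r" "q h < c + r" using approxD[OF v r] .
  have "L2_norm M (\<lambda>x. t * h x - t * v x) = \<bar>t\<bar> * L2_dist M h v"
    using L2_norm_cmult[of M t "\<lambda>x. h x - v x"] by (simp add: algebra_simps)
  also have "\<dots> \<le> \<bar>t\<bar> * r" using h by (intro mult_left_mono) auto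
  also have "\<dots> \<le> (1 + \<bar>t\<bar> + t\<^sup>2) * r" using r by (intro mult_right_mono) auto
  finally have 1: "L2_norm M (\<lambda>x. t * h x - t * v x) \<le> (1 + \<bar>t\<bar> + t\<^sup>2) * r" .
  have "q (\<lambda>x. t * h x) \<le> t\<^sup>2 * (c + r)" using h by (simp add: Q_cmult mult_left_mono)
  also have "\<dots> = t\<^sup>2 * c + t\<^sup>2 * r" by (simp add: algebra_simps)
  also have "\<dots> \<le> t\<^sup>2 * c + (1 + \<bar>t\<bar> + t\<^sup>2) * r"
    using r by (intro add_left_mono mult_right_mono) auto
  finally show "\<exists>h\<in>B. L2_norm M (\<lambda>x. h x - t * v x) \<le> (1 + \<bar>t\<bar> + t\<^sup>2) * r \<and>
      q h \<le> t\<^sup>2 * c + (1 + \<bar>t\<bar> + t\<^sup>2) * r"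
    using 1 h by (intro bexI[of _ "\<lambda>x. t * h x"] V_cmult) auto
qed

lemma dom_cmult: "v \<in> dom \<Longrightarrow> (\<lambda>x. t * v x) \<in> dom"
  using approx_cmult approx_rel domI by blast

lemma rel_zero: "rel (\<lambda>x. 0) = 0"
  using rel_le[OF approx_in_B[OF zero_in_B]] rel_nonneg[OF domI[OF approx_in_B[OF zero_in_B]]]
    Q_cmult[OF zero_in_B, of 0] by simp

lemma rel_cmult:
  assumes v: "v \<in> dom" shows "rel (\<lambda>x. t * v x) = t\<^sup>2 * rel v"
proof (cases "t = 0")
  case False
  have "rel (\<lambda>x. 1/t * (t * v x)) \<le> (1/t)\<^sup>2 * rel (\<lambda>x. t * v x)"
    by (intro rel_le approx_cmult approx_rel dom_cmult v)
  then have "t\<^sup>2 * rel v \<le> rel (\<lambda>x. t * v x)"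
    using False by (simp add: power_divide field_simps)
  moreover have "rel (\<lambda>x. t * v x) \<le> t\<^sup>2 * rel v" by (intro rel_le approx_cmult approx_rel v)
  ultimately show ?thesis by simp
qed (simp add: rel_zero)

lemma approx_add_diff:
  assumes u: "approx u c" and v: "approx v d" and r: "0 < r"
  obtains h k where "h \<in> B" "k \<in> B" "q (\<lambda>x. h x + k x) + q (\<lambda>x. h x - k x) \<le> 2 * c + 2 * d + 4 * r"
    "L2_norm M (\<lambda>x. (h x + k x) - (u x + v x)) \<le> 2 * r"
    "L2_norm M (\<lambda>x. (h x - k x) - (u x - v x)) \<le> 2 * r"
proof -
  obtain h where h: "h \<in> B" "L2_dist M h u < r" "q h < c + r" using approxD[OF u r] .
  obtain k where k: "k \<in> B" "L2_dist M k v < r" "q k < d + r" using approxD[OF v r] .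
  have hu: "(\<lambda>x. h x - u x) \<in> square_integrable M" and kv: "(\<lambda>x. k x - v x) \<in> square_integrable M"
    using h k u v by (auto intro: square_integrable_diff B_sq approx_sq)
  have eq: "(\<lambda>x. (h x - u x) + (k x - v x)) = (\<lambda>x. (h x + k x) - (u x + v x))"
    "(\<lambda>x. (h x - u x) - (k x - v x)) = (\<lambda>x. (h x - k x) - (u x - v x))" by (auto simp: fun_eq_iff)
  show thesis
  proof (rule that[OF h(1) k(1)])
    show "q (\<lambda>x. h x + k x) + q (\<lambda>x. h x - k x) \<le> 2 * c + 2 * d + 4 * r"
      using parallelogram[OF h(1) k(1)] h k by linarith
    show "L2_norm M (\<lambda>x. (h x + k x) - (u x + v x)) \<le> 2 * r"
      using L2_norm_triangle[OF hu kv] h k unfolding eq by linarith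
    show "L2_norm M (\<lambda>x. (h x - k x) - (u x - v x)) \<le> 2 * r"
      using L2_norm_triangle_sub[OF hu kv] h k unfolding eq by linarith
  qed
qed

text \<open>Dropping \<open>q (h - k)\<close> gives a crude bound, which suffices to make
  \<open>dom\<close> a vector space; the sharp inequality is
  \<open>rel_parallelogram_le\<close>.\<close>

lemma approx_add:
  assumes u: "approx u c" and v: "approx v d"
  shows "approx (\<lambda>x. u x + v x) (2 * c + 2 * d)"
proof (rule approxI[of _ 4])
  show "(\<lambda>x. u x + v x) \<in> square_integrable M" by (intro square_integrable_add approx_sq[OF u] approx_sq[OF v])
  fix r :: real assume r: "0 < r"
  obtain h k where hk: "h \<in> B" "k \<in> B" "q (\<lambda>x. h x + k x) + q (\<lambda>x. h x - k x) \<le> 2 * c + 2 * d + 4 * r"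
    "L2_norm M (\<lambda>x. (h x + k x) - (u x + v x)) \<le> 2 * r"
    "L2_norm M (\<lambda>x. (h x - k x) - (u x - v x)) \<le> 2 * r"
    using approx_add_diff[OF u v r] .
  then show "\<exists>h\<in>B. L2_norm M (\<lambda>x. h x - (u x + v x)) \<le> 4 * r \<and> q h \<le> 2 * c + 2 * d + 4 * r"
    using Q_nonneg[OF V_diff[OF hk(1,2)]] r by (intro bexI[of _ "\<lambda>x. h x + k x"] V_add) auto
qed simp

lemma dom_add: "u \<in> dom \<Longrightarrow> v \<in> dom \<Longrightarrow> (\<lambda>x. u x + v x) \<in> dom"
  using approx_add approx_rel domI by blast

lemma dom_diff: "u \<in> dom \<Longrightarrow> v \<in> dom \<Longrightarrow> (\<lambda>x. u x - v x) \<in> dom"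
  using dom_add[OF _ dom_cmult, of u v "-1"] by simp

text \<open>Near-optimal \<open>h\<close> for \<open>u\<close> and \<open>k\<close> for
  \<open>v\<close> obey the parallelogram law, while \<open>h + k\<close> and \<open>h - k\<close>
  are close to \<open>u + v\<close> and \<open>u - v\<close>, where lower semicontinuity bounds
  \<open>q\<close> from below.\<close>

lemma rel_parallelogram_le:
  assumes u: "u \<in> dom" and v: "v \<in> dom"
  shows "rel (\<lambda>x. u x + v x) + rel (\<lambda>x. u x - v x) \<le> 2 * rel u + 2 * rel v"
proof (rule field_le_epsilon)
  fix e :: real assume e: "0 < e"
  have lt: "rel (\<lambda>x. u x + v x) - e/4 < rel (\<lambda>x. u x + v x)"
    "rel (\<lambda>x. u x - v x) - e/4 < rel (\<lambda>x. u x - v x)" using e by auto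
  obtain r where r: "0 < r"
    "\<And>h. h \<in> B \<Longrightarrow> L2_norm M (\<lambda>x. h x - (u x + v x)) < r \<Longrightarrow> rel (\<lambda>x. u x + v x) - e/4 + r \<le> q h"
    by (rule less_relD[OF lt(1) dom_sq[OF dom_add[OF u v]]]) blast
  obtain s where s: "0 < s"
    "\<And>h. h \<in> B \<Longrightarrow> L2_norm M (\<lambda>x. h x - (u x - v x)) < s \<Longrightarrow> rel (\<lambda>x. u x - v x) - e/4 + s \<le> q h"
    by (rule less_relD[OF lt(2) dom_sq[OF dom_diff[OF u v]]]) blast
  \<comment> \<open>\<open>2 * t\<close> has to be below both radii, and the error
    \<open>4 * t\<close> at most \<open>e/2\<close>; the rest of \<open>e\<close> pays for the two
    losses of \<open>e/4\<close>.\<close>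
  define t where "t = min (e/8) (min (r/3) (s/3))"
  have t: "0 < t" "4 * t \<le> e/2" "2 * t < r" "2 * t < s"
    using e r(1) s(1) by (auto simp: t_def min_def)
  obtain h k where hk: "h \<in> B" "k \<in> B"
    "q (\<lambda>x. h x + k x) + q (\<lambda>x. h x - k x) \<le> 2 * rel u + 2 * rel v + 4 * t"
    "L2_norm M (\<lambda>x. (h x + k x) - (u x + v x)) \<le> 2 * t"
    "L2_norm M (\<lambda>x. (h x - k x) - (u x - v x)) \<le> 2 * t"
    using approx_add_diff[OF approx_rel[OF u] approx_rel[OF v] t(1)] .
  have "rel (\<lambda>x. u x + v x) - e/4 + r \<le> q (\<lambda>x. h x + k x)"
    using hk t by (intro r(2) V_add) auto
  moreover have "rel (\<lambda>x. u x - v x) - e/4 + s \<le> q (\<lambda>x. h x - k x)"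
    using hk t by (intro s(2) V_diff) auto
  ultimately show "rel (\<lambda>x. u x + v x) + rel (\<lambda>x. u x - v x) \<le> 2 * rel u + 2 * rel v + e"
    using hk(3) t(2) r(1) s(1) by linarith
qed

text \<open>The reverse inequality in the parallelogram law is the proved one for
  \<open>f + g\<close> and \<open>f - g\<close>, whose sum and difference are \<open>2 f\<close> and
  \<open>2 g\<close>.\<close>

sublocale relaxed: parallelogram_form dom rel
proof
  fix f g assume f: "f \<in> dom" and g: "g \<in> dom"
  have "rel (\<lambda>x. (f x + g x) + (f x - g x)) + rel (\<lambda>x. (f x + g x) - (f x - g x))
      \<le> 2 * rel (\<lambda>x. f x + g x) + 2 * rel (\<lambda>x. f x - g x)"
    by (intro rel_parallelogram_le dom_add dom_diff f g)
  then have "rel (\<lambda>x. 2 * f x) + rel (\<lambda>x. 2 * g x) \<le> 2 * rel (\<lambda>x. f x + g x) + 2 * rel (\<lambda>x. f x - g x)"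
    by (simp add: algebra_simps)
  then have "2 * rel f + 2 * rel g \<le> rel (\<lambda>x. f x + g x) + rel (\<lambda>x. f x - g x)"
    by (simp add: rel_cmult f g)
  with rel_parallelogram_le[OF f g]
  show "rel (\<lambda>x. f x + g x) + rel (\<lambda>x. f x - g x) = 2 * rel f + 2 * rel g" by simp
qed (auto intro: dom_add dom_cmult rel_nonneg rel_cmult)

lemma approx_lsc:
  assumes v: "v \<in> square_integrable M"
    and near: "\<And>r. 0 < r \<Longrightarrow> \<exists>u. approx u c \<and> L2_dist M u v < r"
  shows "approx v c"
proof (rule approxI[of _ 2])
  fix r :: real assume r: "0 < r"
  obtain u where u: "approx u c" "L2_dist M u v < r" using near[OF r] by auto
  obtain h where h: "h \<in> B" "L2_dist M h u < r" "q h < c + r" using approxD[OF u(1) r] .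
  then show "\<exists>h\<in>B. L2_dist M h v \<le> 2 * r \<and> q h \<le> c + 2 * r"
    using L2_norm_triangle_diff[OF B_sq[OF h(1)] approx_sq[OF u(1)] v] u r
    by (intro bexI[of _ h]) auto
qed (use v in auto)

section \<open>The form norm: completeness and density of \<open>B\<close>\<close>

lemma form_norm_power2:
  assumes "f \<in> dom"
  shows "(form_norm M relaxed.polar f)\<^sup>2 = rel f + (L2_norm M f)\<^sup>2"
  using relaxed.polar_self[OF assms] rel_nonneg[OF assms] by (simp add: form_norm_def)

lemma form_norm_nonneg: "f \<in> dom \<Longrightarrow> 0 \<le> form_norm M relaxed.polar f"
  using relaxed.polar_self[of f] rel_nonneg[of f] by (simp add: form_norm_def)

lemma form_norm_less:
  assumes "f \<in> dom" "form_norm M relaxed.polar f < e"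
  shows "L2_norm M f < e" "rel f < e\<^sup>2"
proof -
  have e: "0 < e" using form_norm_nonneg[OF assms(1)] assms(2) by simp
  have "(form_norm M relaxed.polar f)\<^sup>2 < e\<^sup>2"
    using assms(2) form_norm_nonneg[OF assms(1)] by (intro power_strict_mono) auto
  then have *: "rel f + (L2_norm M f)\<^sup>2 < e\<^sup>2" using form_norm_power2[OF assms(1)] by simp
  then show "rel f < e\<^sup>2" using zero_le_power2[of "L2_norm M f"] by linarith
  have "(L2_norm M f)\<^sup>2 < e\<^sup>2" using * rel_nonneg[OF assms(1)] by linarith
  then show "L2_norm M f < e" using e by (meson less_imp_le power2_less_imp_less)
qed

lemma form_norm_lessI:
  assumes "f \<in> dom" "0 < e" "rel f \<le> e\<^sup>2 / 4" "L2_norm M f \<le> e / 2"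
  shows "form_norm M relaxed.polar f < e"
proof -
  have "(L2_norm M f)\<^sup>2 \<le> (e / 2)\<^sup>2" using assms L2_norm_nonneg by (intro power_mono) auto
  then have "(form_norm M relaxed.polar f)\<^sup>2 < e\<^sup>2"
    unfolding form_norm_power2[OF assms(1)] using assms(2,3) by (simp add: power_divide)
      (smt (verit) zero_less_power)
  then show ?thesis using assms(2) by (meson less_imp_le power2_less_imp_less)
qed

text \<open>The \<open>L^2\<close> limit \<open>v\<close> exists by Riesz--Fischer. For fixed
  \<open>n\<close>, \<open>f n - f m\<close> tends to \<open>f n - v\<close> as \<open>m\<close>
  grows, so lower semicontinuity carries the Cauchy bound over to \<open>f n - v\<close>.\<close>

lemma form_complete_relaxed: "form_complete M relaxed.polar dom"
  unfolding form_complete_def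
proof (intro allI impI, elim conjE)
  fix f :: "nat \<Rightarrow> 'a \<Rightarrow> real"
  assume range: "range f \<subseteq> dom"
    and Cauchy: "\<forall>\<epsilon>>0. \<exists>N. \<forall>m\<ge>N. \<forall>n\<ge>N. form_norm M relaxed.polar (\<lambda>x. f m x - f n x) < \<epsilon>"
  have f: "f n \<in> dom" for n using range by auto
  obtain v where v: "v \<in> square_integrable M" and lim: "(\<lambda>n. L2_dist M (f n) v) \<longlonglongrightarrow> 0"
  proof (rule L2_complete[of f])
    show "f n \<in> square_integrable M" for n by (rule dom_sq[OF f])
    show "\<exists>N. \<forall>m\<ge>N. \<forall>n\<ge>N. L2_dist M (f m) (f n) < e" if "0 < e" for e
      using Cauchy that form_norm_less(1)[OF dom_diff[OF f f]] by metis
  qed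
  have approx_diff: "approx (\<lambda>x. f n x - v x) (e\<^sup>2)"
    if N: "\<And>m. N \<le> m \<Longrightarrow> form_norm M relaxed.polar (\<lambda>x. f n x - f m x) < e" for n N e
  proof (rule approx_lsc)
    show "(\<lambda>x. f n x - v x) \<in> square_integrable M" by (intro square_integrable_diff dom_sq f v)
    fix r :: real assume "0 < r"
    then obtain N' where "\<forall>m\<ge>N'. L2_dist M (f m) v < r"
      using LIMSEQ_D[OF lim, of r] by (auto simp: L2_norm_nonneg)
    then have "L2_norm M (\<lambda>x. f (max N N') x - v x) < r" by simp
    moreover have "(\<lambda>x. f n x - f (max N N') x - (f n x - v x)) = (\<lambda>x. v x - f (max N N') x)"
      by (auto simp: fun_eq_iff)
    ultimately have "L2_norm M (\<lambda>x. f n x - f (max N N') x - (f n x - v x)) < r"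
      by (simp add: L2_norm_diff_commute)
    moreover have "approx (\<lambda>x. f n x - f (max N N') x) (e\<^sup>2)"
      by (rule approx_mono[OF approx_rel[OF dom_diff[OF f f]] less_imp_le[OF form_norm_less(2)]])
        (auto intro!: dom_diff f N)
    ultimately show "\<exists>u. approx u (e\<^sup>2) \<and> L2_norm M (\<lambda>x. u x - (f n x - v x)) < r" by blast
  qed
  have "\<exists>N. \<forall>n\<ge>N. (\<lambda>x. f n x - v x) \<in> dom \<and> form_norm M relaxed.polar (\<lambda>x. f n x - v x) < e"
    if e: "0 < e" for e
  proof -
    obtain N where N: "\<And>m n. N \<le> m \<Longrightarrow> N \<le> n \<Longrightarrow> form_norm M relaxed.polar (\<lambda>x. f m x - f n x) < e/2"
      using Cauchy e by (metis half_gt_zero)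
    obtain N' where N': "\<forall>m\<ge>N'. L2_dist M (f m) v < e/2"
      using LIMSEQ_D[OF lim, of "e/2"] e by (auto simp: L2_norm_nonneg)
    have "(\<lambda>x. f n x - v x) \<in> dom \<and> form_norm M relaxed.polar (\<lambda>x. f n x - v x) < e"
      if "max N N' \<le> n" for n
    proof -
      have a: "approx (\<lambda>x. f n x - v x) ((e/2)\<^sup>2)" using N that by (intro approx_diff[of N]) auto
      then have "rel (\<lambda>x. f n x - v x) \<le> e\<^sup>2 / 4" using rel_le by (fastforce simp: power_divide)
      moreover have "L2_dist M (f n) v \<le> e / 2" using N' that by (simp add: less_imp_le)
      ultimately show ?thesis using form_norm_lessI[OF domI[OF a] e] domI[OF a] by simp
    qed
    then show ?thesis by blast
  qed
  note conv = this
  have "v \<in> dom"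
  proof -
    obtain n where "(\<lambda>x. f n x - v x) \<in> dom" using conv[of 1] by auto
    from dom_diff[OF f[of n] this] show ?thesis by simp
  qed
  moreover have "(\<lambda>n. form_norm M relaxed.polar (\<lambda>x. f n x - v x)) \<longlonglongrightarrow> 0"
  proof (rule LIMSEQ_I)
    fix e :: real assume "0 < e"
    then obtain N where N: "\<forall>n\<ge>N. (\<lambda>x. f n x - v x) \<in> dom \<and> form_norm M relaxed.polar (\<lambda>x. f n x - v x) < e"
      using conv by blast
    then show "\<exists>N. \<forall>n\<ge>N. norm (form_norm M relaxed.polar (\<lambda>x. f n x - v x) - 0) < e"
      using form_norm_nonneg by (intro exI[of _ N]) auto
  qed
  ultimately show "\<exists>g\<in>dom. (\<lambda>n. form_norm M relaxed.polar (\<lambda>x. f n x - g x)) \<longlonglongrightarrow> 0" by blast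
qed

text \<open>Two near-minimisers of \<open>q\<close> in a small ball around \<open>v\<close> are \<open>q\<close>-close by the parallelogram law,
  since their midpoint lies in the same ball.\<close>

lemma B_dense_in_dom:
  assumes v: "v \<in> dom" and e: "0 < e"
  shows "\<exists>h\<in>B. form_norm M relaxed.polar (\<lambda>x. v x - h x) < e"
proof -
  \<comment> \<open>With this choice \<open>8 * d\<close> is the bound \<open>e^2 / 4\<close> that
    \<open>form_norm_lessI\<close> asks for.\<close>
  define d where "d = e\<^sup>2 / 32"
  have d: "0 < d" using e by (simp add: d_def)
  have lt: "rel v - d < rel v" using d by simp
  obtain r0 where r0: "0 < r0"
    "\<And>h. h \<in> B \<Longrightarrow> L2_dist M h v < r0 \<Longrightarrow> rel v - d + r0 \<le> q h"
    by (rule less_relD[OF lt dom_sq[OF v]]) blast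
  define r where "r = min r0 (min d (e/2))"
  have r: "0 < r" "r \<le> r0" "r \<le> d" "r \<le> e/2" using r0 d e by (auto simp: r_def)
  obtain h where h: "h \<in> B" "L2_dist M h v < r" "q h < rel v + r"
    using approxD[OF approx_rel[OF v] r(1)] .
  \<comment> \<open>\<open>h\<close> stays fixed while \<open>k\<close> runs through better and
    better approximants of \<open>v\<close>, so that \<open>h - k\<close> approximates
    \<open>h - v\<close>.\<close>
  have "approx (\<lambda>x. h x - v x) (8 * d)"
  proof (rule approxI[of _ 1])
    show "(\<lambda>x. h x - v x) \<in> square_integrable M" by (intro square_integrable_diff B_sq dom_sq v h)
    fix s :: real assume s: "0 < s"
    obtain k where k: "k \<in> B" "L2_dist M k v < min r s" "q k < rel v + min r s"
      using approxD[OF approx_rel[OF v], of "min r s"] r s by (metis min_less_iff_conj)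
    define m where "m x = 1/2 * (h x + k x)" for x
    have mB: "m \<in> B" unfolding m_def by (intro V_cmult V_add h k)
    have "L2_dist M m v = L2_norm M (\<lambda>x. 1/2 * ((h x - v x) + (k x - v x)))"
      unfolding m_def by (rule arg_cong[of _ _ "L2_norm M"]) (auto simp: field_simps)
    also have "\<dots> = 1/2 * L2_norm M (\<lambda>x. (h x - v x) + (k x - v x))" by (subst L2_norm_cmult) simp
    also have "\<dots> \<le> 1/2 * (L2_dist M h v + L2_dist M k v)"
      by (intro mult_left_mono L2_norm_triangle square_integrable_diff B_sq dom_sq v h k) auto
    also have "\<dots> < r0" using h k r by auto
    finally have "rel v - d \<le> q m" using r0 mB by fastforce
    \<comment> \<open>The lower bound at the midpoint costs \<open>4 * d\<close>; the excess of
      \<open>q h\<close> and \<open>q k\<close> over \<open>rel v\<close>, at most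
      \<open>r <= d\<close> each, costs another \<open>4 * d\<close>.\<close>
    then have "4 * (rel v - d) \<le> q (\<lambda>x. h x + k x)"
      unfolding m_def by (subst (asm) Q_cmult) (auto simp: power2_eq_square intro!: V_add h k)
    then have "q (\<lambda>x. h x - k x) \<le> 8 * d"
      using parallelogram[OF h(1) k(1)] h k r by auto
    moreover have "(\<lambda>x. h x - k x - (h x - v x)) = (\<lambda>x. v x - k x)" by (auto simp: fun_eq_iff)
    ultimately show "\<exists>g\<in>B. L2_norm M (\<lambda>x. g x - (h x - v x)) \<le> 1 * s \<and> q g \<le> 8 * d + 1 * s"
      using k s by (intro bexI[of _ "\<lambda>x. h x - k x"] V_diff h) (auto simp: L2_norm_diff_commute[of M v k])
  qed simp
  then have "approx (\<lambda>x. -1 * (h x - v x)) ((-1)\<^sup>2 * (8 * d))" by (rule approx_cmult)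
  then have a: "approx (\<lambda>x. v x - h x) (8 * d)" by simp
  have "form_norm M relaxed.polar (\<lambda>x. v x - h x) < e"
    using rel_le[OF a] h r by (intro form_norm_lessI domI[OF a] e) (auto simp: d_def L2_norm_diff_commute[of M v h])
  with h show ?thesis by blast
qed

text \<open>If \<open>rel u\<close> were smaller, functions arbitrarily close to \<open>u\<close>
  would have \<open>q\<close> at most the midpoint of \<open>rel u\<close> and \<open>e\<close>,
  against the assumed distance.\<close>

lemma rel_eqI:
  assumes a: "approx u e"
    and lsc: "\<And>c. c < e \<Longrightarrow> \<exists>r>0. \<forall>g\<in>B. q g \<le> c \<longrightarrow> r \<le> L2_dist M g u"
  shows "rel u = e"
proof (rule antisym[OF rel_le[OF a]])
  show "e \<le> rel u"
  proof (rule ccontr)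
    assume "\<not> e \<le> rel u"
    then have lt: "(rel u + e) / 2 < e" "0 < (e - rel u) / 2" by auto
    obtain r where r: "0 < r" "\<And>g. g \<in> B \<Longrightarrow> q g \<le> (rel u + e) / 2 \<Longrightarrow> r \<le> L2_dist M g u"
      using lsc[OF lt(1)] by auto
    obtain h where h: "h \<in> B" "L2_dist M h u < min r ((e - rel u) / 2)"
      "q h < rel u + min r ((e - rel u) / 2)"
      using approxD[OF approx_rel[OF domI[OF a]], of "min r ((e - rel u) / 2)"] r lt by (metis min_less_iff_conj)
    have "q h \<le> (rel u + e) / 2"
      using h(3) min.cobounded2[of r "(e - rel u) / 2"] by (simp add: field_simps)
    from r(2)[OF h(1) this] h(2) show False by simp
  qed
qed

text \<open>The unit contraction does not increase \<open>L^2\<close> distances, so clamped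
  approximants approximate the clamped function, and the contraction property passes from
  \<open>B\<close> to the relaxation.\<close>

lemma dirichlet_form_relaxed:
  assumes dense: "L2_dense M B"
    and clamp: "\<And>h. h \<in> B \<Longrightarrow> (\<lambda>x. max (min (h x) 1) 0) \<in> B \<and> q (\<lambda>x. max (min (h x) 1) 0) \<le> q h"
  shows "dirichlet_form M relaxed.polar dom"
proof -
  have B_dom: "B \<subseteq> dom" using approx_in_B domI by auto
  have clamp_approx: "approx (\<lambda>x. max (min (v x) 1) 0) c" if v: "approx v c" for v c
  proof (rule approxI[of _ 1])
    note [measurable] = square_integrableD(1)[OF approx_sq[OF v]]
    show "(\<lambda>x. max (min (v x) 1) 0) \<in> square_integrable M"
      by (rule square_integrable_bounded[of _ 1]) auto
    fix r :: real assume r: "0 < r"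
    obtain h where h: "h \<in> B" "L2_dist M h v < r" "q h < c + r" using approxD[OF v r] .
    note [measurable] = square_integrableD(1)[OF B_sq[OF h(1)]]
    have "L2_norm M (\<lambda>x. max (min (h x) 1) 0 - max (min (v x) 1) 0) \<le> L2_dist M h v"
    proof (rule L2_norm_mono)
      show "(\<lambda>x. h x - v x) \<in> square_integrable M"
        by (intro square_integrable_diff B_sq h approx_sq[OF v])
      show "\<bar>max (min (h x) 1) 0 - max (min (v x) 1) 0\<bar> \<le> \<bar>h x - v x\<bar>" for x
        by (simp add: max_def min_def)
    qed measurable
    then show "\<exists>k\<in>B. L2_norm M (\<lambda>x. k x - max (min (v x) 1) 0) \<le> 1 * r \<and> q k \<le> c + 1 * r"
      using h clamp[OF h(1)] by (intro bexI[of _ "\<lambda>x. max (min (h x) 1) 0"]) auto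
  qed simp
  have "sigma_finite_measure M" by (rule sigma_finite_measure_axioms)
  moreover have "L2_subspace M dom"
    unfolding L2_subspace_def using dom_sq domI[OF approx_in_B[OF zero_in_B]]
    by (auto intro: dom_add dom_cmult domI[OF approx_AE_cong[OF approx_rel]])
  moreover have "L2_dense M dom"
    using dense B_dom unfolding L2_dense_def by blast
  moreover have "L2_bilinear_form M relaxed.polar dom"
    unfolding L2_bilinear_form_def
  proof (intro conjI ballI impI allI)
    fix f f' g assume f: "f \<in> dom" "f' \<in> dom" and g: "g \<in> dom" and eq: "AE x in M. f x = f' x"
    note [measurable] = f[THEN dom_sq, THEN square_integrableD(1)] g[THEN dom_sq, THEN square_integrableD(1)]
    have "rel (\<lambda>x. f x + g x) = rel (\<lambda>x. f' x + g x)" "rel (\<lambda>x. f x - g x) = rel (\<lambda>x. f' x - g x)"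
      using eq by (auto intro!: rel_AE_cong)
    then show "relaxed.polar f g = relaxed.polar f' g" by (simp add: relaxed.polar_def)
  qed (auto simp: relaxed.polar_self relaxed.polar_add relaxed.polar_cmult rel_nonneg relaxed.polar_commute)
  moreover have "(\<lambda>x. max (min (f x) 1) 0) \<in> dom \<and>
      relaxed.polar (\<lambda>x. max (min (f x) 1) 0) (\<lambda>x. max (min (f x) 1) 0) \<le> relaxed.polar f f" if "f \<in> dom" for f
    using clamp_approx[OF approx_rel[OF that]] that by (auto simp: relaxed.polar_self domI rel_le)
  ultimately show ?thesis
    unfolding dirichlet_form_def using form_complete_relaxed by blast
qed

end

section \<open>The spectrum of a countably generated algebra\<close>

lemma function_algebraD:
  assumes "function_algebra A"
  shows "(\<lambda>x. 0) \<in> A" "\<And>f g. f \<in> A \<Longrightarrow> g \<in> A \<Longrightarrow> (\<lambda>x. f x + g x) \<in> A"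
    "\<And>c f. f \<in> A \<Longrightarrow> (\<lambda>x. c * f x) \<in> A" "\<And>f g. f \<in> A \<Longrightarrow> g \<in> A \<Longrightarrow> (\<lambda>x. f x * g x) \<in> A"
  using assms by (auto simp: function_algebra_def)

lemma function_algebra_diff:
  "function_algebra A \<Longrightarrow> f \<in> A \<Longrightarrow> g \<in> A \<Longrightarrow> (\<lambda>x. f x - g x) \<in> A"
  using function_algebraD(2)[of A f "\<lambda>x. -1 * g x"] function_algebraD(3)[of A g "-1"] by simp

lemma uniform_limit_inverse_Suc:
  fixes f :: "'a \<Rightarrow> real"
  assumes "\<And>n x. \<bar>f x - h n x\<bar> < 1 / real (Suc n)"
  shows "uniform_limit UNIV h f sequentially"
  unfolding uniform_limit_iff
proof (intro allI impI)
  fix r :: real assume "0 < r"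
  then obtain N where N: "1 / real (Suc N) < r" by (rule nat_approx_posE)
  show "\<forall>\<^sub>F n in sequentially. \<forall>x\<in>UNIV. dist (h n x) (f x) < r"
  proof (intro eventually_sequentiallyI[of N] ballI)
    fix n x assume "N \<le> n"
    then have "1 / real (Suc n) \<le> 1 / real (Suc N)" by (simp add: frac_le)
    then show "dist (h n x) (f x) < r"
      using assms[of x n] N by (simp add: dist_real_def abs_minus_commute)
  qed
qed

lemma uniformly_closed_approx:
  assumes A: "uniformly_closed A" and ex: "\<And>e. 0 < e \<Longrightarrow> \<exists>h\<in>A. \<forall>x. \<bar>f x - h x\<bar> < e"
  shows "f \<in> A"
proof -
  have "\<exists>h\<in>A. \<forall>x. \<bar>f x - h x\<bar> < 1 / real (Suc n)" for n by (rule ex) simp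
  then obtain h where h: "\<And>n. h n \<in> A" "\<And>n x. \<bar>f x - h n x\<bar> < 1 / real (Suc n)" by metis
  have lim: "uniform_limit UNIV h f sequentially" by (rule uniform_limit_inverse_Suc) (rule h(2))
  have "uniformly_Cauchy_on UNIV h"
    by (rule uniformly_convergent_Cauchy) (use lim in \<open>auto simp: uniformly_convergent_on_def\<close>)
  moreover have "range h \<subseteq> A" using h by auto
  ultimately obtain l where "l \<in> A" "uniform_limit UNIV h l sequentially"
    using A unfolding uniformly_closed_def by blast
  moreover have "l x = f x" for x
    using LIMSEQ_unique tendsto_uniform_limitI[OF lim, of x]
      tendsto_uniform_limitI[OF \<open>uniform_limit UNIV h l sequentially\<close>, of x] by auto
  ultimately show ?thesis by (metis ext)
qed

locale generated_algebra =
  fixes A :: "('a \<Rightarrow> real) set" and g :: "nat \<Rightarrow> 'a \<Rightarrow> real"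
  assumes generates: "generates g A"
begin

definition emb :: "'a \<Rightarrow> nat \<Rightarrow> real" where
  "emb x = (\<lambda>n. g n x)"

text \<open>The origin of \<open>nat \<Rightarrow> real\<close> plays the role of the point at infinity, also if \<open>A\<close> is unital.\<close>

definition K :: "(nat \<Rightarrow> real) set" where
  "K = insert (\<lambda>_. 0) (closure (range emb))"

lemma algebra_A: "function_algebra A" and bounded_A: "\<And>f. f \<in> A \<Longrightarrow> bounded (range f)"
  and closed_A: "uniformly_closed A" and g_in_A: "g n \<in> A"
  using generates by (auto simp: generates_def bounded_function_algebra_def)

lemmas A_closed = function_algebraD[OF algebra_A] function_algebra_diff[OF algebra_A]

lemma emb_in_K: "emb x \<in> K"
  unfolding K_def using closure_subset[of "range emb"] by auto

lemma zero_in_K: "(\<lambda>_. 0) \<in> K"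
  by (simp add: K_def)

text \<open>Tychonoff: each generator is bounded, so the embedding takes values in a product of
  compact intervals.\<close>

lemma compact_K: "compact K"
proof -
  have "\<exists>b. \<forall>x. \<bar>g n x\<bar> \<le> b" for n
    using bounded_A[OF g_in_A[of n]] by (auto simp: bounded_iff)
  then obtain b where b: "\<And>n x. \<bar>g n x\<bar> \<le> b n" by metis
  let ?P = "PiE UNIV (\<lambda>n. {- b n..b n})"
  have "compactin (product_topology (\<lambda>_. euclideanreal) UNIV) ?P"
    by (simp add: compactin_PiE)
  then have P: "compact ?P" by (simp add: euclidean_product_topology)
  have "range emb \<subseteq> ?P" using b by (auto simp: emb_def abs_le_iff) (smt (verit))
  then have "closure (range emb) \<subseteq> ?P" by (rule closure_minimal[OF _ compact_imp_closed[OF P]])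
  then have "compact (closure (range emb))"
    using compact_Int_closed[OF P closed_closure, of "range emb"] by (simp add: Int_absorb1)
  then show ?thesis unfolding K_def by (rule compact_insert)
qed

lemma closed_K: "closed K"
  by (rule compact_imp_closed[OF compact_K])

text \<open>The embedded points are dense in \<open>K\<close> except perhaps for the origin, which
  may be isolated; hence the separate condition there.\<close>

lemma le_on_K:
  assumes h: "continuous_on K h" and "\<And>x. h (emb x) \<le> c" "h (\<lambda>_. 0) \<le> (c::real)" "y \<in> K"
  shows "h y \<le> c"
proof (cases "y = (\<lambda>_. 0)")
  case False
  then have "y \<in> closure (range emb)" using assms(4) by (simp add: K_def)
  moreover have "continuous_on (closure (range emb)) h"
    by (rule continuous_on_subset[OF h]) (auto simp: K_def)
  ultimately show ?thesis using assms(2) by (intro continuous_le_on_closure[of "range emb" h y c]) auto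
qed (use assms in simp)

lemma abs_le_on_K:
  assumes h: "continuous_on K h" and "\<And>x. \<bar>h (emb x)\<bar> \<le> c" "\<bar>h (\<lambda>_. 0)\<bar> \<le> (c::real)" "y \<in> K"
  shows "\<bar>h y\<bar> \<le> c"
  using le_on_K[of "\<lambda>y. \<bar>h y\<bar>" c y] assms by (auto intro: continuous_intros)

text \<open>Stone--Weierstrass needs constants, which \<open>D\<close> may lack. Hence the class
  \<open>P\<close> of functions that pull back into \<open>D\<close> after subtraction of their
  value at the origin. The coordinates belong to it, as they pull back to the generators, and they
  separate points.\<close>

lemma subalgebra_dense:
  assumes D: "function_algebra D" "range g \<subseteq> D"
    and f: "continuous_on K f" "f (\<lambda>_. 0) = 0" and e: "0 < e"
  obtains h where "continuous_on K h" "h (\<lambda>_. 0) = 0" "(\<lambda>x. h (emb x)) \<in> D"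
    "\<And>y. y \<in> K \<Longrightarrow> \<bar>f y - h y\<bar> < e"
proof -
  define P where "P h \<longleftrightarrow> continuous_on K h \<and> (\<lambda>x. h (emb x) - h (\<lambda>_. 0)) \<in> D" for h :: "(nat \<Rightarrow> real) \<Rightarrow> real"
  note D_closed = function_algebraD[OF D(1)]
  \<comment> \<open>Subtracting the approximant's value at the origin, which is below
    \<open>e/2\<close> because \<open>f\<close> vanishes there, doubles the error.\<close>
  have "\<exists>h. P h \<and> (\<forall>y\<in>K. \<bar>f y - h y\<bar> < e/2)"
  proof (rule Stone_Weierstrass_HOL[OF compact_K _ _ _ _ _ f(1)])
    show "P (\<lambda>x. c)" for c unfolding P_def using D_closed by simp
    show "continuous_on K h" if "P h" for h using that by (simp add: P_def)
    show "P (\<lambda>x. h x + k x)" if "P h \<and> P k" for h k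
    proof -
      have "(\<lambda>x. (h (emb x) - h (\<lambda>_. 0)) + (k (emb x) - k (\<lambda>_. 0))) \<in> D"
        using that by (intro D_closed) (auto simp: P_def)
      then show ?thesis using that by (auto simp: P_def algebra_simps intro: continuous_intros)
    qed
    show "P (\<lambda>x. h x * k x)" if "P h \<and> P k" for h k
    proof -
      let ?h = "\<lambda>x. h (emb x) - h (\<lambda>_. 0)" and ?k = "\<lambda>x. k (emb x) - k (\<lambda>_. 0)"
      have "(\<lambda>x. ?h x * ?k x + (h (\<lambda>_. 0) * ?k x + k (\<lambda>_. 0) * ?h x)) \<in> D"
        using that by (intro D_closed) (auto simp: P_def)
      then show ?thesis using that by (auto simp: P_def algebra_simps intro: continuous_intros)
    qed
    show "\<exists>h. P h \<and> h y \<noteq> h z" if "y \<in> K \<and> z \<in> K \<and> y \<noteq> z" for y z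
    proof -
      from that obtain n where n: "y n \<noteq> z n" by (auto simp: fun_eq_iff)
      have "P (\<lambda>y. y n)"
        unfolding P_def using D(2) continuous_on_subset[OF continuous_on_product_coordinates[of n]]
        by (auto simp: emb_def)
      with n show ?thesis by blast
    qed
    show "0 < e/2" using e by simp
  qed
  then obtain h where h: "P h" "\<And>y. y \<in> K \<Longrightarrow> \<bar>f y - h y\<bar> < e/2" by blast
  show thesis
  proof
    show "continuous_on K (\<lambda>y. h y - h (\<lambda>_. 0))" "(\<lambda>x. h (emb x) - h (\<lambda>_. 0)) \<in> D"
      using h(1) by (auto simp: P_def intro: continuous_intros)
    show "\<bar>f y - (h y - h (\<lambda>_. 0))\<bar> < e" if "y \<in> K" for y
      using h(2)[OF that] h(2)[OF zero_in_K] f(2) by (simp add: abs_if split: if_splits)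
  qed simp
qed

text \<open>From right to left, such functions are uniform limits of members of \<open>A\<close> by
  Stone--Weierstrass. From left to right, they form a uniformly closed algebra containing the
  generators, and \<open>A\<close> is the smallest one.\<close>

lemma A_iff: "f \<in> A \<longleftrightarrow> (\<exists>h. continuous_on K h \<and> h (\<lambda>_. 0) = 0 \<and> f = (\<lambda>x. h (emb x)))"
proof
  assume "\<exists>h. continuous_on K h \<and> h (\<lambda>_. 0) = 0 \<and> f = (\<lambda>x. h (emb x))"
  then obtain h where h: "continuous_on K h" "h (\<lambda>_. 0) = 0" "f = (\<lambda>x. h (emb x))" by blast
  show "f \<in> A"
  proof (rule uniformly_closed_approx[OF closed_A])
    fix e :: real assume "0 < e"
    then obtain k where "(\<lambda>x. k (emb x)) \<in> A" "\<And>y. y \<in> K \<Longrightarrow> \<bar>h y - k y\<bar> < e"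
      using subalgebra_dense[OF algebra_A _ h(1,2)] g_in_A by blast
    then show "\<exists>k\<in>A. \<forall>x. \<bar>f x - k x\<bar> < e" using h(3) emb_in_K by (intro bexI) auto
  qed
next
  define B :: "('a \<Rightarrow> real) set" where "B = {f. \<exists>h. continuous_on K h \<and> h (\<lambda>_. 0) = 0 \<and> f = (\<lambda>x. h (emb x))}"
  have "function_algebra B"
    unfolding function_algebra_def
  proof (intro conjI ballI allI)
    show "(\<lambda>x. 0) \<in> B" unfolding B_def by (auto intro!: exI[of _ "\<lambda>_. 0"])
    fix f k assume "f \<in> B" "k \<in> B"
    then obtain a b where ab: "continuous_on K a" "a (\<lambda>_. 0) = 0" "f = (\<lambda>x. a (emb x))"
      "continuous_on K b" "b (\<lambda>_. 0) = 0" "k = (\<lambda>x. b (emb x))" unfolding B_def by blast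
    show "(\<lambda>x. f x + k x) \<in> B"
      unfolding B_def using ab by (auto intro!: exI[of _ "\<lambda>y. a y + b y"] continuous_intros)
    show "(\<lambda>x. f x * k x) \<in> B"
      unfolding B_def using ab by (auto intro!: exI[of _ "\<lambda>y. a y * b y"] continuous_intros)
  next
    fix c f assume "f \<in> B"
    then obtain a where "continuous_on K a" "a (\<lambda>_. 0) = 0" "f = (\<lambda>x. a (emb x))"
      unfolding B_def by blast
    then show "(\<lambda>x. c * f x) \<in> B"
      unfolding B_def by (auto intro!: exI[of _ "\<lambda>y. c * a y"] continuous_intros)
  qed
  moreover have "bounded (range f)" if "f \<in> B" for f
  proof -
    from that obtain h where h: "continuous_on K h" "f = (\<lambda>x. h (emb x))" by (auto simp: B_def)
    have "bounded (h ` K)" by (intro compact_imp_bounded compact_continuous_image h compact_K)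
    moreover have "range f \<subseteq> h ` K" unfolding h(2) using emb_in_K by auto
    ultimately show ?thesis by (rule bounded_subset)
  qed
  moreover have "uniformly_closed B"
    unfolding uniformly_closed_def
  proof (intro allI impI, elim conjE)
    fix f :: "nat \<Rightarrow> 'a \<Rightarrow> real" assume "range f \<subseteq> B" and Cauchy: "uniformly_Cauchy_on UNIV f"
    then have "\<exists>h. continuous_on K h \<and> h (\<lambda>_. 0) = 0 \<and> f n = (\<lambda>x. h (emb x))" for n unfolding B_def by blast
    then obtain h where h: "\<And>n. continuous_on K (h n)" "\<And>n. h n (\<lambda>_. 0) = 0" "\<And>n. f n = (\<lambda>x. h n (emb x))"
      by metis
    \<comment> \<open>The Cauchy estimate extends from the embedded points to \<open>K\<close> by
      density, which weakens the strict inequality; hence \<open>e/2\<close>.\<close>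
    have "uniformly_Cauchy_on K h"
    proof (rule uniformly_Cauchy_onI)
      fix e :: real assume e: "0 < e"
      have "\<exists>N. \<forall>x\<in>UNIV. \<forall>m\<ge>N. \<forall>n\<ge>N. dist (f m x) (f n x) < e/2"
        using Cauchy[unfolded uniformly_Cauchy_on_def, rule_format, of "e/2"] e by simp
      then obtain N where N: "\<And>x m n. N \<le> m \<Longrightarrow> N \<le> n \<Longrightarrow> dist (f m x) (f n x) < e/2"
        by blast
      have "dist (h m y) (h n y) < e" if "N \<le> m" "N \<le> n" "y \<in> K" for m n y
      proof -
        have "\<bar>h m y - h n y\<bar> \<le> e/2"
        proof (rule abs_le_on_K[of "\<lambda>y. h m y - h n y", OF _ _ _ that(3)])
          show "continuous_on K (\<lambda>y. h m y - h n y)" by (intro continuous_intros h)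
          show "\<bar>h m (emb x) - h n (emb x)\<bar> \<le> e/2" for x
            using N[OF that(1,2), of x] by (simp add: h(3) dist_real_def less_imp_le)
          show "\<bar>h m (\<lambda>_. 0) - h n (\<lambda>_. 0)\<bar> \<le> e/2" using e by (simp add: h(2))
        qed
        then show ?thesis using e by (simp add: dist_real_def)
      qed
      then show "\<exists>M. \<forall>x\<in>K. \<forall>m\<ge>M. \<forall>n\<ge>M. dist (h m x) (h n x) < e" by blast
    qed
    then obtain l where l: "uniform_limit K h l sequentially"
      using Cauchy_uniformly_convergent unfolding uniformly_convergent_on_def by blast
    have "continuous_on K l" by (rule uniform_limit_theorem[OF _ l]) (use h in auto)
    moreover have "l (\<lambda>_. 0) = 0"
      using tendsto_uniform_limitI[OF l zero_in_K] by (simp add: h(2) LIMSEQ_const_iff)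
    moreover have "uniform_limit UNIV f (\<lambda>x. l (emb x)) sequentially"
    proof -
      have "uniform_limit (range emb) h l sequentially"
        using l by (rule uniform_limit_on_subset) (use emb_in_K in auto)
      then show ?thesis by (simp add: uniform_limit_iff h(3))
    qed
    ultimately show "\<exists>k\<in>B. uniform_limit UNIV f k sequentially" unfolding B_def by blast
  qed
  moreover have "range g \<subseteq> B"
    unfolding B_def
    by (auto simp: emb_def intro!: exI[of _ "\<lambda>y. y _"] continuous_on_subset[OF continuous_on_product_coordinates])
  ultimately have "A \<subseteq> B" using generates unfolding generates_def bounded_function_algebra_def by blast
  moreover assume "f \<in> A"
  ultimately show "\<exists>h. continuous_on K h \<and> h (\<lambda>_. 0) = 0 \<and> f = (\<lambda>x. h (emb x))" by (auto simp: B_def)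
qed

text \<open>On \<open>K\<close> the choice is unambiguous, since a continuous function is determined
  by its values at the embedded points and the origin. The value 0 off \<open>K\<close> fits the
  convention for functions on a subspace.\<close>

definition hat :: "('a \<Rightarrow> real) \<Rightarrow> (nat \<Rightarrow> real) \<Rightarrow> real" where
  "hat f y = (if y \<in> K then (SOME h. continuous_on K h \<and> h (\<lambda>_. 0) = 0 \<and> f = (\<lambda>x. h (emb x))) y else 0)"

lemma
  assumes "f \<in> A"
  shows continuous_hat: "continuous_on K (hat f)"
    and hat_zero: "hat f (\<lambda>_. 0) = 0"
    and hat_emb: "hat f (emb x) = f x"
proof -
  define k where "k = (SOME h. continuous_on K h \<and> h (\<lambda>_. 0) = 0 \<and> f = (\<lambda>x. h (emb x)))"
  have k: "continuous_on K k" "k (\<lambda>_. 0) = 0" "f = (\<lambda>x. k (emb x))"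
    using someI_ex[OF assms[unfolded A_iff]] unfolding k_def by auto
  have hat_eq: "hat f y = k y" if "y \<in> K" for y using that by (simp add: hat_def k_def)
  show "continuous_on K (hat f)" using k(1) hat_eq by (simp cong: continuous_on_cong)
  show "hat f (\<lambda>_. 0) = 0" using hat_eq[OF zero_in_K] k(2) by simp
  show "hat f (emb x) = f x" using hat_eq[OF emb_in_K] by (subst k(3)) simp
qed

lemma hat_outside: "y \<notin> K \<Longrightarrow> hat f y = 0"
  by (simp add: hat_def)

lemma hat_bound:
  assumes "f \<in> A" "\<And>x. \<bar>f x\<bar> \<le> c"
  shows "\<bar>hat f y\<bar> \<le> c"
proof (cases "y \<in> K")
  case True
  \<comment> \<open>\<open>undefined\<close> serves as a point of \<open>X\<close>: nonemptiness of
    \<open>X\<close> is built into the type.\<close>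
  have "0 \<le> c" using assms(2)[of undefined] by linarith
  then show ?thesis
    using assms hat_zero[OF assms(1)] hat_emb[OF assms(1)]
    by (intro abs_le_on_K[OF continuous_hat[OF assms(1)] _ _ True]) auto
next
  case False
  have "0 \<le> c" using assms(2)[of undefined] by linarith
  with False show ?thesis by (simp add: hat_outside)
qed

text \<open>The tool for the identities below: their right-hand sides are continuous on
  \<open>K\<close>, vanish at the origin and off \<open>K\<close>, and have the right values at
  embedded points.\<close>

lemma hat_unique:
  assumes h: "continuous_on K h" "h (\<lambda>_. 0) = 0" "\<And>y. y \<notin> K \<Longrightarrow> h y = 0"
    and f: "f = (\<lambda>x. h (emb x))"
  shows "f \<in> A" "hat f = h"
proof -
  show fA: "f \<in> A" unfolding A_iff by (intro exI[of _ h] conjI h f)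
  show "hat f = h"
  proof
    fix y
    show "hat f y = h y"
    proof (cases "y \<in> K")
      case True
      have fx: "f x = h (emb x)" for x using f by simp
      have "\<bar>hat f y - h y\<bar> \<le> 0"
      proof (rule abs_le_on_K[OF _ _ _ True])
        show "continuous_on K (\<lambda>y. hat f y - h y)" by (intro continuous_intros continuous_hat fA h)
        show "\<bar>hat f (emb x) - h (emb x)\<bar> \<le> 0" for x using hat_emb[OF fA, of x] fx[of x] by simp
        show "\<bar>hat f (\<lambda>_. 0) - h (\<lambda>_. 0)\<bar> \<le> 0" using hat_zero[OF fA] h(2) by simp
      qed
      then show ?thesis by simp
    qed (simp add: hat_outside h)
  qed
qed

lemma hat_add: "f \<in> A \<Longrightarrow> k \<in> A \<Longrightarrow> hat (\<lambda>x. f x + k x) = (\<lambda>y. hat f y + hat k y)"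
  by (rule hat_unique) (auto intro!: continuous_intros continuous_hat simp: hat_zero hat_emb hat_outside)

lemma hat_diff: "f \<in> A \<Longrightarrow> k \<in> A \<Longrightarrow> hat (\<lambda>x. f x - k x) = (\<lambda>y. hat f y - hat k y)"
  by (rule hat_unique) (auto intro!: continuous_intros continuous_hat simp: hat_zero hat_emb hat_outside)

lemma hat_mult: "f \<in> A \<Longrightarrow> k \<in> A \<Longrightarrow> hat (\<lambda>x. f x * k x) = (\<lambda>y. hat f y * hat k y)"
  by (rule hat_unique) (auto intro!: continuous_intros continuous_hat simp: hat_zero hat_emb hat_outside)

lemma hat_cmult: "f \<in> A \<Longrightarrow> hat (\<lambda>x. c * f x) = (\<lambda>y. c * hat f y)"
  by (rule hat_unique) (auto intro!: continuous_intros continuous_hat simp: hat_zero hat_emb hat_outside)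

lemma
  assumes f: "f \<in> A" and F: "continuous_on UNIV F" "F 0 = 0"
  shows compose_in_A: "(\<lambda>x. F (f x)) \<in> A"
    and hat_compose: "hat (\<lambda>x. F (f x)) = (\<lambda>y. F (hat f y))"
proof -
  have c: "continuous_on K (\<lambda>y. F (hat f y))"
    by (rule continuous_on_compose2[OF F(1) continuous_hat[OF f]]) auto
  have out: "F (hat f y) = 0" if "y \<notin> K" for y
    using hat_outside[OF that] F(2) by simp
  have eq: "(\<lambda>x. F (f x)) = (\<lambda>x. F (hat f (emb x)))" by (simp add: hat_emb[OF f])
  have z: "F (hat f (\<lambda>_. 0)) = 0" using hat_zero[OF f] F(2) by simp
  show "(\<lambda>x. F (f x)) \<in> A" "hat (\<lambda>x. F (f x)) = (\<lambda>y. F (hat f y))"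
    using hat_unique[of "\<lambda>y. F (hat f y)", OF c z out eq] by simp_all
qed

lemma inj_on_hat: "inj_on hat A"
  by (rule inj_onI) (metis ext hat_emb)

lemma hat_measurable: "f \<in> A \<Longrightarrow> hat f \<in> borel_measurable borel"
proof -
  assume f: "f \<in> A"
  have "(\<lambda>y. if y \<in> K then hat f y else 0) \<in> borel_measurable borel"
    by (intro borel_measurable_continuous_on_if continuous_hat f continuous_on_const borel_closed closed_K)
  moreover have "(\<lambda>y. if y \<in> K then hat f y else 0) = hat f"
    by (auto simp: fun_eq_iff hat_outside)
  ultimately show ?thesis by simp
qed

text \<open>Iterating \<open>step\<close> produces the polynomials in the generators without
  constant term and with rational coefficients. The members of \<open>A\<close> that they
  approximate form a uniformly closed algebra containing the generators, hence all of
  \<open>A\<close>.\<close>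

lemma countable_dense_subset:
  obtains Q where "countable Q" "Q \<subseteq> A" "\<And>f e. f \<in> A \<Longrightarrow> 0 < e \<Longrightarrow> \<exists>h\<in>Q. \<forall>x. \<bar>f x - h x\<bar> < e"
proof -
  define step where "step S = S \<union> (\<lambda>(f, h) x. f x + h x) ` (S \<times> S) \<union> (\<lambda>(f, h) x. f x * h x) ` (S \<times> S)
      \<union> (\<lambda>(r, f) x. of_rat r * f x) ` (UNIV \<times> S)" for S :: "('a \<Rightarrow> real) set"
  define Qn where "Qn n = (step ^^ n) (insert (\<lambda>x. 0) (range g))" for n
  define Q where "Q = (\<Union>n. Qn n)"
  have Qn_Suc: "Qn (Suc n) = step (Qn n)" for n by (simp add: Qn_def)
  have mono: "Qn m \<subseteq> Qn n" if "m \<le> n" for m n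
    by (rule lift_Suc_mono_le[OF _ that]) (auto simp: Qn_Suc step_def)
  have cnt: "countable (Qn n)" for n
  proof (induction n)
    case (Suc n)
    then show ?case unfolding Qn_Suc step_def by (intro countable_Un countable_image countable_SIGMA) auto
  qed (simp add: Qn_def)
  have QnA: "Qn n \<subseteq> A" for n
    by (induction n) (auto simp: Qn_Suc step_def intro!: A_closed, auto simp: Qn_def A_closed g_in_A)
  have Q0: "(\<lambda>x. 0) \<in> Q" and Qg: "g n \<in> Q" for n unfolding Q_def by (auto intro!: exI[of _ 0] simp: Qn_def)
  have Q_add: "(\<lambda>x. f x + h x) \<in> Q" and Q_mult: "(\<lambda>x. f x * h x) \<in> Q" if "f \<in> Q" "h \<in> Q" for f h
  proof -
    from that obtain m n where "f \<in> Qn m" "h \<in> Qn n" by (auto simp: Q_def)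
    then have fh: "(f, h) \<in> Qn (max m n) \<times> Qn (max m n)"
      using mono[of m "max m n"] mono[of n "max m n"] by auto
    have "(\<lambda>x. f x + h x) \<in> Qn (Suc (max m n))" "(\<lambda>x. f x * h x) \<in> Qn (Suc (max m n))"
      using imageI[OF fh, of "\<lambda>(f, h) x. f x + h x"] imageI[OF fh, of "\<lambda>(f, h) x. f x * h x"]
      unfolding Qn_Suc step_def by auto
    then show "(\<lambda>x. f x + h x) \<in> Q" "(\<lambda>x. f x * h x) \<in> Q" by (auto simp: Q_def)
  qed
  have Q_scale: "(\<lambda>x. of_rat r * f x) \<in> Q" if "f \<in> Q" for f r
  proof -
    from that obtain m where "f \<in> Qn m" by (auto simp: Q_def)
    then have rf: "(r, f) \<in> UNIV \<times> Qn m" by auto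
    have "(\<lambda>x. of_rat r * f x) \<in> Qn (Suc m)"
      using imageI[OF rf, of "\<lambda>(r, f) x. of_rat r * f x"] unfolding Qn_Suc step_def by auto
    then show ?thesis by (auto simp: Q_def)
  qed
  have QA: "Q \<subseteq> A" using QnA by (auto simp: Q_def)
  define B where "B = {f \<in> A. \<forall>e>0. \<exists>h\<in>Q. \<forall>x. \<bar>f x - h x\<bar> < e}"
  have BD: "\<exists>h\<in>Q. \<forall>x. \<bar>f x - h x\<bar> < e" if "f \<in> B" "0 < e" for f e using that by (auto simp: B_def)
  have "function_algebra B"
    unfolding function_algebra_def
  proof (intro conjI ballI allI)
    show "(\<lambda>x. 0) \<in> B" unfolding B_def using Q0 by (auto intro!: A_closed bexI[of _ "\<lambda>x. 0"])
    fix f k assume f: "f \<in> B" and k: "k \<in> B"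
    then have fkA: "f \<in> A" "k \<in> A" by (auto simp: B_def)
    show "(\<lambda>x. f x + k x) \<in> B"
    proof -
      have "\<exists>h\<in>Q. \<forall>x. \<bar>(f x + k x) - h x\<bar> < e" if e: "0 < e" for e
      proof -
        obtain a where a: "a \<in> Q" "\<And>x. \<bar>f x - a x\<bar> < e/2" using BD[OF f, of "e/2"] e by auto
        obtain b where b: "b \<in> Q" "\<And>x. \<bar>k x - b x\<bar> < e/2" using BD[OF k, of "e/2"] e by auto
        have "\<bar>(f x + k x) - (a x + b x)\<bar> < e" for x using a(2)[of x] b(2)[of x] by linarith
        then show ?thesis by (intro bexI[OF _ Q_add[OF a(1) b(1)]] allI)
      qed
      then show ?thesis using fkA by (auto simp: B_def intro: A_closed)
    qed
    show "(\<lambda>x. f x * k x) \<in> B"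
    proof -
      obtain M where M: "\<And>x. \<bar>f x\<bar> \<le> M" using bounded_A[OF fkA(1)] by (auto simp: bounded_iff)
      obtain N where N: "\<And>x. \<bar>k x\<bar> \<le> N" using bounded_A[OF fkA(2)] by (auto simp: bounded_iff)
      have MN: "0 \<le> M" "0 \<le> N" using M[of undefined] N[of undefined] by linarith+
      have "\<exists>h\<in>Q. \<forall>x. \<bar>f x * k x - h x\<bar> < e" if e: "0 < e" for e
      proof -
        \<comment> \<open>The product error is at most \<open>M * d + (N + 1) * d\<close>, where
          \<open>d <= 1\<close> gives the bound \<open>N + 1\<close> for \<open>b\<close>; the extra
          unit in the denominator makes the estimate strict.\<close>
        define d where "d = min 1 (e / (M + N + 2))"
        have MN2: "0 < M + N + 2" using MN by simp
        then have d: "0 < d" "d \<le> 1" using e by (auto simp: d_def)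
        have d3: "d * (M + N + 2) \<le> e"
          unfolding pos_le_divide_eq[OF MN2, symmetric] by (simp add: d_def)
        obtain a b where a: "a \<in> Q" "\<And>x. \<bar>f x - a x\<bar> < d" and b: "b \<in> Q" "\<And>x. \<bar>k x - b x\<bar> < d"
          using BD[OF f d(1)] BD[OF k d(1)] by auto
        have "\<bar>f x * k x - a x * b x\<bar> < e" for x
        proof -
          have "\<bar>b x\<bar> \<le> N + 1" using b(2)[of x] N[of x] d by linarith
          have "\<bar>f x * k x - a x * b x\<bar> = \<bar>f x * (k x - b x) + b x * (f x - a x)\<bar>" by (simp add: algebra_simps)
          also have "\<dots> \<le> \<bar>f x\<bar> * \<bar>k x - b x\<bar> + \<bar>b x\<bar> * \<bar>f x - a x\<bar>" by (simp add: abs_mult[symmetric])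
          also have "\<dots> \<le> M * d + (N + 1) * d"
            using M \<open>\<bar>b x\<bar> \<le> N + 1\<close> a(2)[of x] b(2)[of x] MN by (intro add_mono mult_mono) auto
          also have "\<dots> < d * (M + N + 2)" using d by (simp add: algebra_simps)
          finally show ?thesis using d3 by simp
        qed
        then show ?thesis by (intro bexI[OF _ Q_mult[OF a(1) b(1)]] allI)
      qed
      then show ?thesis using fkA by (auto simp: B_def intro: A_closed)
    qed
  next
    fix c f assume f: "f \<in> B"
    then have fA: "f \<in> A" by (auto simp: B_def)
    obtain M where M: "\<And>x. \<bar>f x\<bar> \<le> M" using bounded_A[OF fA] by (auto simp: bounded_iff)
    have M0: "0 \<le> M" using M[of undefined] by linarith
    have "\<exists>h\<in>Q. \<forall>x. \<bar>c * f x - h x\<bar> < e" if e: "0 < e" for e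
    proof -
      have d: "0 < e / (2 * (M + 1))" using e M0 by simp
      obtain r where "c - e / (2 * (M + 1)) < of_rat r" "of_rat r < c"
        using of_rat_dense[of "c - e / (2 * (M + 1))" c] d by auto
      define s where "s = (of_rat r :: real)"
      have r: "\<bar>c - s\<bar> < e / (2 * (M + 1))"
        using \<open>c - e / (2 * (M + 1)) < of_rat r\<close> \<open>of_rat r < c\<close> unfolding s_def by linarith
      obtain a where a: "a \<in> Q" "\<And>x. \<bar>f x - a x\<bar> < e / (2 * (\<bar>s\<bar> + 1))"
      proof -
        have "0 < e / (2 * (\<bar>s\<bar> + 1))" using e by (intro divide_pos_pos) auto
        from BD[OF f this] show thesis using that by blast
      qed
      have "\<bar>c * f x - s * a x\<bar> < e" for x
      proof -
        have "\<bar>c * f x - s * a x\<bar> = \<bar>(c - s) * f x + s * (f x - a x)\<bar>" by (simp add: algebra_simps)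
        also have "\<dots> \<le> \<bar>c - s\<bar> * \<bar>f x\<bar> + \<bar>s\<bar> * \<bar>f x - a x\<bar>" by (simp add: abs_mult[symmetric])
        also have "\<dots> \<le> e / (2 * (M + 1)) * M + \<bar>s\<bar> * (e / (2 * (\<bar>s\<bar> + 1)))"
          using r M a(2)[of x] M0 d by (intro add_mono mult_mono) (auto simp: less_imp_le)
        also have "\<dots> < e / 2 + e / 2"
          using e M0 by (intro add_strict_mono) (auto simp: field_simps)
        finally show ?thesis by simp
      qed
      then show ?thesis unfolding s_def by (intro bexI[OF _ Q_scale[OF a(1)]] allI)
    qed
    then show "(\<lambda>x. c * f x) \<in> B" using fA by (auto simp: B_def intro: A_closed)
  qed
  moreover have "uniformly_closed B"
    unfolding uniformly_closed_def
  proof (intro allI impI, elim conjE)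
    fix f :: "nat \<Rightarrow> 'a \<Rightarrow> real" assume fB: "range f \<subseteq> B" and Cauchy: "uniformly_Cauchy_on UNIV f"
    have "range f \<subseteq> A" using fB by (auto simp: B_def)
    then obtain l where l: "l \<in> A" "uniform_limit UNIV f l sequentially"
      using closed_A Cauchy unfolding uniformly_closed_def by blast
    have "\<exists>h\<in>Q. \<forall>x. \<bar>l x - h x\<bar> < e" if e: "0 < e" for e
    proof -
      obtain n where n: "\<And>x. dist (f n x) (l x) < e/2"
        using l(2) e unfolding uniform_limit_iff eventually_sequentially by (metis UNIV_I half_gt_zero order_refl)
      obtain h where h: "h \<in> Q" "\<And>x. \<bar>f n x - h x\<bar> < e/2" using BD[of "f n" "e/2"] fB e by auto
      have "\<bar>l x - h x\<bar> < e" for x using n[of x] h(2)[of x] unfolding dist_real_def by linarith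
      then show ?thesis by (intro bexI[OF _ h(1)] allI)
    qed
    then show "\<exists>g\<in>B. uniform_limit UNIV f g sequentially" using l by (auto simp: B_def)
  qed
  moreover have "range g \<subseteq> B" 
  proof -
    have "g n \<in> B" for n using g_in_A[of n] by (auto simp: B_def intro!: bexI[OF _ Qg[of n]])
    then show ?thesis by auto
  qed
  moreover have "\<forall>f\<in>B. bounded (range f)" using bounded_A by (auto simp: B_def)
  ultimately have "A \<subseteq> B"
    using generates unfolding generates_def bounded_function_algebra_def by blast
  show thesis
  proof
    show "countable Q" unfolding Q_def using cnt by auto
    show "\<exists>h\<in>Q. \<forall>x. \<bar>f x - h x\<bar> < e" if "f \<in> A" "0 < e" for f e
      using BD \<open>A \<subseteq> B\<close> that by blast
  qed (fact QA)
qed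

end

section \<open>Forms on which normal contractions operate\<close>

lemma ennreal_sqrt_ennreal: "0 \<le> r \<Longrightarrow> ennreal_sqrt (ennreal r) = ennreal (sqrt r)"
  by (simp add: ennreal_sqrt_def)

lemma ennreal_sqrt_top: "ennreal_sqrt top = top"
  by (simp add: ennreal_sqrt_def)

lemma ennreal_sqrt_le_imp_le:
  assumes "ennreal_sqrt a \<le> ennreal_sqrt b" shows "a \<le> b"
proof (cases a; cases b)
  fix r s assume "a = ennreal r" "0 \<le> r" "b = ennreal s" "0 \<le> s"
  then show ?thesis using assms by (simp add: ennreal_sqrt_ennreal)
qed (use assms in \<open>auto simp: ennreal_sqrt_ennreal ennreal_sqrt_top top_unique\<close>)

lemma ennreal_sqrt_finite_iff: "ennreal_sqrt a < top \<longleftrightarrow> a < top"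
  by (cases a) (auto simp: ennreal_sqrt_ennreal ennreal_sqrt_top)

text \<open>The cross term \<open>2 s t polar f h\<close> is at most \<open>s t (Q f + Q h)\<close>.
  Convexity opens the sublevel sets to separation arguments.\<close>

lemma (in parallelogram_form) Q_convex:
  assumes f: "f \<in> V" and h: "h \<in> V" and st: "0 \<le> s" "0 \<le> t" "s + t = 1"
  shows "Q (\<lambda>x. s * f x + t * h x) \<le> s * Q f + t * Q h"
proof -
  let ?u = "\<lambda>x. s * f x + t * h x"
  have V: "(\<lambda>x. s * f x) \<in> V" "(\<lambda>x. t * h x) \<in> V" "?u \<in> V"
    by (intro V_cmult V_add f h)+
  have left: "polar ?u k = s * polar f k + t * polar h k" if "k \<in> V" for k
    using polar_add[OF V(1,2) that] polar_cmult[OF f that] polar_cmult[OF h that] by simp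
  have "Q ?u = s * polar f ?u + t * polar h ?u"
    using left[OF V(3)] polar_self[OF V(3)] by simp
  also have "\<dots> = s * (s * Q f + t * polar f h) + t * (s * polar f h + t * Q h)"
    using left[OF f] left[OF h] polar_commute[OF f V(3)] polar_commute[OF h V(3)] polar_commute[OF h f]
      polar_self[OF f] polar_self[OF h] by simp
  also have "\<dots> = s * s * Q f + t * t * Q h + 2 * (s * t) * polar f h" by (simp add: algebra_simps)
  also have "\<dots> \<le> s * s * Q f + t * t * Q h + 2 * (s * t) * ((Q f + Q h) / 2)"
    using polar_bound[OF f h] st by (intro add_left_mono mult_left_mono) (auto simp: abs_le_iff)
  also have "\<dots> = s * (s + t) * Q f + t * (s + t) * Q h" by (simp add: algebra_simps)
  finally show ?thesis using st by simp
qed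

locale contractive_form = generated_algebra A g
  for A :: "('a \<Rightarrow> real) set" and g +
  fixes E :: "('a \<Rightarrow> real) \<Rightarrow> ennreal"
  assumes quadratic: "quadratic_form_on A E"
    and g_finite: "\<And>n. E (g n) < \<infinity>"
    and lsc: "sup_norm_lsc A E"
    and contractions: "normal_contractions_operate A E"
begin

definition D :: "('a \<Rightarrow> real) set" where
  "D = effective_domain A E"

text \<open>\<open>enn2real\<close> sends infinity to 0, so \<open>e\<close> represents the form on
  \<open>D\<close> only.\<close>

definition e :: "('a \<Rightarrow> real) \<Rightarrow> real" where
  "e f = enn2real (E f)"

lemma D_iff: "f \<in> D \<longleftrightarrow> f \<in> A \<and> E f < top"
  by (simp add: D_def effective_domain_def)

lemma D_in_A: "f \<in> D \<Longrightarrow> f \<in> A"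
  by (simp add: D_iff)

lemma E_eq: "f \<in> D \<Longrightarrow> E f = ennreal (e f)"
  by (simp add: D_iff e_def)

lemma e_nonneg: "0 \<le> e f"
  by (simp add: e_def)

lemma contraction_1:
  fixes F :: "real \<Rightarrow> real"
  assumes f: "f \<in> A" and F: "F 0 = 0" "\<And>s t. \<bar>F s - F t\<bar> \<le> \<bar>s - t\<bar>"
  shows "E (\<lambda>x. F (f x)) \<le> E f"
proof -
  have "normal_contraction 1 (\<lambda>z. F (z 0))" using F by (simp add: normal_contraction_def)
  then have "ennreal_sqrt (E (\<lambda>x. F (f x))) \<le> (\<Sum>i<(1::nat). ennreal_sqrt (E f))"
    using contractions[unfolded normal_contractions_operate_def, rule_format, of 1 "\<lambda>z. F (z 0)" "\<lambda>_. f"] f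
    by simp
  then show ?thesis by - (rule ennreal_sqrt_le_imp_le, simp)
qed

lemma contraction_2:
  fixes F :: "real \<Rightarrow> real \<Rightarrow> real"
  assumes fh: "f \<in> A" "h \<in> A"
    and F: "F 0 0 = 0" "\<And>s t s' t'. \<bar>F s t - F s' t'\<bar> \<le> \<bar>s - s'\<bar> + \<bar>t - t'\<bar>"
  shows "ennreal_sqrt (E (\<lambda>x. F (f x) (h x))) \<le> ennreal_sqrt (E f) + ennreal_sqrt (E h)"
proof -
  have 2: "{..<2::nat} = {0, 1}" by auto
  have "normal_contraction 2 (\<lambda>z. F (z 0) (z 1))" using F by (simp add: normal_contraction_def 2)
  then have "ennreal_sqrt (E (\<lambda>x. F (f x) (h x))) \<le> (\<Sum>i<(2::nat). ennreal_sqrt (E (if i = 0 then f else h)))"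
    using contractions[unfolded normal_contractions_operate_def, rule_format,
        of 2 "\<lambda>z. F (z 0) (z 1)" "\<lambda>i. if i = 0 then f else h"] fh
    by simp
  then show ?thesis by (simp add: 2)
qed

lemma contraction_in_D:
  fixes F :: "real \<Rightarrow> real"
  assumes f: "f \<in> D" and F: "F 0 = 0" "\<And>s t. \<bar>F s - F t\<bar> \<le> \<bar>s - t\<bar>"
  shows "(\<lambda>x. F (f x)) \<in> D" "e (\<lambda>x. F (f x)) \<le> e f" "hat (\<lambda>x. F (f x)) = (\<lambda>y. F (hat f y))"
proof -
  have "continuous_on UNIV F"
    unfolding continuous_on_iff using F(2) by (metis dist_real_def le_less_trans)
  note comp = compose_in_A[OF D_in_A[OF f] this F(1)] hat_compose[OF D_in_A[OF f] this F(1)]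
  show hat: "hat (\<lambda>x. F (f x)) = (\<lambda>y. F (hat f y))" by (rule comp)
  have le: "E (\<lambda>x. F (f x)) \<le> E f" by (rule contraction_1[OF D_in_A[OF f] F])
  with comp f show "(\<lambda>x. F (f x)) \<in> D" by (auto simp: D_iff intro: le_less_trans)
  show "e (\<lambda>x. F (f x)) \<le> e f"
    using le f unfolding e_def by (intro enn2real_mono) (auto simp: D_iff)
qed

text \<open>Multiplication is Lipschitz on bounded sets only. Clamping both arguments to
  \<open>[-c, c]\<close> makes it Lipschitz with constant \<open>c\<close>, and division by
  \<open>c\<close> yields a normal contraction of two variables.\<close>

lemma clamp_mult_contraction:
  fixes c :: real
  assumes c: "0 < c"
  defines "k \<equiv> \<lambda>s. max (- c) (min s c)"
  shows "\<bar>k s * k t / c - k s' * k t' / c\<bar> \<le> \<bar>s - s'\<bar> + \<bar>t - t'\<bar>"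
proof -
  have k: "\<bar>k s\<bar> \<le> c" for s using c by (auto simp: k_def)
  have lip: "\<bar>k s - k t\<bar> \<le> \<bar>s - t\<bar>" for s t by (auto simp: k_def max_def min_def)
  have "\<bar>k s * k t - k s' * k t'\<bar> = \<bar>k s * (k t - k t') + k t' * (k s - k s')\<bar>" by (simp add: algebra_simps)
  also have "\<dots> \<le> \<bar>k s\<bar> * \<bar>k t - k t'\<bar> + \<bar>k t'\<bar> * \<bar>k s - k s'\<bar>" by (simp add: abs_mult[symmetric])
  also have "\<dots> \<le> c * \<bar>t - t'\<bar> + c * \<bar>s - s'\<bar>"
    using c by (intro add_mono mult_mono k lip) auto
  finally show ?thesis using c by (simp add: diff_divide_distrib[symmetric] field_simps)
qed

text \<open>For \<open>c = 0\<close> both sides vanish even if \<open>E f\<close> is infinite, as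
  \<open>0 * top = 0\<close>.\<close>

lemma quadratic_cmult: "f \<in> A \<Longrightarrow> E (\<lambda>x. c * f x) = ennreal (c\<^sup>2) * E f"
  using quadratic by (cases "c = 0") (auto simp: quadratic_form_on_def)

lemma quadratic_parallelogram: "f \<in> A \<Longrightarrow> h \<in> A \<Longrightarrow>
    E (\<lambda>x. f x + h x) + E (\<lambda>x. f x - h x) = 2 * E f + 2 * E h"
  using quadratic by (auto simp: quadratic_form_on_def)

lemma D_cmult: "f \<in> D \<Longrightarrow> (\<lambda>x. c * f x) \<in> D"
  by (auto simp: D_iff quadratic_cmult ennreal_mult_less_top intro: A_closed)

lemma
  assumes "f \<in> D" "h \<in> D"
  shows D_add: "(\<lambda>x. f x + h x) \<in> D" and D_diff: "(\<lambda>x. f x - h x) \<in> D"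
proof -
  have "E (\<lambda>x. f x + h x) + E (\<lambda>x. f x - h x) < top"
    using assms by (subst quadratic_parallelogram) (auto simp: D_iff ennreal_mult_less_top)
  then show "(\<lambda>x. f x + h x) \<in> D" "(\<lambda>x. f x - h x) \<in> D"
    using assms by (auto simp: D_iff intro: A_closed)
qed

text \<open>\<open>N f\<close> and \<open>M h\<close> are both bounded by \<open>M N\<close>, so one
  clamp level leaves both unchanged, and their product divided by \<open>M N\<close> is
  \<open>f h\<close>.\<close>

lemma D_mult:
  assumes f: "f \<in> D" and h: "h \<in> D" shows "(\<lambda>x. f x * h x) \<in> D"
proof -
  obtain M where M: "0 < M" "\<And>x. \<bar>f x\<bar> \<le> M"
    using bounded_A[OF D_in_A[OF f]] unfolding bounded_pos by auto
  obtain N where N: "0 < N" "\<And>x. \<bar>h x\<bar> \<le> N"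
    using bounded_A[OF D_in_A[OF h]] unfolding bounded_pos by auto
  define k where "k s = max (- (M * N)) (min s (M * N))" for s
  have MN: "0 < M * N" using M N by simp
  have k: "k s = s" if "\<bar>s\<bar> \<le> M * N" for s using that by (auto simp: k_def)
  have "ennreal_sqrt (E (\<lambda>x. k (N * f x) * k (M * h x) / (M * N)))
      \<le> ennreal_sqrt (E (\<lambda>x. N * f x)) + ennreal_sqrt (E (\<lambda>x. M * h x))"
    by (rule contraction_2[where F = "\<lambda>s t. k s * k t / (M * N)"])
      (use f h MN clamp_mult_contraction[OF MN] in \<open>auto simp: k_def D_iff intro: A_closed\<close>)
  also have "\<dots> < top"
    using D_cmult[OF f] D_cmult[OF h] by (simp add: ennreal_sqrt_finite_iff D_iff)
  finally have "E (\<lambda>x. k (N * f x) * k (M * h x) / (M * N)) < top"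
    by (simp add: ennreal_sqrt_finite_iff)
  moreover have "k (N * f x) * k (M * h x) / (M * N) = f x * h x" for x
  proof -
    have "\<bar>N * f x\<bar> \<le> M * N" "\<bar>M * h x\<bar> \<le> M * N"
      using M N by (auto simp: abs_mult intro: mult_right_mono mult_left_mono)
    then show ?thesis using M N by (simp add: k)
  qed
  ultimately show ?thesis using f h by (simp add: D_iff A_closed)
qed

lemma zero_in_D: "(\<lambda>x. 0) \<in> D"
  using quadratic A_closed(1) by (simp add: D_iff quadratic_form_on_def)

lemma algebra_D: "function_algebra D"
  unfolding function_algebra_def using zero_in_D by (auto intro: D_add D_cmult D_mult)

lemma g_in_D: "g n \<in> D"
  using g_in_A g_finite by (simp add: D_iff)

sublocale D_form: parallelogram_form D e
proof
  fix f assume f: "f \<in> D"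
  show "e (\<lambda>x. c * f x) = c\<^sup>2 * e f" for c
    using f by (simp add: e_def quadratic_cmult D_in_A enn2real_mult)
  fix h assume h: "h \<in> D"
  have "ennreal (e (\<lambda>x. f x + h x) + e (\<lambda>x. f x - h x)) = ennreal (2 * e f + 2 * e h)"
    using quadratic_parallelogram[OF D_in_A[OF f] D_in_A[OF h]] f h
    by (simp add: E_eq D_add D_diff e_nonneg ennreal_plus ennreal_mult)
  then show "e (\<lambda>x. f x + h x) + e (\<lambda>x. f x - h x) = 2 * e f + 2 * e h"
    by (subst (asm) ennreal_inj) (auto simp: e_nonneg)
qed (auto intro: D_add D_cmult e_nonneg)

text \<open>Otherwise members of the sublevel set would converge uniformly to \<open>f\<close>, and
  lower semicontinuity would give \<open>e f <= c\<close>. The point \<open>x\<close> still depends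
  on \<open>h\<close>; \<open>separating_measure\<close> removes this dependence.\<close>

lemma sublevel_distance:
  assumes f: "f \<in> D" and c: "c < e f"
  obtains r where "0 < r" "\<And>h. h \<in> D \<Longrightarrow> e h \<le> c \<Longrightarrow> \<exists>x. r \<le> \<bar>f x - h x\<bar>"
proof (rule ccontr)
  assume "\<not> thesis"
  note found = that
  have close: "\<exists>h\<in>D. e h \<le> c \<and> (\<forall>x. \<bar>f x - h x\<bar> < r)" if r: "0 < r" for r
  proof (rule ccontr)
    assume "\<not> (\<exists>h\<in>D. e h \<le> c \<and> (\<forall>x. \<bar>f x - h x\<bar> < r))"
    then have "\<exists>x. r \<le> \<bar>f x - h x\<bar>" if "h \<in> D" "e h \<le> c" for h
      using that by (auto simp: not_less)
    from found[OF r this] \<open>\<not> thesis\<close> show False by blast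
  qed
  have "\<exists>h. h \<in> D \<and> e h \<le> c \<and> (\<forall>x. \<bar>f x - h x\<bar> < 1 / real (Suc n))" for n
    using close[of "1 / real (Suc n)"] by auto
  then obtain h where h: "\<And>n. h n \<in> D" "\<And>n. e (h n) \<le> c" "\<And>n x. \<bar>f x - h n x\<bar> < 1 / real (Suc n)" by metis
  have "uniform_limit UNIV h f sequentially" by (rule uniform_limit_inverse_Suc) (rule h(3))
  then have "E f \<le> liminf (\<lambda>n. E (h n))"
    using lsc f h(1) unfolding sup_norm_lsc_def by (auto simp: D_iff)
  also have "\<dots> \<le> liminf (\<lambda>n. ennreal c)"
    using h by (intro Liminf_mono always_eventually allI) (auto simp: E_eq intro: ennreal_leI)
  also have "\<dots> = ennreal c" by (simp add: Liminf_const)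
  finally have "ennreal (e f) \<le> ennreal c" using f by (simp add: E_eq)
  moreover have "0 \<le> c" using h(2)[of 0] e_nonneg order_trans by blast
  ultimately show False using c by simp
qed

text \<open>The functions \<open>|hat f - hat h|\<close> with \<open>h\<close> in the sublevel set
  need not form a convex set, but their majorants do, since \<open>e\<close> and the absolute value
  are convex. Each majorant reaches \<open>r\<close> on \<open>K\<close>, so minimax applies to the
  set \<open>P\<close> of majorants.\<close>

lemma separating_measure:
  assumes f: "f \<in> A" and far: "\<And>h. h \<in> D \<Longrightarrow> e h \<le> c \<Longrightarrow> \<exists>x. r \<le> \<bar>f x - h x\<bar>"
  shows "\<exists>M :: (nat \<Rightarrow> real) measure. sets M = sets borel \<and> emeasure M UNIV \<le> 1 \<and>
    (\<forall>h\<in>D. e h \<le> c \<longrightarrow> ennreal r \<le> (\<integral>\<^sup>+y. ennreal \<bar>hat f y - hat h y\<bar> \<partial>M))"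
proof -
  define P :: "((nat \<Rightarrow> real) \<Rightarrow>\<^sub>C real) set" where
    "P = {u. (\<forall>y. 0 \<le> apply_bcontfun u y) \<and>
      (\<exists>h\<in>D. e h \<le> c \<and> (\<forall>y\<in>K. \<bar>hat f y - hat h y\<bar> \<le> apply_bcontfun u y))}"
  have "convex P"
  proof (rule convexI)
    fix u v and s t :: real assume u: "u \<in> P" and v: "v \<in> P" and st: "0 \<le> s" "0 \<le> t" "s + t = 1"
    from u obtain h where h: "h \<in> D" "e h \<le> c" "\<And>y. y \<in> K \<Longrightarrow> \<bar>hat f y - hat h y\<bar> \<le> apply_bcontfun u y"
      by (auto simp: P_def)
    from v obtain k where k: "k \<in> D" "e k \<le> c" "\<And>y. y \<in> K \<Longrightarrow> \<bar>hat f y - hat k y\<bar> \<le> apply_bcontfun v y"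
      by (auto simp: P_def)
    let ?w = "\<lambda>x. s * h x + t * k x"
    have w: "?w \<in> D" by (intro D_add D_cmult h k)
    have "e ?w \<le> s * e h + t * e k" by (rule D_form.Q_convex[OF h(1) k(1) st])
    also have "\<dots> \<le> s * c + t * c" using h k st by (intro add_mono mult_left_mono) auto
    also have "\<dots> = c" using st by (simp flip: distrib_right)
    finally have ew: "e ?w \<le> c" .
    have "\<bar>hat f y - hat ?w y\<bar> \<le> apply_bcontfun (s *\<^sub>R u + t *\<^sub>R v) y" if y: "y \<in> K" for y
    proof -
      have "hat ?w y = s * hat h y + t * hat k y"
        using h k by (simp add: hat_add hat_cmult D_in_A A_closed)
      moreover have "hat f y = s * hat f y + t * hat f y" using st by (simp flip: distrib_right)
      ultimately have eq: "hat f y - hat ?w y = s * (hat f y - hat h y) + t * (hat f y - hat k y)"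
        by (simp add: algebra_simps)
      have "\<bar>hat f y - hat ?w y\<bar> \<le> s * \<bar>hat f y - hat h y\<bar> + t * \<bar>hat f y - hat k y\<bar>"
        unfolding eq using st by (intro order_trans[OF abs_triangle_ineq]) (simp add: abs_mult)
      also have "\<dots> \<le> s * apply_bcontfun u y + t * apply_bcontfun v y"
        using h(3)[OF y] k(3)[OF y] st by (intro add_mono mult_left_mono)
      finally show ?thesis by (simp add: bcontfun_rep_eqs)
    qed
    moreover have "0 \<le> apply_bcontfun (s *\<^sub>R u + t *\<^sub>R v) y" for y
      using u v st by (auto simp: P_def bcontfun_rep_eqs)
    ultimately show "s *\<^sub>R u + t *\<^sub>R v \<in> P" using w ew unfolding P_def by blast
  qed
  have "K \<noteq> {}" using zero_in_K by auto
  obtain M :: "(nat \<Rightarrow> real) measure" where M: "sets M = sets borel" "emeasure M UNIV \<le> 1" "emeasure M (- K) = 0"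
    "\<And>u. u \<in> P \<Longrightarrow> ennreal r \<le> (\<integral>\<^sup>+y. ennreal (apply_bcontfun u y) \<partial>M)"
  proof (rule subprobability_bounding_convex_set_below[OF compact_K \<open>K \<noteq> {}\<close> \<open>convex P\<close>, of r])
    show "0 \<le> apply_bcontfun u y" if "u \<in> P" for u y using that by (simp add: P_def)
    show "\<exists>y\<in>K. r \<le> apply_bcontfun u y" if "u \<in> P" for u
    proof -
      from that obtain h where h: "h \<in> D" "e h \<le> c" "\<And>y. y \<in> K \<Longrightarrow> \<bar>hat f y - hat h y\<bar> \<le> apply_bcontfun u y"
        by (auto simp: P_def)
      obtain x where "r \<le> \<bar>f x - h x\<bar>" using far[OF h(1,2)] by auto
      then show ?thesis using h(3)[OF emb_in_K[of x]] emb_in_K[of x] f h(1)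
        by (intro bexI[of _ "emb x"]) (auto simp: hat_emb D_in_A)
    qed
  qed blast
  have "ennreal r \<le> (\<integral>\<^sup>+y. ennreal \<bar>hat f y - hat h y\<bar> \<partial>M)" if h: "h \<in> D" "e h \<le> c" for h
  proof -
    have cont: "continuous_on K (\<lambda>y. hat f y - hat h y)"
      by (intro continuous_intros continuous_hat f D_in_A h)
    obtain b where b': "0 < b" "\<forall>z\<in>(\<lambda>y. hat f y - hat h y) ` K. norm z \<le> b"
      using compact_imp_bounded[OF compact_continuous_image[OF cont compact_K]]
      unfolding bounded_pos by blast
    then have b: "0 \<le> b" "\<And>y. y \<in> K \<Longrightarrow> norm (hat f y - hat h y) \<le> b" by auto
    \<comment> \<open>\<open>P\<close> consists of bounded continuous functions on the whole space,
      whereas \<open>hat f - hat h\<close> is known to be continuous on \<open>K\<close> only.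
      Tietze extends it, and \<open>M\<close> does not see the difference.\<close>
    obtain u where u: "continuous_on UNIV u" "\<And>y. y \<in> K \<Longrightarrow> u y = hat f y - hat h y" "\<And>y. norm (u y) \<le> b"
    proof (rule Tietze[OF cont _ b, of UNIV])
      show "closedin (top_of_set UNIV) K" using closed_K by simp
    qed auto
    have ap: "apply_bcontfun (Bcontfun (\<lambda>y. \<bar>u y\<bar>)) = (\<lambda>y. \<bar>u y\<bar>)"
      by (rule apply_Bcontfun) (use u in \<open>auto intro!: continuous_intros boundedI[of _ b]\<close>)
    have "Bcontfun (\<lambda>y. \<bar>u y\<bar>) \<in> P" unfolding P_def using h by (auto simp: ap u)
    then have "ennreal r \<le> (\<integral>\<^sup>+y. ennreal \<bar>u y\<bar> \<partial>M)" using M(4) ap by fastforce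
    also have "\<dots> = (\<integral>\<^sup>+y. ennreal \<bar>hat f y - hat h y\<bar> \<partial>M)"
    proof (rule nn_integral_cong_AE)
      have "AE y in M. y \<in> K"
        using M(1,3) closed_K by (intro AE_I[of _ _ "- K"]) (auto simp: borel_open)
      then show "AE y in M. ennreal \<bar>u y\<bar> = ennreal \<bar>hat f y - hat h y\<bar>"
        by eventually_elim (simp add: u)
    qed
    finally show ?thesis .
  qed
  with M show ?thesis by blast
qed

end

section \<open>A measure for which the form is lower semicontinuous\<close>

lemma suminf_swap_ennreal:
  fixes f :: "nat \<Rightarrow> nat \<Rightarrow> ennreal"
  shows "(\<Sum>i. \<Sum>j. f i j) = (\<Sum>j. \<Sum>i. f i j)"
proof -
  have "(\<Sum>i. \<Sum>j. f i j) = (\<integral>\<^sup>+i. (\<Sum>j. f i j) \<partial>count_space UNIV)"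
    by (simp add: nn_integral_count_space_nat)
  also have "\<dots> = (\<Sum>j. \<integral>\<^sup>+i. f i j \<partial>count_space UNIV)" by (rule nn_integral_suminf) simp
  finally show ?thesis by (simp add: nn_integral_count_space_nat)
qed

text \<open>The weights \<open>(1/2) ^ Suc i\<close> sum to one and keep the total mass finite; a
  lower bound for an integral against a single \<open>m i\<close> survives up to its weight.\<close>

lemma dominating_measure:
  fixes m :: "nat \<Rightarrow> 'b measure"
  assumes m: "\<And>i. sets (m i) = sets B" "\<And>i. emeasure (m i) (space B) \<le> 1"
  obtains N where "sets N = sets B" "emeasure N (space B) < \<infinity>"
    "\<And>i f. f \<in> borel_measurable B \<Longrightarrow>
      ennreal ((1/2) ^ Suc i) * (\<integral>\<^sup>+x. f x \<partial>m i) \<le> (\<integral>\<^sup>+x. f x \<partial>N)"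
proof -
  define \<mu> where "\<mu> X = (\<Sum>i. ennreal ((1/2) ^ Suc i) * emeasure (m i) X)" for X
  define N where "N = measure_of (space B) (sets B) \<mu>"
  have sets_N: "sets N = sets B" unfolding N_def by simp
  have em: "emeasure N X = \<mu> X" if "X \<in> sets B" for X
    unfolding N_def
  proof (rule emeasure_measure_of_sigma[OF sets.sigma_algebra_axioms _ _ that])
    show "positive (sets B) \<mu>" by (simp add: positive_def \<mu>_def)
    show "countably_additive (sets B) \<mu>"
    proof (rule countably_additiveI)
      fix X :: "nat \<Rightarrow> 'b set" assume X: "range X \<subseteq> sets B" "disjoint_family X"
      have "(\<Sum>j. \<mu> (X j)) = (\<Sum>i. \<Sum>j. ennreal ((1/2) ^ Suc i) * emeasure (m i) (X j))"
        unfolding \<mu>_def by (rule suminf_swap_ennreal)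
      also have "\<dots> = (\<Sum>i. ennreal ((1/2) ^ Suc i) * emeasure (m i) (\<Union>j. X j))"
        using X m(1) by (intro suminf_cong) (simp add: suminf_emeasure)
      finally show "(\<Sum>j. \<mu> (X j)) = \<mu> (\<Union>j. X j)" by (simp add: \<mu>_def)
    qed
  qed
  show thesis
  proof
    show "sets N = sets B" by (rule sets_N)
    have "emeasure N (space B) = \<mu> (space B)" by (simp add: em)
    also have "\<dots> \<le> (\<Sum>i. ennreal ((1/2) ^ Suc i) * 1)"
      unfolding \<mu>_def by (intro suminf_le mult_left_mono m) auto
    also have "\<dots> = ennreal 1"
      unfolding mult_1_right by (rule suminf_ennreal_eq[OF zero_le_power power_half_series]) simp
    finally show "emeasure N (space B) < \<infinity>" by (simp add: le_less_trans del: power_Suc)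
    fix i and f :: "'b \<Rightarrow> ennreal" assume f: "f \<in> borel_measurable B"
    have "emeasure (scale_measure (ennreal ((1/2) ^ Suc i)) (m i)) X \<le> emeasure N X" if "X \<in> sets B" for X
    proof -
      have "(\<Sum>k\<in>{i}. ennreal ((1/2) ^ Suc k) * emeasure (m k) X) \<le> \<mu> X"
        unfolding \<mu>_def by (rule sum_le_suminf) auto
      then show ?thesis by (simp add: em that)
    qed
    then have "scale_measure (ennreal ((1/2) ^ Suc i)) (m i) \<le> N"
      by (subst le_measure) (auto simp: sets_N m le_fun_def emeasure_notin_sets)
    then have "nn_integral (scale_measure (ennreal ((1/2) ^ Suc i)) (m i)) f \<le> nn_integral N f"
      by (intro nn_integral_mono_measure) (simp_all add: sets_N m)
    then show "ennreal ((1/2) ^ Suc i) * (\<integral>\<^sup>+x. f x \<partial>m i) \<le> (\<integral>\<^sup>+x. f x \<partial>N)"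
      using f by (simp add: nn_integral_scale_measure measurable_cong_sets[OF m(1) refl])
  qed
qed

context contractive_form
begin

definition Y :: "(nat \<Rightarrow> real) set" where
  "Y = K - {\<lambda>_. 0}"

text \<open>Uncountably many pairs \<open>f\<close>, \<open>c\<close> have to be served by countably
  many measures. These are indexed by a function from a countable dense set and two rationals; a
  general pair is handled by a nearby triple, at the cost of part of the distance.\<close>

lemma lower_semicontinuity_measure:
  obtains N :: "(nat \<Rightarrow> real) measure" where "sets N = sets borel" "emeasure N UNIV < \<infinity>"
    "\<And>U. open U \<Longrightarrow> U \<inter> Y \<noteq> {} \<Longrightarrow> 0 < emeasure N (U \<inter> Y)"
    "\<And>f c. f \<in> D \<Longrightarrow> c < e f \<Longrightarrow>
      \<exists>r>0. \<forall>h\<in>D. e h \<le> c \<longrightarrow> ennreal r \<le> (\<integral>\<^sup>+y. ennreal \<bar>hat f y - hat h y\<bar> \<partial>N)"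
proof -
  obtain T where T: "countable T" "T \<subseteq> Y" "Y \<subseteq> closure T" using separable by blast
  obtain Q where Q: "countable Q" "Q \<subseteq> A" "\<And>f r. f \<in> A \<Longrightarrow> 0 < r \<Longrightarrow> \<exists>h\<in>Q. \<forall>x. \<bar>f x - h x\<bar> < r"
    using countable_dense_subset by blast
  define I where "I = Q \<times> (UNIV :: rat set) \<times> (UNIV :: rat set)"
  have I: "countable I" unfolding I_def by (intro countable_SIGMA Q) auto
  \<comment> \<open>The hypotheses of \<open>separating_measure\<close> are premises inside
    \<open>good\<close>, so every triple has a good measure, if need be the null measure.\<close>
  define good where "good = (\<lambda>(f, c, r) (M :: (nat \<Rightarrow> real) measure).
    sets M = sets borel \<and> emeasure M UNIV \<le> 1 \<and>
    ((\<forall>h\<in>D. e h \<le> of_rat c \<longrightarrow> (\<exists>x. of_rat r \<le> \<bar>f x - h x\<bar>)) \<longrightarrow> f \<in> A \<longrightarrow>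
    (\<forall>h\<in>D. e h \<le> of_rat c \<longrightarrow> ennreal (of_rat r) \<le> (\<integral>\<^sup>+y. ennreal \<bar>hat f y - hat h y\<bar> \<partial>M))))"
  have "\<exists>M. good i M" for i
  proof -
    obtain f c r where i: "i = (f, c, r)" by (cases i)
    show ?thesis
    proof (cases "f \<in> A \<and> (\<forall>h\<in>D. e h \<le> of_rat c \<longrightarrow> (\<exists>x. of_rat r \<le> \<bar>f x - h x\<bar>))")
      case True
      then show ?thesis
        using separating_measure[of f "of_rat c" "of_rat r"] unfolding i good_def by auto
    next
      case False
      then show ?thesis
        unfolding i good_def by (auto intro!: exI[of _ "null_measure borel"])
    qed
  qed
  then obtain M where M: "\<And>i. good i (M i)" by metis
  \<comment> \<open>Even indices enumerate the separating measures, odd ones the point masses at a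
    dense sequence, which provide full support.\<close>
  define m where "m n = (if even n then M (from_nat_into I (n div 2)) 
    else distr (count_space {from_nat_into T (n div 2)}) borel (\<lambda>y. y))" for n :: nat
  have m: "sets (m n) = sets borel" "emeasure (m n) UNIV \<le> 1" for n
    using M[of "from_nat_into I (n div 2)"]
    by (auto simp: m_def good_def emeasure_distr emeasure_count_space split: prod.splits)
  obtain N where N: "sets N = sets borel" "emeasure N UNIV < \<infinity>"
    "\<And>i f. f \<in> borel_measurable borel \<Longrightarrow>
      ennreal ((1/2) ^ Suc i) * (\<integral>\<^sup>+x. f x \<partial>m i) \<le> (\<integral>\<^sup>+x. f x \<partial>N)"
    using dominating_measure[of m borel] m by auto
  have Y_borel: "Y \<in> sets borel" unfolding Y_def using closed_K by auto
  show thesis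
  proof
    fix U :: "(nat \<Rightarrow> real) set" assume U: "open U" "U \<inter> Y \<noteq> {}"
    then obtain y where y: "y \<in> T" "y \<in> U"
      using T(3) open_Int_closure_eq_empty[OF U(1), of T] by blast
    obtain n where n: "from_nat_into T n = y" using from_nat_into_surj[OF T(1) y(1)] by auto
    have UY: "U \<inter> Y \<in> sets borel" using U Y_borel by auto
    have "0 < ennreal ((1/2) ^ Suc (2 * n + 1)) * indicator (U \<inter> Y) y"
      using y T(2) by (auto simp: ennreal_zero_less_mult_iff)
    also have "indicator (U \<inter> Y) y = (\<integral>\<^sup>+x. indicator (U \<inter> Y) x \<partial>m (2 * n + 1))"
      using UY by (simp add: m_def n nn_integral_distr nn_integral_count_space_finite del: nn_integral_indicator)
    also have "ennreal ((1/2) ^ Suc (2 * n + 1)) * \<dots> \<le> (\<integral>\<^sup>+x. indicator (U \<inter> Y) x \<partial>N)"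
      using UY by (intro N(3)) simp
    also have "\<dots> = emeasure N (U \<inter> Y)" using UY N(1) by simp
    finally show "0 < emeasure N (U \<inter> Y)" .
  next
    fix f c assume f: "f \<in> D" and c: "c < e f"
    obtain c' where c': "c < of_rat c'" "of_rat c' < e f" using of_rat_dense[OF c] by auto
    obtain r0 where r0: "0 < r0" "\<And>h. h \<in> D \<Longrightarrow> e h \<le> of_rat c' \<Longrightarrow> \<exists>x. r0 \<le> \<bar>f x - h x\<bar>"
      using sublevel_distance[OF f c'(2)] by blast
    obtain q where q: "0 < (of_rat q :: real)" "of_rat q < r0 / 2"
      using of_rat_dense[of 0 "r0 / 2"] r0(1) by auto
    \<comment> \<open>As \<open>k\<close> is within \<open>r/2\<close> of \<open>f\<close> and
      \<open>2 * r < r0\<close>, it keeps a distance of at least \<open>r0 - r/2 > r\<close> from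
      the sublevel set.\<close>
    define r where "r = (of_rat q :: real)"
    have r: "0 < r" "2 * r < r0" using q by (auto simp: r_def)
    obtain k where k: "k \<in> Q" "\<And>x. \<bar>f x - k x\<bar> < r / 2" using Q(3)[OF D_in_A[OF f], of "r / 2"] r by auto
    have kA: "k \<in> A" using k Q by auto
    have "(k, c', q) \<in> I" using k by (simp add: I_def)
    then obtain n where n: "from_nat_into I n = (k, c', q)" using from_nat_into_surj[OF I] by blast
    have mn: "m (2 * n) = M (k, c', q)" by (simp add: m_def n)
    have far: "\<exists>x. r \<le> \<bar>k x - h x\<bar>" if h: "h \<in> D" "e h \<le> of_rat c'" for h
    proof -
      obtain x where "r0 \<le> \<bar>f x - h x\<bar>" using r0(2)[OF h] by auto
      then have "r \<le> \<bar>k x - h x\<bar>" using k(2)[of x] r by linarith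
      then show ?thesis ..
    qed
    let ?w = "ennreal ((1/2) ^ Suc (2 * n))"
    \<comment> \<open>Replacing \<open>k\<close> by \<open>f\<close> under the integral costs
      \<open>r/2\<close>, because \<open>m (2 * n)\<close> has mass at most one. The remaining
      \<open>r/2\<close> is multiplied by the weight of that measure in \<open>N\<close>.\<close>
    have "ennreal ((1/2) ^ Suc (2 * n) * (r / 2)) \<le> (\<integral>\<^sup>+y. ennreal \<bar>hat f y - hat h y\<bar> \<partial>N)"
      if h: "h \<in> D" "e h \<le> c" for h
    proof -
      have hA: "h \<in> A" by (rule D_in_A[OF h(1)])
      have meas: "(\<lambda>y. ennreal \<bar>hat f y - hat h y\<bar>) \<in> borel_measurable borel"
      proof -
        note [measurable] = hat_measurable[OF D_in_A[OF f]] hat_measurable[OF hA]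
        show ?thesis by measurable
      qed
      have [measurable]: "hat f \<in> borel_measurable (m (2 * n))" "hat h \<in> borel_measurable (m (2 * n))"
        using hat_measurable[OF D_in_A[OF f]] hat_measurable[OF hA] by (simp_all add: measurable_cong_sets[OF m(1) refl])
      have "ennreal (r / 2) + ennreal (r / 2) = ennreal r" using r by (simp flip: ennreal_plus)
      also have "ennreal r \<le> (\<integral>\<^sup>+y. ennreal \<bar>hat k y - hat h y\<bar> \<partial>m (2 * n))"
        using M[of "(k, c', q)"] far kA h c' unfolding mn good_def r_def by auto
      also have "\<dots> \<le> (\<integral>\<^sup>+y. ennreal \<bar>hat f y - hat h y\<bar> + ennreal (r / 2) \<partial>m (2 * n))"
      proof (rule nn_integral_mono)
        fix y
        have "\<bar>hat (\<lambda>x. f x - k x) y\<bar> \<le> r / 2"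
          using k(2) by (intro hat_bound A_closed D_in_A f kA) (auto simp: less_imp_le)
        then have "\<bar>hat k y - hat h y\<bar> \<le> \<bar>hat f y - hat h y\<bar> + r / 2"
          unfolding hat_diff[OF D_in_A[OF f] kA] by linarith
        then show "ennreal \<bar>hat k y - hat h y\<bar> \<le> ennreal \<bar>hat f y - hat h y\<bar> + ennreal (r / 2)"
          using r by (simp add: ennreal_leI flip: ennreal_plus)
      qed
      also have "\<dots> = (\<integral>\<^sup>+y. ennreal \<bar>hat f y - hat h y\<bar> \<partial>m (2 * n)) + ennreal (r / 2) * emeasure (m (2 * n)) (space (m (2 * n)))"
        by (subst nn_integral_add) auto
      also have "\<dots> \<le> (\<integral>\<^sup>+y. ennreal \<bar>hat f y - hat h y\<bar> \<partial>m (2 * n)) + ennreal (r / 2) * 1"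
        using m[of "2 * n"] sets_eq_imp_space_eq[OF m(1)[of "2 * n"]] by (intro add_left_mono mult_left_mono) auto
      finally have "ennreal (r / 2) \<le> (\<integral>\<^sup>+y. ennreal \<bar>hat f y - hat h y\<bar> \<partial>m (2 * n))"
        by simp
      then have "?w * ennreal (r / 2) \<le> ?w * (\<integral>\<^sup>+y. ennreal \<bar>hat f y - hat h y\<bar> \<partial>m (2 * n))"
        by (rule mult_left_mono) simp
      also have "\<dots> \<le> (\<integral>\<^sup>+y. ennreal \<bar>hat f y - hat h y\<bar> \<partial>N)" by (rule N(3)[OF meas])
      finally have "?w * ennreal (r / 2) \<le> (\<integral>\<^sup>+y. ennreal \<bar>hat f y - hat h y\<bar> \<partial>N)" .
      moreover have "ennreal ((1/2) ^ Suc (2 * n) * (r / 2)) = ?w * ennreal (r / 2)"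
        using r by (intro ennreal_mult) auto
      ultimately show ?thesis by (simp only:)
    qed
    then show "\<exists>r>0. \<forall>h\<in>D. e h \<le> c \<longrightarrow> ennreal r \<le> (\<integral>\<^sup>+y. ennreal \<bar>hat f y - hat h y\<bar> \<partial>N)"
      using r by (intro exI[of _ "(1/2) ^ Suc (2 * n) * (r / 2)"]) auto
  qed (use N in auto)
qed

end

section \<open>The regular Dirichlet form on the spectrum\<close>

text \<open>For functions with a common bound, \<open>L^1\<close> distance controls
  \<open>L^2\<close> distance. So indicators, and then all integrable functions, are approximated in
  \<open>L^1\<close>; a square-integrable function is first truncated, and clamping its
  \<open>L^1\<close> approximant to the same level brings it no further away.\<close>

lemma (in finite_measure) L2_denseI:
  assumes sq: "B \<subseteq> square_integrable M"
    and add: "\<And>f h. f \<in> B \<Longrightarrow> h \<in> B \<Longrightarrow> (\<lambda>x. f x + h x) \<in> B"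
    and scale: "\<And>c f. f \<in> B \<Longrightarrow> (\<lambda>x. c * f x) \<in> B"
    and clamp: "\<And>c f. 0 < c \<Longrightarrow> f \<in> B \<Longrightarrow> (\<lambda>x. max (- c) (min (f x) c)) \<in> B"
    and sets: "\<And>X d. X \<in> sets M \<Longrightarrow> 0 < d \<Longrightarrow> \<exists>b\<in>B. (\<integral>x. \<bar>indicator X x - b x\<bar> \<partial>M) < d"
  shows "L2_dense M B"
proof -
  have B_int: "integrable M b" if "b \<in> B" for b
    using integral_abs_le_weighted(1)[of b 1] square_integrableD(1)[of b M] sq that
    by (auto simp: integrable_abs_iff)
  have L1: "\<exists>b\<in>B. (\<integral>x. \<bar>f x - b x\<bar> \<partial>M) < d" if "integrable M f" "0 < d" for f :: "'a \<Rightarrow> real" and d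
    using that
  proof (induction f arbitrary: d rule: integrable_induct)
    case (base X c)
    show ?case
    proof (cases "c = 0")
      case True
      obtain b where "b \<in> B" using sets[of "{}" 1] by auto
      then have "(\<lambda>x. 0 * b x) \<in> B" by (rule scale)
      then show ?thesis using True base by (intro bexI[of _ "\<lambda>x. 0 * b x"]) auto
    next
      case False
      then obtain b where b: "b \<in> B" "(\<integral>x. \<bar>indicator X x - b x\<bar> \<partial>M) < d / \<bar>c\<bar>"
        using sets[OF base(1), of "d / \<bar>c\<bar>"] base(3) by auto
      have "(\<integral>x. \<bar>indicator X x *\<^sub>R c - c * b x\<bar> \<partial>M) = (\<integral>x. \<bar>c\<bar> * \<bar>indicator X x - b x\<bar> \<partial>M)"
        by (intro Bochner_Integration.integral_cong) (auto simp: abs_mult[symmetric] algebra_simps)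
      also have "\<dots> = \<bar>c\<bar> * (\<integral>x. \<bar>indicator X x - b x\<bar> \<partial>M)" by simp
      also have "\<dots> < d" using b(2) False by (simp add: field_simps)
      finally show ?thesis by (intro bexI[OF _ scale[OF b(1)]])
    qed
  next
    case (add f h)
    obtain a b where a: "a \<in> B" "(\<integral>x. \<bar>f x - a x\<bar> \<partial>M) < d/2" and b: "b \<in> B" "(\<integral>x. \<bar>h x - b x\<bar> \<partial>M) < d/2"
      using add.IH(1)[of "d/2"] add.IH(2)[of "d/2"] add.prems by auto
    have int: "integrable M (\<lambda>x. \<bar>f x - a x\<bar>)" "integrable M (\<lambda>x. \<bar>h x - b x\<bar>)"
      using add.hyps B_int[OF a(1)] B_int[OF b(1)] by auto
    have "(\<integral>x. \<bar>(f x + h x) - (a x + b x)\<bar> \<partial>M) \<le> (\<integral>x. \<bar>f x - a x\<bar> + \<bar>h x - b x\<bar> \<partial>M)"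
      using add.hyps B_int[OF a(1)] B_int[OF b(1)] by (intro integral_mono) auto
    also have "\<dots> < d" using int a b by simp
    finally show ?case by (intro bexI[OF _ assms(2)[OF a(1) b(1)]])
  next
    case (lim f s)
    have "(\<lambda>i. \<integral>x. \<bar>s i x - f x\<bar> \<partial>M) \<longlonglongrightarrow> (\<integral>x. 0 \<partial>M)"
    \<comment> \<open>\<open>integrable_induct\<close> supplies \<open>|s i| <= 2 |f|\<close>,
      whence the factor 3.\<close>
    proof (rule integral_dominated_convergence[where w = "\<lambda>x. 3 * \<bar>f x\<bar>"])
      show "AE x in M. (\<lambda>i. \<bar>s i x - f x\<bar>) \<longlonglongrightarrow> 0"
        using lim.hyps(2) by (intro AE_I2 tendsto_rabs_zero) (simp add: LIM_zero)
      show "AE x in M. norm \<bar>s i x - f x\<bar> \<le> 3 * \<bar>f x\<bar>" for i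
        using lim.hyps(3)[of _ i] by (intro AE_I2) (simp, smt (verit))
    qed (use lim.hyps in auto)
    then obtain i where i: "(\<integral>x. \<bar>s i x - f x\<bar> \<partial>M) < d/2"
      using LIMSEQ_D[of _ 0 "d/2"] lim.prems by fastforce
    obtain b where b: "b \<in> B" "(\<integral>x. \<bar>s i x - b x\<bar> \<partial>M) < d/2" using lim.IH[of "d/2" i] lim.prems by auto
    have "(\<integral>x. \<bar>f x - b x\<bar> \<partial>M) \<le> (\<integral>x. \<bar>s i x - f x\<bar> + \<bar>s i x - b x\<bar> \<partial>M)"
      using lim.hyps B_int[OF b(1)] by (intro integral_mono) auto
    also have "\<dots> < d" using i b lim.hyps B_int[OF b(1)] by simp
    finally show ?case using b(1) by blast
  qed
  show ?thesis
    unfolding L2_dense_def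
  proof (intro ballI allI impI)
    fix u and d :: real assume u: "u \<in> square_integrable M" and d: "0 < d"
    note [measurable] = square_integrableD(1)[OF u]
    define k where "k n s = max (- real (Suc n)) (min s (real (Suc n)))" for n s
    have "(\<lambda>n. \<integral>x. (u x - k n (u x))\<^sup>2 \<partial>M) \<longlonglongrightarrow> (\<integral>x. 0 \<partial>M)"
    proof (rule integral_dominated_convergence[where w = "\<lambda>x. (u x)\<^sup>2"])
      show "AE x in M. (\<lambda>n. (u x - k n (u x))\<^sup>2) \<longlonglongrightarrow> 0"
      proof (intro AE_I2 tendsto_eventually)
        fix x
        obtain N where "\<bar>u x\<bar> \<le> real N" using real_arch_simple by blast
        then show "\<forall>\<^sub>F n in sequentially. (u x - k n (u x))\<^sup>2 = 0"
          by (intro eventually_sequentiallyI[of N]) (auto simp: k_def)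
      qed
      have "\<bar>s - k n s\<bar> \<le> \<bar>s\<bar>" for n s by (auto simp: k_def)
      then have "(s - k n s)\<^sup>2 \<le> s\<^sup>2" for n s by (simp add: abs_le_square_iff)
      then show "AE x in M. norm ((u x - k n (u x))\<^sup>2) \<le> (u x)\<^sup>2" for n by simp
      show "(\<lambda>x. (u x - k n (u x))\<^sup>2) \<in> borel_measurable M" for n unfolding k_def by measurable
    qed (use square_integrableD[OF u] in auto)
    moreover have "0 < (d/2)\<^sup>2" using d by simp
    ultimately obtain n where n: "(\<integral>x. (u x - k n (u x))\<^sup>2 \<partial>M) < (d/2)\<^sup>2"
      using LIMSEQ_D[of _ 0 "(d/2)\<^sup>2"] by fastforce
    define v where "v x = k n (u x)" for x
    have v_meas [measurable]: "v \<in> borel_measurable M" unfolding v_def k_def by measurable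
    have v_le: "\<bar>v x\<bar> \<le> real (Suc n)" for x by (auto simp: v_def k_def)
    have v: "v \<in> square_integrable M" by (rule square_integrable_bounded[OF v_meas v_le])
    \<comment> \<open>Chosen so that the factor \<open>2 (n + 1)\<close> in the estimate of the
      square turns \<open>t\<close> into \<open>(d/2)^2\<close>.\<close>
    define t where "t = d\<^sup>2 / (8 * real (Suc n))"
    have t: "0 < t" "2 * real (Suc n) * t = (d/2)\<^sup>2" using d by (auto simp: t_def power2_eq_square field_simps)
    have v_int: "integrable M v"
      using integral_abs_le_weighted(1)[OF v, of 1] by (simp add: integrable_abs_iff)
    obtain b where b: "b \<in> B" "(\<integral>x. \<bar>v x - b x\<bar> \<partial>M) < t" using L1[OF v_int t(1)] by auto
    define w where "w x = k n (b x)" for x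
    have w: "w \<in> B" unfolding w_def k_def by (rule clamp[OF _ b(1)]) simp
    have [measurable]: "w \<in> borel_measurable M" "b \<in> borel_measurable M"
      using w b sq square_integrableD(1) by auto
    have le: "(v x - w x)\<^sup>2 \<le> 2 * real (Suc n) * \<bar>v x - b x\<bar>" for x
    proof -
      have 1: "\<bar>v x - w x\<bar> \<le> \<bar>v x - b x\<bar>" using v_le[of x] by (auto simp: w_def k_def)
      have 2: "\<bar>v x - w x\<bar> \<le> 2 * real (Suc n)" using v_le[of x] by (auto simp: w_def k_def)
      have "(v x - w x)\<^sup>2 = \<bar>v x - w x\<bar> * \<bar>v x - w x\<bar>" by (simp add: power2_eq_square)
      also have "\<dots> \<le> 2 * real (Suc n) * \<bar>v x - b x\<bar>" by (intro mult_mono 1 2) auto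
      finally show ?thesis .
    qed
    have vw: "(\<lambda>x. v x - w x) \<in> square_integrable M" using v w sq by (intro square_integrable_diff) auto
    have "(\<integral>x. (v x - w x)\<^sup>2 \<partial>M) \<le> (\<integral>x. 2 * real (Suc n) * \<bar>v x - b x\<bar> \<partial>M)"
      using v_int B_int[OF b(1)] by (intro integral_mono le square_integrableD(2)[OF vw]) auto
    also have "\<dots> = 2 * real (Suc n) * (\<integral>x. \<bar>v x - b x\<bar> \<partial>M)" by simp
    also have "\<dots> < 2 * real (Suc n) * t" using b(2) by (intro mult_strict_left_mono) auto
    finally have "(L2_dist M v w)\<^sup>2 < (d/2)\<^sup>2" unfolding t(2) L2_norm_power2 .
    then have 1: "L2_dist M v w < d/2" by (rule power2_less_imp_less) (use d in simp)
    have "(L2_dist M u v)\<^sup>2 < (d/2)\<^sup>2" using n by (simp add: L2_norm_power2 v_def)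
    then have 2: "L2_dist M u v < d/2" by (rule power2_less_imp_less) (use d in simp)
    have "L2_dist M u w \<le> L2_dist M u v + L2_dist M v w"
      using w sq by (intro L2_norm_triangle_diff u v) auto
    then have "L2_dist M u w < d" using 1 2 by linarith
    with w show "\<exists>g\<in>B. L2_dist M u g < d" by blast
  qed
qed

section \<open>The space \<open>Y\<close> and the functions with compact support in it\<close>

context contractive_form
begin

lemma Y_subset: "Y \<subseteq> K" and zero_notin_Y: "(\<lambda>_. 0) \<notin> Y"
  by (auto simp: Y_def)

lemma Y_borel: "Y \<in> sets borel"
  unfolding Y_def using closed_K by auto

lemma locally_compact_Y: "locally_compact_space (top_of_set Y)"
proof -
  have "locally_compact_space (subtopology (top_of_set K) Y)"
  proof (rule locally_compact_space_open_subset)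
    show "Hausdorff_space (top_of_set K) \<or> regular_space (top_of_set K)"
      by (simp add: Hausdorff_space_subtopology)
    show "locally_compact_space (top_of_set K)"
      using compact_K by (intro compact_imp_locally_compact_space) (simp add: compact_space_subtopology)
    show "openin (top_of_set K) Y"
      unfolding openin_open by (intro exI[of _ "- {\<lambda>_. 0}"]) (auto simp: Y_def)
  qed
  then show ?thesis using Y_subset by (simp add: subtopology_subtopology Int_absorb1)
qed

lemma separable_Y: "separable_space (top_of_set Y)"
proof -
  obtain T where T: "countable T" "T \<subseteq> Y" "Y \<subseteq> closure T" using separable by blast
  then show ?thesis
    unfolding separable_space_def
    by (intro exI[of _ T]) (auto simp: closure_of_subtopology Int_absorb1)
qed

lemma hat_in_continuous_functions: "f \<in> A \<Longrightarrow> hat f \<in> continuous_functions (top_of_set Y)"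
  using continuous_on_subset[OF continuous_hat Y_subset] hat_zero hat_outside
  by (auto simp: continuous_functions_def Y_def)

lemma hat_in_Cc_iff:
  assumes f: "f \<in> A"
  shows "hat f \<in> Cc (top_of_set Y) \<longleftrightarrow> (\<exists>L. compact L \<and> L \<subseteq> Y \<and> (\<forall>y. y \<notin> L \<longrightarrow> hat f y = 0))"
proof
  assume "hat f \<in> Cc (top_of_set Y)"
  then have "compactin (top_of_set Y) (top_of_set Y closure_of {y \<in> Y. hat f y \<noteq> 0})"
    by (simp add: Cc_def)
  moreover have "{y \<in> Y. hat f y \<noteq> 0} \<subseteq> top_of_set Y closure_of {y \<in> Y. hat f y \<noteq> 0}"
    by (rule closure_of_subset) auto
  moreover have "hat f y = 0" if "y \<notin> Y" for y
    using hat_in_continuous_functions[OF f] that by (auto simp: continuous_functions_def)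
  ultimately show "\<exists>L. compact L \<and> L \<subseteq> Y \<and> (\<forall>y. y \<notin> L \<longrightarrow> hat f y = 0)"
    by (intro exI[of _ "top_of_set Y closure_of {y \<in> Y. hat f y \<noteq> 0}"]) (auto simp: compactin_subtopology)
next
  assume "\<exists>L. compact L \<and> L \<subseteq> Y \<and> (\<forall>y. y \<notin> L \<longrightarrow> hat f y = 0)"
  then obtain L where L: "compact L" "L \<subseteq> Y" "\<And>y. y \<notin> L \<Longrightarrow> hat f y = 0" by auto
  have "{y \<in> Y. hat f y \<noteq> 0} \<subseteq> L" using L(3) by blast
  then have "top_of_set Y closure_of {y \<in> Y. hat f y \<noteq> 0} \<subseteq> L"
    by (rule closure_of_minimal) (rule closed_subset[OF L(2) compact_imp_closed[OF L(1)]])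
  moreover have "compactin (top_of_set Y) L" using L(1,2) by (simp add: compactin_subtopology)
  ultimately have "compactin (top_of_set Y) (top_of_set Y closure_of {y \<in> Y. hat f y \<noteq> 0})"
    using closed_compactin closedin_closure_of by blast
  then show "hat f \<in> Cc (top_of_set Y)"
    using hat_in_continuous_functions[OF f] by (simp add: Cc_def)
qed

text \<open>The compact support misses a ball around the origin, so extension by zero is continuous
  there. The gluing is over two closed sets, one off the open ball of half the radius and one inside
  its closed counterpart.\<close>

lemma Cc_imp_hat:
  assumes u: "u \<in> Cc (top_of_set Y)"
  obtains f where "f \<in> A" "u = hat f"
proof -
  define L where "L = top_of_set Y closure_of {y \<in> Y. u y \<noteq> 0}"
  have L: "compact L" "L \<subseteq> Y" using u by (auto simp: Cc_def L_def compactin_subtopology)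
  have out: "u y = 0" if "y \<notin> Y" for y using u that by (auto simp: Cc_def continuous_functions_def)
  have u0: "u y = 0" if "y \<notin> L" for y
    using closure_of_subset[of "{y \<in> Y. u y \<noteq> 0}" "top_of_set Y"] that out[of y] unfolding L_def by auto
  have cY: "continuous_on Y u" using u by (auto simp: Cc_def continuous_functions_def)
  have "closed L" by (rule compact_imp_closed[OF L(1)])
  then obtain d where d: "0 < d" "ball (\<lambda>_. 0) d \<subseteq> - L"
    using L(2) zero_notin_Y open_contains_ball[of "- L"] by (metis ComplI open_Compl subsetD)
  let ?S = "K - ball (\<lambda>_. 0) (d/2)" and ?T = "K \<inter> cball (\<lambda>_. 0) (d/2)"
  have "continuous_on (?S \<union> ?T) u"
  proof (rule continuous_on_closed_Un)
    show "closed ?S" "closed ?T" using closed_K by (auto intro: closed_Diff)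
    show "continuous_on ?S u" by (rule continuous_on_subset[OF cY]) (use d in \<open>auto simp: Y_def\<close>)
    have "u y = 0" if "y \<in> ?T" for y
      using that d by (intro u0) (auto simp: subset_iff)
    then show "continuous_on ?T u" using continuous_on_cong[of ?T ?T u "\<lambda>_. 0"] by auto
  qed
  moreover have "?S \<union> ?T = K" by auto
  ultimately have cK: "continuous_on K u" by simp
  have "u (\<lambda>_. 0) = 0" "\<And>y. y \<notin> K \<Longrightarrow> u y = 0" using out zero_notin_Y Y_subset by blast+
  from hat_unique[OF cK this refl] show thesis using that by metis
qed

definition D0 :: "('a \<Rightarrow> real) set" where
  "D0 = {f \<in> D. hat f \<in> Cc (top_of_set Y)}"

lemma D0_iff: "f \<in> D0 \<longleftrightarrow> f \<in> D \<and> (\<exists>L. compact L \<and> L \<subseteq> Y \<and> (\<forall>y. y \<notin> L \<longrightarrow> hat f y = 0))"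
  unfolding D0_def using hat_in_Cc_iff D_in_A by auto

lemma D0_in_D: "f \<in> D0 \<Longrightarrow> f \<in> D" and D0_in_A: "f \<in> D0 \<Longrightarrow> f \<in> A"
  by (auto simp: D0_def D_in_A)

lemma D0_zero: "(\<lambda>x. 0) \<in> D0"
  using hat_cmult[OF A_closed(1), of 0] zero_in_D by (auto simp: D0_iff intro!: exI[of _ "{}"])

lemma D0_add: assumes f: "f \<in> D0" and h: "h \<in> D0" shows "(\<lambda>x. f x + h x) \<in> D0"
proof -
  obtain L L' where L: "compact L" "L \<subseteq> Y" "\<And>y. y \<notin> L \<Longrightarrow> hat f y = 0"
    and L': "compact L'" "L' \<subseteq> Y" "\<And>y. y \<notin> L' \<Longrightarrow> hat h y = 0" using f h by (auto simp: D0_iff)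
  have "hat (\<lambda>x. f x + h x) y = 0" if "y \<notin> L \<union> L'" for y
    unfolding hat_add[OF D0_in_A[OF f] D0_in_A[OF h]] using L(3)[of y] L'(3)[of y] that by simp
  moreover have "compact (L \<union> L')" "L \<union> L' \<subseteq> Y" using L L' by (auto intro: compact_Un)
  ultimately show ?thesis
    unfolding D0_iff using D_add[OF D0_in_D[OF f] D0_in_D[OF h]] by blast
qed

lemma D0_cmult: "f \<in> D0 \<Longrightarrow> (\<lambda>x. c * f x) \<in> D0"
  using hat_cmult[OF D0_in_A, of f c] D_cmult[OF D0_in_D, of f c] unfolding D0_iff[of "\<lambda>x. c * f x"]
  by (auto simp: D0_iff[of f])

lemma D0_contraction:
  fixes F :: "real \<Rightarrow> real"
  assumes f: "f \<in> D0" and F: "F 0 = 0" "\<And>s t. \<bar>F s - F t\<bar> \<le> \<bar>s - t\<bar>"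
  shows "(\<lambda>x. F (f x)) \<in> D0"
proof -
  obtain L where L: "compact L" "L \<subseteq> Y" "\<And>y. y \<notin> L \<Longrightarrow> hat f y = 0" using f by (auto simp: D0_iff)
  note c = contraction_in_D[OF D0_in_D[OF f] F]
  have "hat (\<lambda>x. F (f x)) y = 0" if "y \<notin> L" for y
    unfolding c(3) L(3)[OF that] by (rule F(1))
  with c(1) L(1,2) show ?thesis unfolding D0_iff by blast
qed

text \<open>Subtracting the clamp is a contraction that sends \<open>[-r, r]\<close> to 0. The
  result is supported in the compact set where \<open>|hat f| >= r\<close>, which avoids the origin
  because \<open>hat f\<close> vanishes there.\<close>

lemma truncate_in_D0:
  assumes f: "f \<in> D" and r: "0 < r"
  defines "F \<equiv> \<lambda>s. s - max (- r) (min s r)"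
  shows "(\<lambda>x. F (f x)) \<in> D0" "e (\<lambda>x. F (f x)) \<le> e f" "\<bar>hat f y - hat (\<lambda>x. F (f x)) y\<bar> \<le> r"
proof -
  have F: "F 0 = 0" "\<bar>F s - F t\<bar> \<le> \<bar>s - t\<bar>" for s t using r by (auto simp: F_def)
  note c = contraction_in_D[where F = F, OF f F]
  show "e (\<lambda>x. F (f x)) \<le> e f" by (rule c)
  show "\<bar>hat f y - hat (\<lambda>x. F (f x)) y\<bar> \<le> r" using r unfolding c by (auto simp: F_def)
  let ?L = "K \<inter> {y. r \<le> \<bar>hat f y\<bar>}"
  have "closed {y \<in> K. r \<le> \<bar>hat f y\<bar>}"
    by (rule continuous_on_closed_Collect_le) (auto intro!: continuous_intros continuous_hat D_in_A f closed_K)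
  then have "closed ?L" by (simp add: Collect_conj_eq)
  then have "compact (K \<inter> ?L)" by (rule compact_Int_closed[OF compact_K])
  then have "compact ?L" by simp
  moreover have "?L \<subseteq> Y" using hat_zero[OF D_in_A[OF f]] r by (auto simp: Y_def)
  moreover have "hat (\<lambda>x. F (f x)) y = 0" if "y \<notin> ?L" for y
  proof -
    have "F (hat f y) = 0" using that r by (cases "y \<in> K") (auto simp: hat_outside F_def)
    then show ?thesis unfolding c(3) .
  qed
  ultimately show "(\<lambda>x. F (f x)) \<in> D0" using c(1) unfolding D0_iff by blast
qed

text \<open>The generators have finite energy, so \<open>subalgebra_dense\<close> applies to the
  algebra \<open>D\<close>. Its approximant is then truncated; the errors \<open>r/2\<close> and
  \<open>r/4\<close> leave room for strictness.\<close>

lemma D0_sup_dense: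
  assumes f: "f \<in> A" and r: "0 < r"
  obtains k where "k \<in> D0" "\<And>y. \<bar>hat f y - hat k y\<bar> < r"
proof -
  have gD: "range g \<subseteq> D" using g_in_D by auto
  obtain h where h: "continuous_on K h" "h (\<lambda>_. 0) = 0" "(\<lambda>x. h (emb x)) \<in> D"
    "\<And>y. y \<in> K \<Longrightarrow> \<bar>hat f y - h y\<bar> < r / 2"
    using subalgebra_dense[OF algebra_D gD continuous_hat[OF f] hat_zero[OF f], of "r / 2"] r by auto
  let ?k = "\<lambda>x. h (emb x) - max (- (r/4)) (min (h (emb x)) (r/4))"
  have close: "\<bar>hat f y - hat (\<lambda>x. h (emb x)) y\<bar> \<le> r / 2" for y
  proof -
    have "\<bar>hat (\<lambda>x. f x - h (emb x)) y\<bar> \<le> r / 2"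
      using h(4)[OF emb_in_K] r
      by (intro hat_bound A_closed(5) f D_in_A[OF h(3)]) (auto simp: hat_emb[OF f] intro!: less_imp_le)
    then show ?thesis using hat_diff[OF f D_in_A[OF h(3)]] by simp
  qed
  show thesis
  proof
    show "?k \<in> D0" using truncate_in_D0(1)[OF h(3), of "r/4"] r by simp
    show "\<bar>hat f y - hat ?k y\<bar> < r" for y
      using close[of y] truncate_in_D0(3)[OF h(3), of "r/4" y] r by linarith
  qed
qed

text \<open>The hypothesis on \<open>n\<close> makes the bump vanish at the origin, so that it comes
  from a function in \<open>A\<close>.\<close>

lemma compact_bump:
  assumes L: "compact L" "L \<subseteq> Y" "L \<noteq> {}" and n: "1 \<le> real n * infdist (\<lambda>_. 0) L"
  shows "\<exists>f\<in>A. \<forall>y\<in>K. hat f y = max 0 (1 - real n * infdist y L)"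
proof -
  define h where "h y = (if y \<in> K then max 0 (1 - real n * infdist y L) else 0)" for y
  have "continuous_on K (\<lambda>y. max 0 (1 - real n * infdist y L))" by (intro continuous_intros)
  then have "continuous_on K h" by (simp add: h_def cong: continuous_on_cong)
  from hat_unique[OF this _ _ refl] show ?thesis
    using n by (intro bexI[of _ "\<lambda>x. h (emb x)"]) (auto simp: h_def)
qed

end

section \<open>The relaxed form over the measure restricted to \<open>Y\<close>\<close>

locale contractive_form_measure = contractive_form A g E
  for A :: "('a \<Rightarrow> real) set" and g E +
  fixes N :: "(nat \<Rightarrow> real) measure"
  assumes sets_N: "sets N = sets borel" and finite_N: "emeasure N UNIV < \<infinity>"
    and positive_N: "\<And>U. open U \<Longrightarrow> U \<inter> Y \<noteq> {} \<Longrightarrow> 0 < emeasure N (U \<inter> Y)"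
    and lsc_N: "\<And>f c. f \<in> D \<Longrightarrow> c < e f \<Longrightarrow>
      \<exists>r>0. \<forall>h\<in>D. e h \<le> c \<longrightarrow> ennreal r \<le> (\<integral>\<^sup>+y. ennreal \<bar>hat f y - hat h y\<bar> \<partial>N)"
begin

definition M :: "(nat \<Rightarrow> real) measure" where
  "M = restrict_space N Y"

lemma space_N: "space N = UNIV"
  using sets_eq_imp_space_eq[OF sets_N] by simp

lemma space_M: "space M = Y"
  by (simp add: M_def space_restrict_space space_N)

lemma Y_in_sets_N: "Y \<inter> space N \<in> sets N"
  using Y_borel by (simp add: sets_N space_N)

lemma sets_M_iff: "X \<in> sets M \<longleftrightarrow> X \<in> sets borel \<and> X \<subseteq> Y"
  using Y_in_sets_N unfolding M_def by (subst sets_restrict_space_iff) (auto simp: sets_N)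

lemma emeasure_M: "X \<subseteq> Y \<Longrightarrow> emeasure M X = emeasure N X"
  unfolding M_def by (rule emeasure_restrict_space[OF Y_in_sets_N])

sublocale finite_measure M
proof
  have "emeasure M (space M) \<le> emeasure N UNIV"
    unfolding space_M using emeasure_M[of Y] by (simp add: emeasure_mono sets_N)
  then show "emeasure M (space M) \<noteq> \<infinity>" using finite_N by auto
qed

text \<open>Finite Borel measures on the Polish space \<open>nat => real\<close> are inner regular,
  and compactness of a subset of \<open>Y\<close> means the same in \<open>Y\<close> and in the
  ambient space.\<close>

lemma radon_M: "radon_measure (top_of_set Y) M"
  unfolding radon_measure_def
proof (intro conjI allI impI ballI)
  show "space M = topspace (top_of_set Y)" by (simp add: space_M)
  have "{U. openin (top_of_set Y) U} = (\<inter>) Y ` {S. open S}" by (auto simp: openin_open)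
  moreover have "Y \<in> sigma_sets UNIV {S. open S}" using Y_borel by (simp add: borel_def)
  ultimately have "sigma_sets Y {U. openin (top_of_set Y) U} = (\<inter>) Y ` sigma_sets UNIV {S. open S}"
    by (simp add: sigma_sets_Int)
  moreover have "sets borel = sigma_sets UNIV {S :: (nat \<Rightarrow> real) set. open S}" by (simp add: borel_def)
  ultimately show "sets M = sets (sigma (topspace (top_of_set Y)) {U. openin (top_of_set Y) U})"
    by (subst sets_measure_of) (auto simp: M_def sets_restrict_space sets_N dest: openin_subset)
  show "emeasure M L < \<infinity>" for L by (simp add: emeasure_eq_measure)
  fix X assume X: "X \<in> sets M"
  have "emeasure M X = emeasure N X" using X by (simp add: sets_M_iff emeasure_M)
  also have "\<dots> = (SUP L\<in>{L. L \<subseteq> X \<and> compact L}. emeasure N L)"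
    using X finite_N by (intro inner_regular) (auto simp: sets_N space_N sets_M_iff)
  also have "{L. L \<subseteq> X \<and> compact L} = {L. compactin (top_of_set Y) L \<and> L \<subseteq> X}"
    using X by (auto simp: compactin_subtopology sets_M_iff)
  also have "(SUP L\<in>{L. compactin (top_of_set Y) L \<and> L \<subseteq> X}. emeasure N L)
      = (SUP L\<in>{L. compactin (top_of_set Y) L \<and> L \<subseteq> X}. emeasure M L)"
    by (intro SUP_cong) (auto simp: compactin_subtopology emeasure_M)
  finally show "emeasure M X = (SUP L\<in>{L. compactin (top_of_set Y) L \<and> L \<subseteq> X}. emeasure M L)" .
qed

lemma full_support_M: "full_support (top_of_set Y) M"
  unfolding full_support_def
proof (intro allI impI, elim conjE)
  fix U assume "openin (top_of_set Y) U" "U \<noteq> {}"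
  then obtain V where "open V" "U = V \<inter> Y" by (auto simp: openin_open)
  then show "0 < emeasure M U" using positive_N[of V] \<open>U \<noteq> {}\<close> by (simp add: emeasure_M)
qed

lemma hat_measurable_M: "f \<in> A \<Longrightarrow> hat f \<in> borel_measurable M"
  unfolding M_def using hat_measurable
  by (intro measurable_restrict_space1) (simp add: measurable_cong_sets[OF sets_N refl])

lemma hat_square_integrable: "f \<in> A \<Longrightarrow> hat f \<in> square_integrable M"
proof -
  assume f: "f \<in> A"
  obtain b where "\<And>x. \<bar>f x\<bar> \<le> b" using bounded_A[OF f] by (auto simp: bounded_iff)
  then show ?thesis using hat_bound[OF f] by (intro square_integrable_bounded[of _ b] hat_measurable_M f) auto
qed

definition B :: "((nat \<Rightarrow> real) \<Rightarrow> real) set" where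
  "B = hat ` D0"

text \<open>Composition with \<open>emb\<close> inverts \<open>hat\<close>, so this is the given
  form carried over to \<open>B\<close>.\<close>

definition q :: "((nat \<Rightarrow> real) \<Rightarrow> real) \<Rightarrow> real" where
  "q u = e (\<lambda>x. u (emb x))"

lemma q_hat: "f \<in> A \<Longrightarrow> q (hat f) = e f"
  by (simp add: q_def hat_emb)

lemma B_sq: "b \<in> B \<Longrightarrow> b \<in> square_integrable M"
  by (auto simp: B_def D0_in_A hat_square_integrable)

lemma B_contraction:
  fixes F :: "real \<Rightarrow> real"
  assumes b: "b \<in> B" and F: "F 0 = 0" "\<And>s t. \<bar>F s - F t\<bar> \<le> \<bar>s - t\<bar>"
  shows "(\<lambda>y. F (b y)) \<in> B" "q (\<lambda>y. F (b y)) \<le> q b"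
proof -
  obtain f where f: "f \<in> D0" "b = hat f" using b by (auto simp: B_def)
  note c = contraction_in_D[OF D0_in_D[OF f(1)] F] D0_contraction[OF f(1) F]
  have eq: "(\<lambda>y. F (b y)) = hat (\<lambda>x. F (f x))" using c(3) f(2) by simp
  show "(\<lambda>y. F (b y)) \<in> B" unfolding eq B_def using c(4) by auto
  show "q (\<lambda>y. F (b y)) \<le> q b" 
    unfolding eq unfolding f(2) q_hat[OF D0_in_A[OF c(4)]] q_hat[OF D0_in_A[OF f(1)]] by (rule c(2))
qed

sublocale relaxable_form M B q
proof
  fix u assume "u \<in> B"
  then obtain f where f: "f \<in> D0" "u = hat f" by (auto simp: B_def)
  show "(\<lambda>x. c * u x) \<in> B" for c
    using imageI[OF D0_cmult[OF f(1)], of hat] unfolding B_def f(2) hat_cmult[OF D0_in_A[OF f(1)]] .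
  show "0 \<le> q u" by (simp add: q_def e_nonneg)
  show "q (\<lambda>x. c * u x) = c\<^sup>2 * q u" for c
    using D_form.Q_cmult[OF D0_in_D[OF f(1)], of c] by (simp add: f(2) q_def hat_emb[OF D0_in_A[OF f(1)]])
  fix v assume "v \<in> B"
  then obtain h where h: "h \<in> D0" "v = hat h" by (auto simp: B_def)
  show "(\<lambda>x. u x + v x) \<in> B"
    using imageI[OF D0_add[OF f(1) h(1)], of hat]
    unfolding B_def f(2) h(2) hat_add[OF D0_in_A[OF f(1)] D0_in_A[OF h(1)]] .
  show "q (\<lambda>x. u x + v x) + q (\<lambda>x. u x - v x) = 2 * q u + 2 * q v"
    using D_form.parallelogram[OF D0_in_D[OF f(1)] D0_in_D[OF h(1)]]
    by (simp add: f(2) h(2) q_def hat_emb[OF D0_in_A[OF f(1)]] hat_emb[OF D0_in_A[OF h(1)]])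
next
  show "B \<subseteq> square_integrable M" using B_sq by auto
  have "hat (\<lambda>x. 0) = (\<lambda>y. 0)" using hat_cmult[OF D0_in_A[OF D0_zero], of 0] by simp
  then show "(\<lambda>x. 0) \<in> B" using imageI[OF D0_zero, of hat] by (simp add: B_def)
qed

text \<open>Truncation at level \<open>r\<close> moves \<open>hat f\<close> by at most
  \<open>r\<close> uniformly, hence in \<open>L^2\<close> by at most \<open>r\<close> times the
  square root of the mass, and does not raise the energy.\<close>

lemma approx_hat: assumes f: "f \<in> D" shows "approx (hat f) (e f)"
proof (rule approxI[of _ "1 + sqrt (measure M (space M))"])
  show "hat f \<in> square_integrable M" by (rule hat_square_integrable[OF D_in_A[OF f]])
  show "0 < 1 + sqrt (measure M (space M))" by (simp add: add_pos_nonneg)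
  fix r :: real assume r: "0 < r"
  let ?k = "\<lambda>x. f x - max (- r) (min (f x) r)"
  note k = truncate_in_D0[OF f r]
  have [measurable]: "hat f \<in> borel_measurable M" "hat ?k \<in> borel_measurable M"
    using hat_measurable_M D_in_A[OF f] D0_in_A[OF k(1)] by auto
  have "L2_dist M (hat f) (hat ?k) \<le> r * sqrt (measure M (space M))"
    using k(3) r by (intro L2_norm_le_sup) auto
  also have "\<dots> \<le> (1 + sqrt (measure M (space M))) * r" using r by (simp add: algebra_simps)
  finally have "L2_dist M (hat ?k) (hat f) \<le> (1 + sqrt (measure M (space M))) * r"
    by (subst L2_norm_diff_commute)
  moreover have "q (hat ?k) \<le> e f + (1 + sqrt (measure M (space M))) * r"
    using k(2) r by (simp add: q_hat D0_in_A[OF k(1)] add_increasing2)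
  ultimately show "\<exists>h\<in>B. L2_dist M h (hat f) \<le> (1 + sqrt (measure M (space M))) * r \<and>
      q h \<le> e f + (1 + sqrt (measure M (space M))) * r"
    using k(1) by (intro bexI[of _ "hat ?k"]) (auto simp: B_def)
qed

text \<open>In \<open>integral_abs_le_weighted\<close>, \<open>t\<close> is so large that
  \<open>?m / t\<close> uses up at most half of the \<open>L^1\<close> bound \<open>r\<close>; the
  squared \<open>L^2\<close> norm is then at least \<open>r / (2 * t)\<close>.\<close>

lemma L2_lsc:
  assumes f: "f \<in> D" and c: "c < e f"
  shows "\<exists>s>0. \<forall>h\<in>D. e h \<le> c \<longrightarrow> s \<le> L2_dist M (hat h) (hat f)"
proof -
  obtain r where r: "0 < r" "\<And>h. h \<in> D \<Longrightarrow> e h \<le> c \<Longrightarrow> ennreal r \<le> (\<integral>\<^sup>+y. ennreal \<bar>hat f y - hat h y\<bar> \<partial>N)"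
    using lsc_N[OF f c] by blast
  let ?m = "measure M (space M)"
  define t where "t = 2 * ?m / r + 1"
  have t: "0 < t" using r(1) by (simp add: t_def add_nonneg_pos)
  have "r / 2 * t = ?m + r / 2" using r(1) by (simp add: t_def field_simps)
  then have t2: "?m / t \<le> r / 2" unfolding pos_divide_le_eq[OF t] using r(1) by simp
  have "sqrt (r / (2 * t)) \<le> L2_dist M (hat h) (hat f)" if h: "h \<in> D" "e h \<le> c" for h
  proof -
    let ?u = "\<lambda>y. hat f y - hat h y"
    have u: "?u \<in> square_integrable M" by (intro square_integrable_diff hat_square_integrable D_in_A f h)
    \<comment> \<open>\<open>N\<close> may charge points off \<open>Y\<close>, but the integrand
      vanishes there, so the restriction to \<open>Y\<close> keeps the integral.\<close>
    have "?u y = 0" if "y \<notin> Y" for y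
      using that hat_zero[OF D_in_A] hat_outside f h by (auto simp: Y_def)
    then have "(\<integral>\<^sup>+y. ennreal \<bar>?u y\<bar> \<partial>N) = (\<integral>\<^sup>+y. ennreal \<bar>?u y\<bar> * indicator Y y \<partial>N)"
      by (intro nn_integral_cong) (auto simp: indicator_def)
    also have "\<dots> = (\<integral>\<^sup>+y. ennreal \<bar>?u y\<bar> \<partial>M)"
      unfolding M_def by (rule nn_integral_restrict_space[OF Y_in_sets_N, symmetric])
    also have "\<dots> = ennreal (\<integral>y. \<bar>?u y\<bar> \<partial>M)"
      by (intro nn_integral_eq_integral integral_abs_le_weighted(1)[OF u t]) auto
    finally have "ennreal r \<le> ennreal (\<integral>y. \<bar>?u y\<bar> \<partial>M)" using r(2)[OF h] by simp
    then have "r \<le> (\<integral>y. \<bar>?u y\<bar> \<partial>M)" by (simp add: ennreal_le_iff)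
    also have "\<dots> \<le> t * (L2_norm M ?u)\<^sup>2 + ?m / t" by (rule integral_abs_le_weighted(2)[OF u t])
    finally have "r / 2 \<le> t * (L2_norm M ?u)\<^sup>2" using t2 by linarith
    then have "r / (2 * t) \<le> (L2_norm M ?u)\<^sup>2" using t by (simp add: field_simps)
    then have "sqrt (r / (2 * t)) \<le> sqrt ((L2_norm M ?u)\<^sup>2)" by (rule real_sqrt_le_mono)
    then have "sqrt (r / (2 * t)) \<le> L2_norm M ?u" by (simp add: L2_norm_nonneg)
    then show ?thesis by (subst L2_norm_diff_commute)
  qed
  moreover have "0 < sqrt (r / (2 * t))" using r(1) t by simp
  ultimately show ?thesis by blast
qed

text \<open>The upper bound comes from truncation, the lower one from \<open>L^2\<close> lower
  semicontinuity on \<open>D\<close>.\<close>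

lemma rel_hat: assumes f: "f \<in> D" shows "rel (hat f) = e f"
proof (rule rel_eqI[OF approx_hat[OF f]])
  fix c assume "c < e f"
  then obtain s where "0 < s" "\<And>h. h \<in> D \<Longrightarrow> e h \<le> c \<Longrightarrow> s \<le> L2_dist M (hat h) (hat f)"
    using L2_lsc[OF f] by blast
  then show "\<exists>s>0. \<forall>g\<in>B. q g \<le> c \<longrightarrow> s \<le> L2_dist M g (hat f)"
    by (intro exI[of _ s]) (auto simp: B_def q_hat D0_in_A D0_in_D)
qed

text \<open>Bumps of width \<open>1/n\<close> around \<open>L\<close> decrease to its indicator. For
  large \<open>n\<close> the bump vanishes at the origin and so comes from \<open>A\<close>; a
  uniform approximation then replaces it by a member of \<open>B\<close>.\<close>

lemma indicator_compact_approx: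
  assumes L: "compact L" "L \<subseteq> Y" and d: "0 < d"
  shows "\<exists>b\<in>B. (\<integral>y. \<bar>indicator L y - b y\<bar> \<partial>M) < d"
proof (cases "L = {}")
  case True
  then show ?thesis using zero_in_B d by (intro bexI[of _ "\<lambda>_. 0"]) auto
next
  case False
  have L_borel: "L \<in> sets M" using L by (auto simp: sets_M_iff compact_imp_closed)
  define f where "f n y = max 0 (1 - real n * infdist y L)" for n y
  have f_meas [measurable]: "f n \<in> borel_measurable M" for n
    unfolding M_def f_def
    by (intro measurable_restrict_space1) (simp add: measurable_cong_sets[OF sets_N refl] borel_measurable_continuous_onI continuous_intros)
  have "(\<lambda>n. \<integral>y. \<bar>indicator L y - f n y\<bar> \<partial>M) \<longlonglongrightarrow> (\<integral>y. 0 \<partial>M)"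
  proof (rule integral_dominated_convergence[where w = "\<lambda>_. 1"])
    show "AE y in M. (\<lambda>n. \<bar>indicator L y - f n y\<bar>) \<longlonglongrightarrow> 0"
    proof (intro AE_I2 tendsto_eventually)
      fix y
      show "\<forall>\<^sub>F n in sequentially. \<bar>indicator L y - f n y\<bar> = 0"
      proof (cases "y \<in> L")
        case True
        then show ?thesis by (simp add: f_def)
      next
        case False
        then have pos: "0 < infdist y L"
          using in_closed_iff_infdist_zero[OF compact_imp_closed[OF L(1)] \<open>L \<noteq> {}\<close>] infdist_nonneg[of y L]
          by (metis less_le)
        obtain n0 :: nat where n0: "1 < real n0 * infdist y L" using reals_Archimedean3[OF pos] by blast
        have "f n y = 0" if "n0 \<le> n" for n
        proof -
          have "real n0 * infdist y L \<le> real n * infdist y L" using that pos by (intro mult_right_mono) auto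
          then show ?thesis using n0 by (simp add: f_def)
        qed
        then show ?thesis using False by (intro eventually_sequentiallyI[of n0]) auto
      qed
    qed
    show "AE y in M. norm \<bar>indicator L y - f n y\<bar> \<le> 1" for n
      by (intro AE_I2) (auto simp: f_def indicator_def infdist_nonneg)
  qed (use L_borel in auto)
  then have "\<forall>\<^sub>F n in sequentially. (\<integral>y. \<bar>indicator L y - f n y\<bar> \<partial>M) < d/2"
    using d by (intro order_tendstoD(2)) auto
  then obtain n1 where n1: "\<And>n. n1 \<le> n \<Longrightarrow> (\<integral>y. \<bar>indicator L y - f n y\<bar> \<partial>M) < d/2"
    by (auto simp: eventually_sequentially)
  have pos: "0 < infdist (\<lambda>_. 0) L"
    using in_closed_iff_infdist_zero[OF compact_imp_closed[OF L(1)] False, of "\<lambda>_. 0"] infdist_nonneg[of "\<lambda>_. 0" L]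
      L(2) zero_notin_Y by (metis less_le subsetD)
  obtain n0 :: nat where n0: "1 < real n0 * infdist (\<lambda>_. 0) L" using reals_Archimedean3[OF pos] by blast
  define n where "n = max n0 n1"
  have "real n0 * infdist (\<lambda>_. 0) L \<le> real n * infdist (\<lambda>_. 0) L"
    using pos by (intro mult_right_mono) (auto simp: n_def)
  then obtain h where h: "h \<in> A" "\<And>y. y \<in> K \<Longrightarrow> hat h y = f n y"
    using compact_bump[OF L False, of n] n0 unfolding f_def by fastforce
  let ?m = "measure M (space M)"
  \<comment> \<open>The uniform error \<open>r\<close> adds \<open>r * ?m\<close> to the integral;
    the added one in the denominator covers total mass 0 and makes the bound strict.\<close>
  define r where "r = d / (2 * (?m + 1))"
  have p: "0 < 2 * (?m + 1)" by (simp add: add_nonneg_pos)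
  have "0 < r" unfolding r_def by (rule divide_pos_pos[OF d p])
  moreover have "r * (2 * (?m + 1)) = d" unfolding r_def using p by simp
  ultimately have r: "0 < r" "r * ?m < d / 2" by (simp_all add: algebra_simps)
  obtain k where k: "k \<in> D0" "\<And>y. \<bar>hat h y - hat k y\<bar> < r" using D0_sup_dense[OF h(1) r(1)] by blast
  have [measurable]: "hat k \<in> borel_measurable M" by (rule hat_measurable_M[OF D0_in_A[OF k(1)]])
  have int: "integrable M (\<lambda>y. \<bar>indicator L y - f n y\<bar>)"
  proof (rule integrable_const_bound[where B = 1])
    show "AE y in M. norm \<bar>indicator L y - f n y\<bar> \<le> 1"
      by (intro AE_I2) (auto simp: f_def indicator_def infdist_nonneg)
    note [measurable] = L_borel
    show "(\<lambda>y. \<bar>indicator L y - f n y\<bar>) \<in> borel_measurable M" by measurable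
  qed
  have "integrable M (hat k)"
    using integral_abs_le_weighted(1)[OF hat_square_integrable[OF D0_in_A[OF k(1)]], of 1] by (simp add: integrable_abs_iff)
  then have int2: "integrable M (\<lambda>y. \<bar>indicator L y - hat k y\<bar>)"
    using L_borel
    by (intro integrable_abs Bochner_Integration.integrable_diff integrable_real_indicator)
      (auto simp: emeasure_eq_measure)
  have "(\<integral>y. \<bar>indicator L y - hat k y\<bar> \<partial>M) \<le> (\<integral>y. \<bar>indicator L y - f n y\<bar> + r \<partial>M)"
  proof (rule integral_mono[OF int2])
    fix y assume "y \<in> space M"
    then have "hat h y = f n y" using h(2) Y_subset by (auto simp: space_M)
    then show "\<bar>indicator L y - hat k y\<bar> \<le> \<bar>indicator L y - f n y\<bar> + r" using k(2)[of y] by linarith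
  qed (use int in auto)
  also have "\<dots> = (\<integral>y. \<bar>indicator L y - f n y\<bar> \<partial>M) + r * ?m" using int by simp
  also have "\<dots> < d" using n1[of n] r(2) by (simp add: n_def)
  finally show ?thesis using k(1) by (auto simp: B_def)
qed

text \<open>Inner regularity approximates a measurable set by compact subsets, for which
  \<open>indicator_compact_approx\<close> is available.\<close>

lemma dense_B: "L2_dense M B"
proof (rule L2_denseI)
  show "(\<lambda>x. max (- c) (min (b x) c)) \<in> B" if "0 < c" "b \<in> B" for c b
    using that by (intro B_contraction[where F = "\<lambda>s. max (- c) (min s c)"]) auto
  show "\<exists>b\<in>B. (\<integral>x. \<bar>indicator X x - b x\<bar> \<partial>M) < d" if X: "X \<in> sets M" and d: "0 < d" for X d
  proof -
    let ?C = "{L. compactin (top_of_set Y) L \<and> L \<subseteq> X}"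
    have SUP: "emeasure M X = (SUP L\<in>?C. emeasure M L)"
      using radon_M X by (simp add: radon_measure_def)
    have "\<exists>L\<in>?C. emeasure M X < emeasure M L + ennreal (d/2)"
    proof (rule ccontr)
      assume "\<not> ?thesis"
      then have "(SUP L\<in>?C. emeasure M L + ennreal (d/2)) \<le> emeasure M X"
        by (intro SUP_least) (auto simp: not_less)
      moreover have "?C \<noteq> {}" by (auto intro!: exI[of _ "{}"])
      ultimately have "emeasure M X + ennreal (d/2) \<le> emeasure M X"
        using SUP by (simp add: ennreal_SUP_add_left)
      then show False using d by (simp add: emeasure_eq_measure flip: ennreal_plus)
    qed
    then obtain L where L: "compactin (top_of_set Y) L" "L \<subseteq> X" "emeasure M X < emeasure M L + ennreal (d/2)"
      by auto
    have cL: "compact L" "L \<subseteq> Y" using L(1) by (auto simp: compactin_subtopology)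
    then have LM [measurable]: "L \<in> sets M" by (simp add: sets_M_iff compact_imp_closed)
    note X [measurable]
    have m: "measure M X < measure M L + d/2"
      using L(3) d by (simp add: emeasure_eq_measure ennreal_less_iff flip: ennreal_plus)
    obtain b where b: "b \<in> B" "(\<integral>y. \<bar>indicator L y - b y\<bar> \<partial>M) < d/2"
      using indicator_compact_approx[OF cL, of "d/2"] d by auto
    have b_int: "integrable M b"
      using integral_abs_le_weighted(1)[OF B_sq[OF b(1)], of 1] square_integrableD(1)[OF B_sq[OF b(1)]]
      by (simp add: integrable_abs_iff)
    have ind: "integrable M (indicator Z :: _ \<Rightarrow> real)" if "Z \<in> sets M" for Z
      using that by (intro integrable_real_indicator) (auto simp: emeasure_eq_measure)
    have int: "integrable M (\<lambda>y. \<bar>indicator Z y - b y\<bar>)" if "Z \<in> sets M" for Z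
      by (intro integrable_abs Bochner_Integration.integrable_diff ind that b_int)
    have XL: "X - L \<in> sets M" by measurable
    have "(\<integral>y. \<bar>indicator X y - b y\<bar> \<partial>M) \<le> (\<integral>y. indicator (X - L) y + \<bar>indicator L y - b y\<bar> \<partial>M)"
    proof (rule integral_mono)
      show "\<bar>indicator X y - b y\<bar> \<le> indicator (X - L) y + \<bar>indicator L y - b y\<bar>" for y
        using L(2) by (auto simp: indicator_def)
    qed (intro Bochner_Integration.integrable_add int ind XL X LM)+
    also have "\<dots> = measure M (X - L) + (\<integral>y. \<bar>indicator L y - b y\<bar> \<partial>M)"
      using XL sets.sets_into_space[OF XL]
      by (subst Bochner_Integration.integral_add[OF ind[OF XL] int[OF LM]]) (simp add: Int_absorb2)
    also have "measure M (X - L) = measure M X - measure M L"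
      using L(2) by (intro finite_measure_Diff) auto
    finally show ?thesis using m b by (intro bexI[OF _ b(1)]) simp
  qed
qed (use B_sq V_add V_cmult in auto)

lemma dirichlet: "dirichlet_form M relaxed.polar dom"
proof (rule dirichlet_form_relaxed[OF dense_B])
  show "(\<lambda>x. max (min (h x) 1) 0) \<in> B \<and> q (\<lambda>x. max (min (h x) 1) 0) \<le> q h" if "h \<in> B" for h
    using B_contraction[OF that, of "\<lambda>s. max (min s 1) 0"] by auto
qed

text \<open>Form-norm density holds by the construction of the relaxation; uniform density follows
  as every compactly supported function comes from \<open>A\<close>.\<close>

lemma core: "form_core (top_of_set Y) M relaxed.polar dom B"
  unfolding form_core_def
proof (intro conjI ballI allI impI)
  show "B \<subseteq> Cc (top_of_set Y) \<inter> dom"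
    using approx_in_B domI by (auto simp: B_def D0_def)
  show "\<exists>g\<in>B. form_norm M relaxed.polar (\<lambda>y. f y - g y) < r" if "f \<in> dom" "0 < r" for f r
    using B_dense_in_dom that by blast
  fix u and r :: real assume u: "u \<in> Cc (top_of_set Y)" and r: "0 < r"
  obtain f where "f \<in> A" "u = hat f" using Cc_imp_hat[OF u] .
  then show "\<exists>g\<in>B. \<forall>y\<in>topspace (top_of_set Y). \<bar>u y - g y\<bar> < r"
    using D0_sup_dense[OF _ r, of f] by (metis B_def imageI)
qed

lemma hat_image_in_dom: "hat ` D \<subseteq> dom"
  using approx_hat domI by auto

lemma polar_hat: "f \<in> D \<Longrightarrow> ennreal (relaxed.polar (hat f) (hat f)) = E f"
  using relaxed.polar_self[of "hat f"] hat_image_in_dom rel_hat by (auto simp: E_eq)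

end

section \<open>The isomorphism and preservation of the supremum norm\<close>

context contractive_form
begin

lemma isomorphism_hat: "algebra_isomorphism D (hat ` D) hat"
  unfolding algebra_isomorphism_def
proof (intro conjI ballI allI)
  have hD: "hat f \<in> hat ` D" if "f \<in> D" for f using that by auto
  show "function_algebra (hat ` D)"
    unfolding function_algebra_def
  proof (intro conjI ballI allI)
    show "(\<lambda>x. 0) \<in> hat ` D"
      using hD[OF zero_in_D] hat_cmult[OF D_in_A[OF zero_in_D], of 0] by simp
    show "(\<lambda>x. u x + v x) \<in> hat ` D" if "u \<in> hat ` D" "v \<in> hat ` D" for u v
      using that hat_add[symmetric] by (auto simp: D_in_A intro!: hD D_add)
    show "(\<lambda>x. u x * v x) \<in> hat ` D" if "u \<in> hat ` D" "v \<in> hat ` D" for u v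
      using that hat_mult[symmetric] by (auto simp: D_in_A intro!: hD D_mult)
    show "(\<lambda>x. c * u x) \<in> hat ` D" if "u \<in> hat ` D" for c u
      using that hat_cmult[symmetric] by (auto simp: D_in_A intro!: hD D_cmult)
  qed
  show "bij_betw hat D (hat ` D)"
    by (rule inj_on_imp_bij_betw[OF inj_on_subset[OF inj_on_hat]]) (auto simp: D_in_A)
qed (auto simp: algebra_D hat_add hat_cmult hat_mult D_in_A)

text \<open>The extension of a strictly positive function vanishes at the origin but at no embedded
  point. This is how sigma-finiteness enters.\<close>

lemma emb_in_Y:
  assumes "h \<in> A" "\<And>x. 0 < h x" shows "emb x \<in> Y"
  using emb_in_K[of x] hat_emb[OF assms(1), of x] hat_zero[OF assms(1)] assms(2)[of x] by (auto simp: Y_def)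

text \<open>One inequality is \<open>hat_bound\<close>; the other holds because all embedded points
  survive in \<open>Y\<close>.\<close>

lemma SUP_hat:
  assumes f: "f \<in> A" and emb: "\<And>x. emb x \<in> Y"
  shows "(SUP y\<in>Y. ereal \<bar>hat f y\<bar>) = (SUP x. ereal \<bar>f x\<bar>)"
proof (rule antisym)
  obtain b where b: "\<And>x. \<bar>f x\<bar> \<le> b" using bounded_A[OF f] by (auto simp: bounded_iff)
  let ?S = "SUP x. ereal \<bar>f x\<bar>"
  have up: "ereal \<bar>f x\<bar> \<le> ?S" for x by (rule SUP_upper) simp
  have "?S \<le> ereal b" by (rule SUP_least) (simp add: b)
  then obtain t where t: "?S = ereal t" using up[of undefined] by (cases ?S) auto
  then have "\<bar>hat f y\<bar> \<le> t" for y using up by (intro hat_bound[OF f]) simp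
  then show "(SUP y\<in>Y. ereal \<bar>hat f y\<bar>) \<le> ?S" unfolding t by (intro SUP_least) simp
  show "(SUP x. ereal \<bar>f x\<bar>) \<le> (SUP y\<in>Y. ereal \<bar>hat f y\<bar>)"
    using emb by (intro SUP_least SUP_upper2[of "emb _"]) (auto simp: hat_emb[OF f])
qed

end

theorem theorem1p1:
  fixes A :: "('a \<Rightarrow> real) set"
    and E :: "('a \<Rightarrow> real) \<Rightarrow> ennreal"
  assumes "bounded_function_algebra A"
    and "uniformly_closed A"
    and "countably_generated A"
    and "separates_points A"
    and "quadratic_form_on A E"
    and "sup_norm_separable A E"
    and "sigma_finite_form A E"
    and "sup_norm_lsc A E"
    and "normal_contractions_operate A E"
  shows "\<exists>(Y :: (nat \<Rightarrow> real) metric) (\<nu> :: (nat \<Rightarrow> real) measure)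
            (Eh :: ((nat \<Rightarrow> real) \<Rightarrow> real) \<Rightarrow> ((nat \<Rightarrow> real) \<Rightarrow> real) \<Rightarrow> real)
            (Fh :: ((nat \<Rightarrow> real) \<Rightarrow> real) set)
            (Dh :: ((nat \<Rightarrow> real) \<Rightarrow> real) set)
            (hat :: ('a \<Rightarrow> real) \<Rightarrow> (nat \<Rightarrow> real) \<Rightarrow> real).
           locally_compact_space (mtopology_of Y) \<and> separable_space (mtopology_of Y) \<and>
           radon_measure (mtopology_of Y) \<nu> \<and> full_support (mtopology_of Y) \<nu> \<and>
           regular_dirichlet_form (mtopology_of Y) \<nu> Eh Fh \<and>
           function_algebra Dh \<and> Dh \<subseteq> continuous_functions (mtopology_of Y) \<and> Dh \<subseteq> Fh \<and>
           bij_betw hat (effective_domain A E) Dh \<and>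
           algebra_isomorphism (effective_domain A E) Dh hat \<and>
           (\<forall>f\<in>effective_domain A E.
              (SUP y\<in>mspace Y. ereal \<bar>hat f y\<bar>) = (SUP x. ereal \<bar>f x\<bar>)) \<and>
           (\<forall>f\<in>effective_domain A E. ennreal (Eh (hat f) (hat f)) = E f) \<and>
           (\<exists>C\<subseteq>Dh. form_core (mtopology_of Y) \<nu> Eh Fh C)"
proof -
  obtain g where g: "generates g A" "\<And>n. E (g n) < \<infinity>"
    using assms(6) by (auto simp: sup_norm_separable_def)
  obtain h where h: "h \<in> A" "\<And>x. 0 < h x" using assms(7) by (auto simp: sigma_finite_form_def)
  interpret contractive_form A g E by unfold_locales (fact assms g)+
  have emb: "emb x \<in> Y" for x by (rule emb_in_Y[OF h])
  obtain N where N: "sets N = sets borel" "emeasure N UNIV < \<infinity>"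
    "\<And>U. open U \<Longrightarrow> U \<inter> Y \<noteq> {} \<Longrightarrow> 0 < emeasure N (U \<inter> Y)"
    "\<And>f c. f \<in> D \<Longrightarrow> c < e f \<Longrightarrow>
      \<exists>r>0. \<forall>h\<in>D. e h \<le> c \<longrightarrow> ennreal r \<le> (\<integral>\<^sup>+y. ennreal \<bar>hat f y - hat h y\<bar> \<partial>N)"
    by (rule lower_semicontinuity_measure) blast
  interpret contractive_form_measure A g E N by unfold_locales (fact N)+
  \<comment> \<open>\<open>Y\<close> carries the restriction of the metric of
    \<open>nat => real\<close>, which induces the product topology.\<close>
  have top: "mtopology_of (submetric euclidean_metric Y) = top_of_set Y"
    by (simp add: mtopology_of_submetric)
  have mspace: "mspace (submetric euclidean_metric Y) = Y" by simp
  have D: "effective_domain A E = D" by (simp add: D_def)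
  have "B \<subseteq> hat ` D" by (auto simp: B_def D0_in_D)
  have "locally_compact_space (top_of_set Y) \<and> separable_space (top_of_set Y) \<and>
      radon_measure (top_of_set Y) M \<and> full_support (top_of_set Y) M \<and>
      regular_dirichlet_form (top_of_set Y) M relaxed.polar dom \<and>
      function_algebra (hat ` D) \<and> hat ` D \<subseteq> continuous_functions (top_of_set Y) \<and> hat ` D \<subseteq> dom \<and>
      bij_betw hat D (hat ` D) \<and> algebra_isomorphism D (hat ` D) hat \<and>
      (\<forall>f\<in>D. (SUP y\<in>Y. ereal \<bar>hat f y\<bar>) = (SUP x. ereal \<bar>f x\<bar>)) \<and>
      (\<forall>f\<in>D. ennreal (relaxed.polar (hat f) (hat f)) = E f) \<and>
      (\<exists>C\<subseteq>hat ` D. form_core (top_of_set Y) M relaxed.polar dom C)"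
  proof (intro conjI ballI locally_compact_Y separable_Y radon_M full_support_M isomorphism_hat hat_image_in_dom)
    show "regular_dirichlet_form (top_of_set Y) M relaxed.polar dom"
      unfolding regular_dirichlet_form_def using dirichlet core by blast
    show "function_algebra (hat ` D)" "bij_betw hat D (hat ` D)"
      using isomorphism_hat by (simp_all add: algebra_isomorphism_def)
    show "hat ` D \<subseteq> continuous_functions (top_of_set Y)"
      using hat_in_continuous_functions D_in_A by blast
    show "\<exists>C\<subseteq>hat ` D. form_core (top_of_set Y) M relaxed.polar dom C"
      using \<open>B \<subseteq> hat ` D\<close> core by blast
  qed (auto intro: SUP_hat D_in_A emb polar_hat)
  then show ?thesis
    unfolding D
    by - (rule exI[of _ "submetric euclidean_metric Y"], rule exI[of _ M], rule exI[of _ relaxed.polar],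
      rule exI[of _ dom], rule exI[of _ "hat ` D"], rule exI[of _ hat], unfold top mspace, assumption)
qed

end
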